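(* Let $(k_0,\mathbf{k})\in\mathbb{N}^{d+1}$ and suppose that the mixed multiplicity $e(J^{[k_0+1]},\mathbf{I}^{[\mathbf{k}]};N)$ is defined. Let $\mathbf{x}$ be a weak-$(FC)$-sequence of $N$ with respect to $J,\mathbf{I}$ of the type $(h_0,\mathbf{h})$ with $(h_0,\mathbf{h})\le(k_0,\mathbf{k})$. Then $e(J^{[k_0-h_0+1]},\mathbf{I}^{[\mathbf{k}-\mathbf{h}]};N/\mathbf{x}N)$ is defined and $$e\big(J^{[k_0+1]},\mathbf{I}^{[\mathbf{k}]};N\big)=e\big(J^{[k_0-h_0+1]},\mathbf{I}^{[\mathbf{k}-\mathbf{h}]};N/\mathbf{x}N\big).$$
   Context: $\mathbb{N}$ denotes the nonnegative integers, $d\ge1$; $\le$ on $\mathbb{N}^{d+1}$ is componentwise. $(R,\mathfrak{n})$ is a Noetherian local ring with infinite residue field, $N$ is a finitely generated $R$-module, $J,I_1,\ldots,I_d$ are ideals of $R$ with $J$ being $\mathfrak{n}$-primary. Put $\mathbf{I}=I_1,\ldots,I_d$, $I_0=J$, $I=JI_1\cdots I_d$, and $\mathbb{I}^{\mathbf{n}}=I_1^{n_1}\cdots I_d^{n_d}$. For a module $N$, $0_N:a=\{m\in N:am=0\}$ and $0_N:I^\infty=\bigcup_{t\ge0}\{m\in N: I^tm=0\}$. "For all large $\mathbf{n}$" (or $\mathbf{n}\gg\mathbf{0}$) means every component is sufficiently large. Mixed multiplicities of ideals: for any finitely generated $R$-module $N$, let $T=\bigoplus_{n\ge0,\,\mathbf{n}\ge\mathbf{0}}J^n\mathbb{I}^{\mathbf{n}}/J^{n+1}\mathbb{I}^{\mathbf{n}}$,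 a standard $\mathbb{N}^{d+1}$-graded algebra over the Artinian local ring $R/J$, and $\mathcal{N}=\bigoplus_{n\ge0,\,\mathbf{n}\ge\mathbf{0}}J^n\mathbb{I}^{\mathbf{n}}N/J^{n+1}\mathbb{I}^{\mathbf{n}}N$, a finitely generated $\mathbb{N}^{d+1}$-graded $T$-module. For all large $(n_0,\mathbf{n})$ the length of $\mathcal{N}_{(n_0,\mathbf{n})}$ is given by a polynomial, written uniquely as $\sum_{(k_0,\mathbf{k})\in\mathbb{N}^{d+1}}e(\mathcal{N};k_0,\mathbf{k})\prod_{i=0}^d\binom{n_i+k_i}{k_i}$ with integer coefficients. The mixed multiplicity $e(J^{[k_0+1]},\mathbf{I}^{[\mathbf{k}]};N)$ is defined if $e(\mathcal{N};h_0,\mathbf{h})=0$ for all $(h_0,\mathbf{h})\ne(k_0,\mathbf{k})$ with $(h_0,\mathbf{h})\ge(k_0,\mathbf{k})$; then $e(J^{[k_0+1]},\mathbf{I}^{[\mathbf{k}]};N):=e(\mathcal{N};k_0,\mathbf{k})$. Weak-$(FC)$-sequences: an element $a\in R$ is a weak-$(FC)$-element of $N$ with respect to $J,\mathbf{I}$ if for some $i\in\{0,\ldots,d\}$, $a\in I_i$, $aN\cap J^{n_0}\mathbb{I}^{\mathbf{n}}I_iN=aJ^{n_0}\mathbb{I}^{\mathbf{n}}N$ for all $(n_0,\mathbf{n})\gg\mathbf{0}$, and $0_N:a\subseteq0_N:I^\infty$; it is then counted as an element of $I_i$. A sequence $x_1,\ldots,x_t$ is a weak-$(FC)$-sequence of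 $N$ with respect to $J,\mathbf{I}$ if each $x_{j+1}$ is a weak-$(FC)$-element of $N/(x_1,\ldots,x_j)N$ with respect to $J,\mathbf{I}$ ($0\le j<t$); it is of the type $(k_0,\mathbf{k})$ if it consists of $k_0$ elements of $J$, $k_1$ elements of $I_1$, ..., $k_d$ elements of $I_d$ (in any order). *)

theory Defs
  imports "HOL-Algebra.Algebra" "HOL-Library.Extended_Nat"
begin

section \<open>Local rings and primary ideals\<close>

definition local_ring :: "('a, 'r) ring_scheme \<Rightarrow> 'a set \<Rightarrow> bool" where
  "local_ring R \<nn> \<longleftrightarrow> cring R \<and> {\<mm>. maximalideal \<mm> R} = {\<nn>}"

definition ideal_radical :: "('a, 'r) ring_scheme \<Rightarrow> 'a set \<Rightarrow> 'a set" where
  "ideal_radical R Q = {a \<in> carrier R. \<exists>n::nat. a [^]\<^bsub>R\<^esub> n \<in> Q}"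

definition primary_ideal :: "('a, 'r) ring_scheme \<Rightarrow> 'a set \<Rightarrow> bool" where
  "primary_ideal R Q \<longleftrightarrow> ideal Q R \<and> Q \<noteq> carrier R \<and>
    (\<forall>a\<in>carrier R. \<forall>b\<in>carrier R. a \<otimes>\<^bsub>R\<^esub> b \<in> Q \<longrightarrow> a \<in> Q \<or> b \<in> ideal_radical R Q)"

definition primary_to :: "('a, 'r) ring_scheme \<Rightarrow> 'a set \<Rightarrow> 'a set \<Rightarrow> bool" where
  "primary_to R \<pp> Q \<longleftrightarrow> primary_ideal R Q \<and> ideal_radical R Q = \<pp>"


section \<open>Modules\<close>

definition mod_span :: "('a, 'r) ring_scheme \<Rightarrow> ('a, 'b, 'm) module_scheme \<Rightarrow> 'b set \<Rightarrow> 'b set" where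
  "mod_span R M S = \<Inter>{H. submodule H R M \<and> S \<subseteq> H}"

definition fin_gen_module :: "('a, 'r) ring_scheme \<Rightarrow> ('a, 'b, 'm) module_scheme \<Rightarrow> bool" where
  "fin_gen_module R M \<longleftrightarrow> module R M \<and>
    (\<exists>S \<subseteq> carrier M. finite S \<and> mod_span R M S = carrier M)"

text \<open>The submodule \<open>\<aa>M\<close> for an ideal \<open>\<aa>\<close>.\<close>
definition ideal_smult :: "('a, 'r) ring_scheme \<Rightarrow> 'a set \<Rightarrow> ('a, 'b, 'm) module_scheme \<Rightarrow> 'b set" where
  "ideal_smult R \<aa> M = mod_span R M {a \<odot>\<^bsub>M\<^esub> m |a m. a \<in> \<aa> \<and> m \<in> carrier M}"

text \<open>
  The quotient \<open>M/P\<close> by a submodule \<open>P\<close>. Module records inherit the fields \<open>mult\<close> and \<open>one\<close> from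
  ring records; they play no role in the locale \<open>module\<close>, and are filled in as in \<open>FactRing\<close>.
\<close>
definition quot_module :: "('a, 'b, 'm) module_scheme \<Rightarrow> 'b set \<Rightarrow> ('a, 'b set) module" where
  "quot_module M P =
    \<lparr>carrier = a_rcosets\<^bsub>M\<^esub> P, monoid.mult = rcoset_mult M P, one = P +>\<^bsub>M\<^esub> \<one>\<^bsub>M\<^esub>,
     ring.zero = P, add = set_add M, smult = (\<lambda>r U. \<Union>x\<in>U. P +>\<^bsub>M\<^esub> (r \<odot>\<^bsub>M\<^esub> x))\<rparr>"

text \<open>The length: the supremum of the lengths \<open>t\<close> of chains \<open>C\<^sub>0 \<subset> \<dots> \<subset> C\<^sub>t\<close> of submodules.\<close>
definition module_length :: "('a, 'r) ring_scheme \<Rightarrow> ('a, 'b, 'm) module_scheme \<Rightarrow> enat" where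
  "module_length R M = Sup {enat t |t. \<exists>C :: nat \<Rightarrow> 'b set.
    (\<forall>j\<le>t. submodule (C j) R M) \<and> (\<forall>j<t. C j \<subset> C (Suc j))}"


section \<open>Multi-indices and products of powers of ideals\<close>

text \<open>
  An element \<open>(n\<^sub>0, n\<^sub>1, \<dots>, n\<^sub>d)\<close> of \<open>\<nat>\<^bsup>d+1\<^esup>\<close> is a function \<open>nat \<Rightarrow> nat\<close> vanishing beyond \<open>d\<close>.
  On such functions, \<open>=\<close> and \<open>\<le>\<close> are the componentwise relations.
\<close>
definition multi_indices :: "nat \<Rightarrow> (nat \<Rightarrow> nat) set" where
  "multi_indices d = {n. \<forall>i>d. n i = 0}"

definition for_all_large :: "nat \<Rightarrow> ((nat \<Rightarrow> nat) \<Rightarrow> bool) \<Rightarrow> bool" where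
  "for_all_large d P \<longleftrightarrow> (\<exists>c. \<forall>n\<in>multi_indices d. (\<forall>i\<le>d. c \<le> n i) \<longrightarrow> P n)"

text \<open>
  The ideals \<open>J, I\<^sub>1, \<dots>, I\<^sub>d\<close> form one family \<open>I\<^sub>0, \<dots>, I\<^sub>d\<close> with \<open>I\<^sub>0 = J\<close>. The following is
  \<open>J\<^bsup>n\<^sub>0\<^esup> I\<^sub>1\<^bsup>n\<^sub>1\<^esup> \<cdots> I\<^sub>d\<^bsup>n\<^sub>d\<^esup>\<close>, computed in the multiplicative monoid of ideals, so that the zeroth power
  of an ideal is \<open>R\<close>.
\<close>
definition multi_power ::
  "('a, 'r) ring_scheme \<Rightarrow> nat \<Rightarrow> (nat \<Rightarrow> 'a set) \<Rightarrow> (nat \<Rightarrow> nat) \<Rightarrow> 'a set" where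
  "multi_power R d I n = (\<Otimes>\<^bsub>ideals_set R\<^esub> i \<in> {..d}. I i [^]\<^bsub>ideals_set R\<^esub> n i)"


section \<open>Mixed multiplicities\<close>

text \<open>
  A family \<open>M\<close> of modules stands for the homogeneous components of an \<open>\<nat>\<^bsup>d+1\<^esup>\<close>-graded module.
  \<open>is_hilbert_coeffs R d M e\<close> says that, for all large \<open>n\<close>, the length of \<open>M n\<close> is finite and equal to
  \<open>\<Sum>\<^sub>k e(k) \<Prod>\<^sub>i (n\<^sub>i + k\<^sub>i choose k\<^sub>i)\<close>.
\<close>
definition is_hilbert_coeffs ::
  "('a, 'r) ring_scheme \<Rightarrow> nat \<Rightarrow> ((nat \<Rightarrow> nat) \<Rightarrow> ('a, 'b, 'm) module_scheme) \<Rightarrow>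
    ((nat \<Rightarrow> nat) \<Rightarrow> int) \<Rightarrow> bool" where
  "is_hilbert_coeffs R d M e \<longleftrightarrow>
    finite {k. e k \<noteq> 0} \<and> {k. e k \<noteq> 0} \<subseteq> multi_indices d \<and>
    for_all_large d (\<lambda>n. \<exists>l. module_length R (M n) = enat l \<and>
      int l = (\<Sum>k | e k \<noteq> 0. e k * (\<Prod>i\<le>d. int ((n i + k i) choose k i))))"

definition hilbert_coeff ::
  "('a, 'r) ring_scheme \<Rightarrow> nat \<Rightarrow> ((nat \<Rightarrow> nat) \<Rightarrow> ('a, 'b, 'm) module_scheme) \<Rightarrow>
    (nat \<Rightarrow> nat) \<Rightarrow> int" where
  "hilbert_coeff R d M = (THE e. is_hilbert_coeffs R d M e)"

text \<open>
  The component \<open>J\<^bsup>n\<^sub>0\<^esup>\<I>\<^sup>nN / J\<^bsup>n\<^sub>0+1\<^esup>\<I>\<^sup>nN\<close>. It is annihilated by \<open>J\<close>; its \<open>R\<close>-submodules are its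
  \<open>R/J\<close>-submodules, so its length may be taken over \<open>R\<close>.
\<close>
definition mixed_component ::
  "('a, 'r) ring_scheme \<Rightarrow> nat \<Rightarrow> (nat \<Rightarrow> 'a set) \<Rightarrow> ('a, 'b, 'm) module_scheme \<Rightarrow>
    (nat \<Rightarrow> nat) \<Rightarrow> ('a, 'b set) module" where
  "mixed_component R d I N n =
    quot_module (N\<lparr>carrier := ideal_smult R (multi_power R d I n) N\<rparr>)
      (ideal_smult R (multi_power R d I (n(0 := n 0 + 1))) N)"

text \<open>
  With \<open>k = (k\<^sub>0, k\<^sub>1, \<dots>, k\<^sub>d)\<close>, the following two constants concern
  \<open>e(J\<^bsup>[k\<^sub>0+1]\<^esup>, I\<^sub>1\<^bsup>[k\<^sub>1]\<^esup>, \<dots>, I\<^sub>d\<^bsup>[k\<^sub>d]\<^esup>; N)\<close>. Note the shift by one in the exponent of \<open>J\<close>.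
\<close>
definition mixed_mult_defined ::
  "('a, 'r) ring_scheme \<Rightarrow> nat \<Rightarrow> (nat \<Rightarrow> 'a set) \<Rightarrow> ('a, 'b, 'm) module_scheme \<Rightarrow>
    (nat \<Rightarrow> nat) \<Rightarrow> bool" where
  "mixed_mult_defined R d I N k \<longleftrightarrow>
    (\<forall>h\<in>multi_indices d. h \<noteq> k \<and> k \<le> h \<longrightarrow> hilbert_coeff R d (mixed_component R d I N) h = 0)"

definition mixed_mult ::
  "('a, 'r) ring_scheme \<Rightarrow> nat \<Rightarrow> (nat \<Rightarrow> 'a set) \<Rightarrow> ('a, 'b, 'm) module_scheme \<Rightarrow>
    (nat \<Rightarrow> nat) \<Rightarrow> int" where
  "mixed_mult R d I N k = hilbert_coeff R d (mixed_component R d I N) k"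


section \<open>Weak-(FC)-sequences\<close>

definition annihilated_by :: "('a, 'b, 'm) module_scheme \<Rightarrow> 'a set \<Rightarrow> 'b set" where
  "annihilated_by N A = {m \<in> carrier N. \<forall>a\<in>A. a \<odot>\<^bsub>N\<^esub> m = \<zero>\<^bsub>N\<^esub>}"

text \<open>\<open>0\<^sub>N : \<aa>\<^sup>\<infinity>\<close>\<close>
definition power_torsion ::
  "('a, 'r) ring_scheme \<Rightarrow> ('a, 'b, 'm) module_scheme \<Rightarrow> 'a set \<Rightarrow> 'b set" where
  "power_torsion R N \<aa> = (\<Union>t::nat. annihilated_by N (\<aa> [^]\<^bsub>ideals_set R\<^esub> t))"

text \<open>\<open>a\<close> is a weak-(FC)-element of \<open>N\<close> that is counted as an element of \<open>I\<^sub>i\<close>.\<close>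
definition weak_FC_element ::
  "('a, 'r) ring_scheme \<Rightarrow> nat \<Rightarrow> (nat \<Rightarrow> 'a set) \<Rightarrow> ('a, 'b, 'm) module_scheme \<Rightarrow>
    nat \<Rightarrow> 'a \<Rightarrow> bool" where
  "weak_FC_element R d I N i a \<longleftrightarrow>
    i \<le> d \<and> a \<in> I i \<and>
    for_all_large d (\<lambda>n.
      (\<lambda>m. a \<odot>\<^bsub>N\<^esub> m) ` carrier N \<inter> ideal_smult R (multi_power R d I n \<cdot>\<^bsub>R\<^esub> I i) N
        = (\<lambda>m. a \<odot>\<^bsub>N\<^esub> m) ` ideal_smult R (multi_power R d I n) N) \<and>
    annihilated_by N {a} \<subseteq> power_torsion R N (\<Otimes>\<^bsub>ideals_set R\<^esub> l \<in> {..d}. I l)"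

text \<open>\<open>N/(x\<^sub>1, \<dots>, x\<^sub>t)N\<close>\<close>
definition quot_by_elements ::
  "('a, 'r) ring_scheme \<Rightarrow> ('a, 'b, 'm) module_scheme \<Rightarrow> 'a list \<Rightarrow> ('a, 'b set) module" where
  "quot_by_elements R N xs = quot_module N (ideal_smult R (Idl\<^bsub>R\<^esub> (set xs)) N)"

text \<open>
  The same element may be a weak-(FC)-element with respect to several of the ideals. The list \<open>is\<close>
  records which \<open>I\<^sub>i\<close> each member of the sequence is counted in, and \<open>h\<close> is the resulting type.
\<close>
definition weak_FC_sequence_of_type ::
  "('a, 'r) ring_scheme \<Rightarrow> nat \<Rightarrow> (nat \<Rightarrow> 'a set) \<Rightarrow> ('a, 'b, 'm) module_scheme \<Rightarrow>
    'a list \<Rightarrow> (nat \<Rightarrow> nat) \<Rightarrow> bool" where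
  "weak_FC_sequence_of_type R d I N xs h \<longleftrightarrow>
    (\<exists>is. length is = length xs \<and>
      (\<forall>j<length xs. weak_FC_element R d I (quot_by_elements R N (take j xs)) (is ! j) (xs ! j)) \<and>
      (\<forall>i. h i = count_list is i))"

end

theory Submission
  imports Defs "HOL-Library.Fun_Lexorder"
begin

text \<open>
  Write \<open>M\<^sub>n = J\<^bsup>n\<^sub>0\<^esup> I\<^sub>1\<^bsup>n\<^sub>1\<^esup> \<cdots> I\<^sub>d\<^bsup>n\<^sub>d\<^esup> N\<close>, and \<open>\<epsilon>\<^sub>i\<close> for the \<open>i\<close>-th unit vector, so that the component of degree
  \<open>n\<close> is \<open>M\<^sub>n / M\<^bsub>n+\<epsilon>\<^sub>0\<^esub>\<close>. For a submodule \<open>P\<close> let \<open>H\<^sub>P(n)\<close> be the length of this component formed for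
  \<open>N/P\<close>. The theorem rests on one identity: if \<open>a \<in> I\<^sub>i\<close> is a weak-(FC)-element of \<open>N/P\<close> and
  \<open>P' = P + aN\<close>, then \<open>H\<^bsub>P'\<^esub>(n) = H\<^sub>P(n) - H\<^sub>P(n - \<epsilon>\<^sub>i)\<close> for all large \<open>n\<close>
  (\<open>rel_hilbert_function_step\<close>). Indeed, put \<open>m = n - \<epsilon>\<^sub>i\<close>. The intersection condition says that
  what is lost from \<open>(M\<^sub>n + P)/(M\<^bsub>n+\<epsilon>\<^sub>0\<^esub> + P)\<close> on passing to \<open>P'\<close> is
  \<open>(aM\<^sub>m + P)/(aM\<^bsub>m+\<epsilon>\<^sub>0\<^esub> + P)\<close>, and multiplication by \<open>a\<close> identifies this with the component of
  degree \<open>m\<close>, because its kernel \<open>P : a\<close> meets \<open>M\<^sub>m + P\<close> only in \<open>P\<close> (\<open>len_quotient_by_mul\<close>). This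
  last fact holds for large \<open>m\<close> since \<open>P : a\<close> is torsion modulo \<open>P\<close> for powers of \<open>J I\<^sub>1 \<cdots> I\<^sub>d\<close>
  (\<open>ideal_power_meets_torsion_trivially\<close>).

  By Pascal's rule the difference in direction \<open>i\<close> of \<open>\<Sum>\<^sub>k e(k) \<Prod>\<^sub>i (n\<^sub>i + k\<^sub>i choose k\<^sub>i)\<close> has the
  coefficients \<open>k \<mapsto> e(k + \<epsilon>\<^sub>i)\<close> (\<open>binomial_sum_shift\<close>). Along a weak-(FC)-sequence \<open>x\<close> of type \<open>h\<close>
  the coefficients therefore become \<open>k \<mapsto> e(k + h)\<close> (\<open>has_hilbert_coeffs_sequence\<close>), and both claims
  are read off from this formula.

  All modules \<open>N/(x\<^sub>1, \<dots>, x\<^sub>j)N\<close> are handled inside \<open>N\<close>: the length of a subquotient is the height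
  of an interval in the lattice of submodules of \<open>N\<close>, and lengths are compared by means of the modular
  law and of multiplication by ring elements.

  The coefficients are given by a definite description, so it also has to be shown that they exist and
  are unique. Uniqueness again follows by taking differences (\<open>binomial_sum_zero_imp\<close>). For existence
  (\<open>hilbert_polynomial_exists\<close>), choose finite sets of generators of the ideals and filter
  \<open>M\<^sub>n / M\<^bsub>n+\<epsilon>\<^sub>0\<^esub>\<close> along the monomials of multidegree \<open>n\<close> in these generators, ordered
  lexicographically. The factor belonging to \<open>x\<^sup>\<alpha>\<close> is \<open>N / L(\<alpha>)\<close>, where \<open>L(\<alpha>)\<close> consists of the \<open>m\<close>
  for which \<open>x\<^sup>\<alpha> m\<close> lies in the span of the smaller terms (\<open>len_filtration\<close>). As \<open>L\<close> is increasing and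
  \<open>N\<close> is Noetherian, \<open>L(\<alpha>)\<close> depends only on \<open>min(\<alpha>, c)\<close> for some constant \<open>c\<close>
  (\<open>monotone_multiindex_stable\<close>); as \<open>JN \<subseteq> L(\<alpha>)\<close> and \<open>J\<close> is primary to the maximal ideal, the factor
  has finite length (\<open>finite_len_above_primary\<close>). So the length of \<open>M\<^sub>n / M\<^bsub>n+\<epsilon>\<^sub>0\<^esub>\<close> is a sum over all
  exponent vectors \<open>\<alpha>\<close> of multidegree \<open>n\<close> of a function of \<open>min(\<alpha>, c)\<close>, and such a sum is eventually a
  polynomial in \<open>n\<close> (\<open>multi_numerical_exponents_sum\<close>).
\<close>

section \<open>Heights of families of sets\<close>

definition has_chain :: "'a set set \<Rightarrow> nat \<Rightarrow> bool" where
  "has_chain S t \<longleftrightarrow> (\<exists>C :: nat \<Rightarrow> 'a set. (\<forall>j\<le>t. C j \<in> S) \<and> (\<forall>j<t. C j \<subset> C (Suc j)))"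

text \<open>
  For the family of all submodules of a module this is the length; for the submodules between \<open>P\<close> and
  \<open>Q\<close> it is the length of \<open>Q/P\<close>.
\<close>
definition height :: "'a set set \<Rightarrow> enat" where
  "height S = Sup {enat t |t. has_chain S t}"

lemma has_chain_le: "has_chain S t" if "has_chain S s" "t \<le> s"
  using that unfolding has_chain_def by (meson le_trans less_le_trans)

lemma has_chain_0: "has_chain S 0 \<longleftrightarrow> S \<noteq> {}"
  unfolding has_chain_def by auto

text \<open>
  The supremum is attained whenever it is finite, because an initial segment of a chain is a chain.
\<close>
lemma le_height_iff: "enat t \<le> height S \<longleftrightarrow> has_chain S t" if "S \<noteq> {}"
proof
  assume "has_chain S t"
  then show "enat t \<le> height S" unfolding height_def by (intro Sup_upper) blast
next
  assume le: "enat t \<le> height S"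
  show "has_chain S t"
  proof (rule ccontr)
    assume no: "\<not> has_chain S t"
    with has_chain_0 that have "t > 0" by (cases t) auto
    have "height S \<le> enat (t - 1)"
      unfolding height_def
    proof (rule Sup_least)
      fix x assume "x \<in> {enat s |s. has_chain S s}"
      then obtain s where "x = enat s" "has_chain S s" by blast
      moreover from this no have "s < t" using has_chain_le by (meson not_le)
      ultimately show "x \<le> enat (t - 1)" by simp
    qed
    with le have "enat t \<le> enat (t - 1)" by (rule order_trans)
    with \<open>t > 0\<close> show False by simp
  qed
qed

lemma height_le_enat_iff: "height S \<le> enat m \<longleftrightarrow> (\<forall>t. has_chain S t \<longrightarrow> t \<le> m)"
  unfolding height_def by (auto simp: Sup_le_iff)

lemma height_mono_map:
  assumes "\<And>W. W \<in> S \<Longrightarrow> f W \<in> T"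
    and "\<And>W Y. W \<in> S \<Longrightarrow> Y \<in> S \<Longrightarrow> W \<subset> Y \<Longrightarrow> f W \<subset> f Y"
  shows "height S \<le> height T"
  unfolding height_def
proof (rule Sup_subset_mono, safe)
  fix t assume "has_chain S t"
  then obtain C where "\<forall>j\<le>t. C j \<in> S" "\<forall>j<t. C j \<subset> C (Suc j)"
    unfolding has_chain_def by blast
  with assms have "(\<forall>j\<le>t. f (C j) \<in> T) \<and> (\<forall>j<t. f (C j) \<subset> f (C (Suc j)))"
    by (metis less_imp_le_nat Suc_leI)
  then have "has_chain T t" unfolding has_chain_def by (intro exI[of _ "\<lambda>j. f (C j)"])
  then show "\<exists>t'. enat t = enat t' \<and> has_chain T t'" by blast
qed

text \<open>
  A weakly increasing sequence becomes a chain once repetitions are dropped.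
\<close>
lemma has_chain_weak:
  assumes "\<forall>j\<le>t. D j \<in> S" and "\<forall>j<t. D j \<subseteq> D (Suc j)"
  shows "has_chain S (card {j. j < t \<and> D j \<noteq> D (Suc j)})"
proof -
  have "\<exists>E. (\<forall>j\<le>card {j. j < t \<and> D j \<noteq> D (Suc j)}. E j \<in> S) \<and>
      (\<forall>j<card {j. j < t \<and> D j \<noteq> D (Suc j)}. E j \<subset> E (Suc j)) \<and>
      E (card {j. j < t \<and> D j \<noteq> D (Suc j)}) = D t"
    using assms
  proof (induction t)
    case 0
    then show ?case by (auto intro!: exI[of _ D])
  next
    case (Suc t)
    let ?u = "card {j. j < t \<and> D j \<noteq> D (Suc j)}"
    from Suc obtain E where E: "\<forall>j\<le>?u. E j \<in> S" "\<forall>j<?u. E j \<subset> E (Suc j)" "E ?u = D t"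
      by (auto simp: le_Suc_eq less_Suc_eq)
    show ?case
    proof (cases "D t = D (Suc t)")
      case True
      then have "{j. j < Suc t \<and> D j \<noteq> D (Suc j)} = {j. j < t \<and> D j \<noteq> D (Suc j)}"
        by (auto simp: less_Suc_eq)
      with E True show ?thesis by auto
    next
      case False
      then have "{j. j < Suc t \<and> D j \<noteq> D (Suc j)} = insert t {j. j < t \<and> D j \<noteq> D (Suc j)}"
        by (auto simp: less_Suc_eq)
      then have c: "card {j. j < Suc t \<and> D j \<noteq> D (Suc j)} = Suc ?u" by simp
      have "D t \<subset> D (Suc t)" using Suc.prems False by blast
      with E c Suc.prems show ?thesis
        by (intro exI[of _ "E(Suc ?u := D (Suc t))"]) (auto simp: less_Suc_eq le_Suc_eq)
    qed
  qed
  then show ?thesis unfolding has_chain_def by blast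
qed

text \<open>
  Chains in \<open>S\<close> and \<open>T\<close> can be concatenated. The join counts no step of its own: the last member of the
  first chain may equal the first member of the second, so the latter is left out.
\<close>
lemma height_add_le:
  assumes S: "S \<noteq> {}" and T: "T \<noteq> {}" and U: "S \<subseteq> U" "T \<subseteq> U"
    and ST: "\<And>W Y. W \<in> S \<Longrightarrow> Y \<in> T \<Longrightarrow> W \<subseteq> Y"
  shows "height S + height T \<le> height U"
proof -
  have *: "enat (s + t) \<le> height U" if s: "has_chain S s" and t: "has_chain T t" for s t
  proof -
    from s obtain C where C: "\<forall>j\<le>s. C j \<in> S" "\<forall>j<s. C j \<subset> C (Suc j)"
      unfolding has_chain_def by blast
    from t obtain D where D: "\<forall>j\<le>t. D j \<in> T" "\<forall>j<t. D j \<subset> D (Suc j)"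
      unfolding has_chain_def by blast
    define E where "E j = (if j \<le> s then C j else D (j - s))" for j
    have "E j \<in> U" if "j \<le> s + t" for j
      using C D U that unfolding E_def by auto
    moreover have "E j \<subset> E (Suc j)" if "j < s + t" for j
    proof -
      consider "j < s" | "j = s" | "j > s" by linarith
      then show ?thesis
      proof cases
        case 1 with C show ?thesis by (simp add: E_def)
      next
        case 2
        with that have "t > 0" by simp
        then have "D 0 \<subset> D 1" "C s \<subseteq> D 0" using C D ST by auto
        with 2 show ?thesis by (simp add: E_def)
      next
        case 3
        with that have "j - s < t" by simp
        with D 3 show ?thesis by (simp add: E_def Suc_diff_le)
      qed
    qed
    ultimately have "has_chain U (s + t)" unfolding has_chain_def by blast
    then show ?thesis using S U le_height_iff[of U] by auto
  qed
  show ?thesis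
  proof (cases "height S")
    case (enat s)
    then have s: "has_chain S s" using le_height_iff[OF S, of s] by simp
    show ?thesis
    proof (cases "height T")
      case (enat t)
      then have "has_chain T t" using le_height_iff[OF T, of t] by simp
      with *[OF s] enat \<open>height S = enat s\<close> show ?thesis by simp
    next
      case infinity
      have "enat u \<le> height U" for u
      proof -
        have "has_chain T u" using le_height_iff[OF T, of u] infinity by simp
        from *[OF s this] show ?thesis by (meson enat_ord_simps(1) le_add2 order_trans)
      qed
      then have "height U = \<infinity>" by (metis Suc_ile_eq enat_ord_simps(4) less_irrefl not_enat_eq)
      then show ?thesis by simp
    qed
  next
    case infinity
    obtain t where t: "has_chain T t" using has_chain_0 T by blast
    have "enat u \<le> height U" for u
    proof -
      have "has_chain S u" using le_height_iff[OF S, of u] infinity by simp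
      from *[OF this t] show ?thesis by (meson enat_ord_simps(1) le_add1 order_trans)
    qed
    then have "height U = \<infinity>" by (metis Suc_ile_eq enat_ord_simps(4) less_irrefl not_enat_eq)
    then show ?thesis by simp
  qed
qed

text \<open>
  Every strict step of a chain in \<open>U\<close> is seen by \<open>f\<close> or by \<open>g\<close>, so it is counted in one of the two
  images. In the application \<open>f\<close> and \<open>g\<close> are the intersection and the sum with a fixed submodule.
\<close>
lemma height_le_add:
  assumes f: "\<And>W. W \<in> U \<Longrightarrow> f W \<in> S" and g: "\<And>W. W \<in> U \<Longrightarrow> g W \<in> T"
    and f_mono: "\<And>W Y. W \<in> U \<Longrightarrow> Y \<in> U \<Longrightarrow> W \<subseteq> Y \<Longrightarrow> f W \<subseteq> f Y"
    and g_mono: "\<And>W Y. W \<in> U \<Longrightarrow> Y \<in> U \<Longrightarrow> W \<subseteq> Y \<Longrightarrow> g W \<subseteq> g Y"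
    and inj: "\<And>W Y. W \<in> U \<Longrightarrow> Y \<in> U \<Longrightarrow> W \<subseteq> Y \<Longrightarrow> f W = f Y \<Longrightarrow> g W = g Y \<Longrightarrow> W = Y"
  shows "height U \<le> height S + height T"
  unfolding height_def[of U]
proof (rule Sup_least, safe)
  fix t assume "has_chain U t"
  then obtain C where C: "\<forall>j\<le>t. C j \<in> U" "\<forall>j<t. C j \<subset> C (Suc j)"
    unfolding has_chain_def by blast
  let ?A = "{j. j < t \<and> f (C j) \<noteq> f (C (Suc j))}"
  let ?B = "{j. j < t \<and> g (C j) \<noteq> g (C (Suc j))}"
  from C f have "S \<noteq> {}" by blast
  from C g have "T \<noteq> {}" by blast
  have le: "C j \<in> U" "C (Suc j) \<in> U" "C j \<subseteq> C (Suc j)" "C j \<noteq> C (Suc j)" if "j < t" for j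
    using that C by auto
  have "has_chain S (card ?A)"
    by (rule has_chain_weak) (use C f f_mono le in auto)
  moreover have "has_chain T (card ?B)"
    by (rule has_chain_weak) (use C g g_mono le in auto)
  ultimately have "enat (card ?A) + enat (card ?B) \<le> height S + height T"
    using le_height_iff[OF \<open>S \<noteq> {}\<close>] le_height_iff[OF \<open>T \<noteq> {}\<close>] by (intro add_mono) blast+
  then have "enat (card ?A + card ?B) \<le> height S + height T" by simp
  moreover have "t \<le> card ?A + card ?B"
  proof -
    have "{..<t} \<subseteq> ?A \<union> ?B"
    proof
      fix j assume "j \<in> {..<t}"
      then show "j \<in> ?A \<union> ?B" using inj[of "C j" "C (Suc j)"] le[of j] by auto
    qed
    then have "card {..<t} \<le> card (?A \<union> ?B)" by (intro card_mono) auto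
    also have "\<dots> \<le> card ?A + card ?B" by (rule card_Un_le)
    finally show ?thesis by simp
  qed
  ultimately show "enat t \<le> height S + height T" by (meson enat_ord_simps(1) order_trans)
qed

section \<open>Ascending chain condition\<close>

text \<open>
  The ascending chain condition, stated as well-foundedness of strict inclusion read upwards.
\<close>
definition ascending_wf :: "'a set set \<Rightarrow> bool" where
  "ascending_wf S \<longleftrightarrow> wf {(Y, W). W \<in> S \<and> Y \<in> S \<and> W \<subset> Y}"

lemma ascending_wf_map:
  assumes "ascending_wf T" and "\<And>W. W \<in> S \<Longrightarrow> f W \<in> T"
    and "\<And>W Y. W \<in> S \<Longrightarrow> Y \<in> S \<Longrightarrow> W \<subset> Y \<Longrightarrow> f W \<subset> f Y"
  shows "ascending_wf S"
  unfolding ascending_wf_def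
  by (rule wf_subset[OF wf_inv_image[OF assms(1)[unfolded ascending_wf_def], of f]])
    (use assms(2,3) in \<open>force simp: inv_image_def\<close>)

lemma ascending_wf_subset: "ascending_wf S" if "ascending_wf T" "S \<subseteq> T"
  by (rule ascending_wf_map[OF that(1), of S "\<lambda>W. W"]) (use that(2) in auto)

text \<open>
  The pair \<open>(f, g)\<close> embeds \<open>U\<close> into the lexicographic product of two well-founded relations.
\<close>
lemma ascending_wf_pair:
  assumes S: "ascending_wf S" and T: "ascending_wf T"
    and f: "\<And>W. W \<in> U \<Longrightarrow> f W \<in> S" and g: "\<And>W. W \<in> U \<Longrightarrow> g W \<in> T"
    and f_mono: "\<And>W Y. W \<in> U \<Longrightarrow> Y \<in> U \<Longrightarrow> W \<subseteq> Y \<Longrightarrow> f W \<subseteq> f Y"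
    and g_mono: "\<And>W Y. W \<in> U \<Longrightarrow> Y \<in> U \<Longrightarrow> W \<subseteq> Y \<Longrightarrow> g W \<subseteq> g Y"
    and inj: "\<And>W Y. W \<in> U \<Longrightarrow> Y \<in> U \<Longrightarrow> W \<subseteq> Y \<Longrightarrow> f W = f Y \<Longrightarrow> g W = g Y \<Longrightarrow> W = Y"
  shows "ascending_wf U"
  unfolding ascending_wf_def
proof (rule wf_subset)
  show "wf (inv_image ({(Y, W). W \<in> S \<and> Y \<in> S \<and> W \<subset> Y} <*lex*> {(Y, W). W \<in> T \<and> Y \<in> T \<and> W \<subset> Y})
      (\<lambda>W. (f W, g W)))"
    using S T unfolding ascending_wf_def by (intro wf_inv_image wf_lex_prod)
next
  show "{(Y, W). W \<in> U \<and> Y \<in> U \<and> W \<subset> Y} \<subseteq>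
      inv_image ({(Y, W). W \<in> S \<and> Y \<in> S \<and> W \<subset> Y} <*lex*> {(Y, W). W \<in> T \<and> Y \<in> T \<and> W \<subset> Y})
      (\<lambda>W. (f W, g W))"
  proof (rule subrelI)
    fix Y W assume "(Y, W) \<in> {(Y, W). W \<in> U \<and> Y \<in> U \<and> W \<subset> Y}"
    then have XY: "W \<in> U" "Y \<in> U" "W \<subset> Y" by auto
    then have "f W \<subseteq> f Y" "g W \<subseteq> g Y" "f W \<noteq> f Y \<or> g W \<noteq> g Y"
      using f_mono[of W Y] g_mono[of W Y] inj[of W Y] by auto
    with XY f g show "(Y, W) \<in> inv_image ({(Y, W). W \<in> S \<and> Y \<in> S \<and> W \<subset> Y} <*lex*>
        {(Y, W). W \<in> T \<and> Y \<in> T \<and> W \<subset> Y}) (\<lambda>W. (f W, g W))"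
      by (cases "f W = f Y") (auto simp: inv_image_def)
  qed
qed

lemma ascending_wf_maximal:
  assumes "ascending_wf S" and "Q \<subseteq> S" and "Q \<noteq> {}"
  obtains W where "W \<in> Q" and "\<And>Y. Y \<in> Q \<Longrightarrow> W \<subseteq> Y \<Longrightarrow> Y = W"
proof -
  obtain X0 where X0: "X0 \<in> Q" using assms(3) by blast
  obtain W where W: "W \<in> Q" "\<And>Y. (Y, W) \<in> {(Y, W). W \<in> S \<and> Y \<in> S \<and> W \<subset> Y} \<Longrightarrow> Y \<notin> Q"
    using wfE_min[OF assms(1)[unfolded ascending_wf_def] X0] by blast
  show thesis
  proof (rule that[OF W(1)])
    fix Y assume "Y \<in> Q" "W \<subseteq> Y"
    then show "Y = W" using W(1) W(2)[of Y] assms(2) by blast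
  qed
qed

lemma ascending_wf_chain_stable:
  assumes "ascending_wf S" and "\<And>n::nat. u n \<in> S" and "\<And>m n. m \<le> n \<Longrightarrow> u m \<subseteq> u n"
  shows "\<exists>m. \<forall>n\<ge>m. u n = u m"
proof -
  obtain W where W: "W \<in> range u" "\<And>Y. Y \<in> range u \<Longrightarrow> W \<subseteq> Y \<Longrightarrow> Y = W"
    by (rule ascending_wf_maximal[OF assms(1), of "range u"]) (use assms(2) in auto)
  then obtain m where m: "W = u m" by blast
  show ?thesis
  proof (intro exI[of _ m] allI impI)
    fix n assume "m \<le> n"
    with assms(3)[of m n] W(2)[of "u n"] m show "u n = u m" by simp
  qed
qed

text \<open>
  A form of Dickson's lemma: an increasing family with the ascending chain condition, indexed by
  exponent vectors, does not change when the exponents are cut off at a suitable bound \<open>c\<close>; the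
  inclusion stated is the one that does not follow from monotonicity. Along the diagonal the family is constant
  from some \<open>s\<close> on, which settles the vectors with all entries at least \<open>s\<close>. Any other vector has an
  entry among the finitely many values below \<open>s\<close>; fixing that entry leaves fewer free coordinates.
  The coordinates outside \<open>V\<close> are the ones already fixed, at the values of \<open>\<gamma>\<close>.
\<close>
lemma monotone_multiindex_stable:
  fixes f :: "('i \<Rightarrow> nat) \<Rightarrow> 'a set"
  assumes wf: "ascending_wf S" and f: "\<And>\<alpha>. f \<alpha> \<in> S" and mono: "\<And>\<alpha> \<beta>. \<alpha> \<le> \<beta> \<Longrightarrow> f \<alpha> \<subseteq> f \<beta>"
    and "finite V"
  shows "\<exists>c. \<forall>\<alpha>. (\<forall>j. j \<notin> V \<longrightarrow> \<alpha> j = \<gamma> j) \<longrightarrow> f \<alpha> \<subseteq> f (\<lambda>j. if j \<in> V then min (\<alpha> j) c else \<gamma> j)"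
  using \<open>finite V\<close>
proof (induction V arbitrary: \<gamma> rule: finite_psubset_induct)
  case (psubset V)
  define u where "u s = f (\<lambda>j. if j \<in> V then s else \<gamma> j)" for s :: nat
  have u_mono: "u m \<subseteq> u n" if "m \<le> n" for m n
    unfolding u_def by (rule mono) (use that in \<open>auto simp: le_fun_def\<close>)
  have u_S: "u n \<in> S" for n unfolding u_def by (rule f)
  obtain s where s: "\<And>n. s \<le> n \<Longrightarrow> u n = u s"
    using ascending_wf_chain_stable[of S u, OF wf u_S u_mono] by auto
  define stable where "stable j v c \<longleftrightarrow> (\<forall>\<alpha>. (\<forall>i. i \<notin> V - {j} \<longrightarrow> \<alpha> i = (\<gamma>(j := v)) i) \<longrightarrow>
      f \<alpha> \<subseteq> f (\<lambda>i. if i \<in> V - {j} then min (\<alpha> i) c else (\<gamma>(j := v)) i))" for j v c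
  have "\<exists>c. stable j v c" if "j \<in> V" for j v
    unfolding stable_def by (rule psubset.IH) (use that in auto)
  then obtain c where c: "\<And>j v. j \<in> V \<Longrightarrow> stable j v (c j v)" by metis
  \<comment> \<open>It covers the diagonal bound and the bounds for every coordinate fixed at a value below it.\<close>
  define b where "b = Max (insert s ((\<lambda>(j, v). c j v) ` (V \<times> {..<s})))"
  have fin: "finite (insert s ((\<lambda>(j, v). c j v) ` (V \<times> {..<s})))" using psubset.hyps by simp
  have b: "s \<le> b" "\<And>j v. j \<in> V \<Longrightarrow> v < s \<Longrightarrow> c j v \<le> b"
    unfolding b_def by (rule Max_ge[OF fin], simp, rule Max_ge[OF fin], force)
  show ?case
  proof (intro exI[of _ b] allI impI)
    fix \<alpha> assume \<alpha>: "\<forall>j. j \<notin> V \<longrightarrow> \<alpha> j = \<gamma> j"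
    show "f \<alpha> \<subseteq> f (\<lambda>j. if j \<in> V then min (\<alpha> j) b else \<gamma> j)"
    proof (cases "\<forall>j\<in>V. s \<le> \<alpha> j")
      case True
      define m where "m = Max (insert s (\<alpha> ` V))"
      have m: "s \<le> m" "\<And>j. j \<in> V \<Longrightarrow> \<alpha> j \<le> m"
        unfolding m_def using psubset.hyps by auto
      have "f \<alpha> \<subseteq> u m" unfolding u_def by (rule mono) (use m \<alpha> in \<open>auto simp: le_fun_def\<close>)
      also have "u m = u s" using s m by blast
      also have "\<dots> \<subseteq> f (\<lambda>j. if j \<in> V then min (\<alpha> j) b else \<gamma> j)"
        unfolding u_def by (rule mono) (use True b in \<open>auto simp: le_fun_def\<close>)
      finally show ?thesis .
    next
      case False
      then obtain j where j: "j \<in> V" "\<alpha> j < s" by (meson not_le)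
      have "f \<alpha> \<subseteq> f (\<lambda>i. if i \<in> V - {j} then min (\<alpha> i) (c j (\<alpha> j)) else (\<gamma>(j := \<alpha> j)) i)"
        by (rule c[OF j(1), unfolded stable_def, rule_format]) (use \<alpha> in auto)
      also have "\<dots> \<subseteq> f (\<lambda>j. if j \<in> V then min (\<alpha> j) b else \<gamma> j)"
      proof (rule mono, rule le_funI)
        fix i
        have "\<alpha> j \<le> b" using j b(1) by simp
        moreover have "min (\<alpha> i) (c j (\<alpha> j)) \<le> min (\<alpha> i) b" using b(2)[OF j] by (rule min.mono[OF order_refl])
        ultimately show "(if i \<in> V - {j} then min (\<alpha> i) (c j (\<alpha> j)) else (\<gamma>(j := \<alpha> j)) i)
            \<le> (if i \<in> V then min (\<alpha> i) b else \<gamma> i)"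
          using j(1) by (cases "i = j") simp_all
      qed
      finally show ?thesis .
    qed
  qed
qed

section \<open>Sums over exponent vectors\<close>

text \<open>
  The functions that agree, for large arguments, with an integral combination of the polynomials
  \<open>(n + k choose k)\<close>. The inductive form makes closure properties proofs by rule induction.
\<close>
inductive numerical :: "(nat \<Rightarrow> int) \<Rightarrow> bool" where
  basis: "numerical (\<lambda>n. int ((n + k) choose k))"
| add: "numerical f \<Longrightarrow> numerical g \<Longrightarrow> numerical (\<lambda>n. f n + g n)"
| scale: "numerical f \<Longrightarrow> numerical (\<lambda>n. c * f n)"
| cong: "numerical f \<Longrightarrow> (\<And>n. m \<le> n \<Longrightarrow> g n = f n) \<Longrightarrow> numerical g"

lemma numerical_const: "numerical (\<lambda>n. c)"
  using numerical.scale[OF numerical.basis[of 0], of c] by simp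

lemma numerical_delta: "numerical (\<lambda>n. if n = 0 then 1 else 0)"
  by (rule numerical.cong[OF numerical_const[of 0], of 1]) auto

text \<open>
  On the basis this is the hockey-stick identity. Changing finitely many values changes the partial
  sums by a constant from some point on.
\<close>
lemma numerical_partial_sums: "numerical f \<Longrightarrow> numerical (\<lambda>n. \<Sum>t\<le>n. f t)"
proof (induction rule: numerical.induct)
  case (basis k)
  have "(\<lambda>n. \<Sum>t\<le>n. int ((t + k) choose k)) = (\<lambda>n. int ((n + Suc k) choose Suc k))"
  proof
    fix n show "(\<Sum>t\<le>n. int ((t + k) choose k)) = int ((n + Suc k) choose Suc k)"
      by (induction n) (simp_all add: algebra_simps)
  qed
  then show ?case by (simp only: numerical.basis)
next
  case (add f g)
  then show ?case by (simp add: sum.distrib numerical.add)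
next
  case (scale f c)
  then show ?case by (simp add: sum_distrib_left[symmetric] numerical.scale)
next
  case (cong f m g)
  \<comment> \<open>the contribution of the finitely many places where \<open>f\<close> and \<open>g\<close> may differ\<close>
  define c where "c = (\<Sum>t<m. g t) - (\<Sum>t<m. f t)"
  have "(\<Sum>t\<le>n. g t) = (\<Sum>t\<le>n. f t) + c" if "m \<le> n" for n
  proof -
    have split: "{..n} = {..<m} \<union> {m..n}" using that by auto
    have "(\<Sum>t\<le>n. g t) = (\<Sum>t<m. g t) + (\<Sum>t=m..n. g t)"
      unfolding split by (rule sum.union_disjoint) auto
    moreover have "(\<Sum>t\<le>n. f t) = (\<Sum>t<m. f t) + (\<Sum>t=m..n. f t)"
      unfolding split by (rule sum.union_disjoint) auto
    moreover have "(\<Sum>t=m..n. g t) = (\<Sum>t=m..n. f t)" by (rule sum.cong) (auto simp: cong)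
    ultimately show ?thesis unfolding c_def by simp
  qed
  then show ?case by (rule numerical.cong[OF numerical.add[OF cong.IH numerical_const]])
qed

text \<open>
  On the basis this is Pascal's rule.
\<close>
lemma numerical_delay_1: "numerical f \<Longrightarrow> numerical (\<lambda>n. if 1 \<le> n then f (n - 1) else 0)"
proof (induction rule: numerical.induct)
  case (basis k)
  show ?case
  proof (cases k)
    case 0
    show ?thesis by (rule numerical.cong[OF numerical_const[of 1], of 1]) (simp add: 0)
  next
    case (Suc l)
    have "numerical (\<lambda>n. int ((n + k) choose k) + (-1) * int ((n + l) choose l))"
      by (intro numerical.add numerical.basis numerical.scale)
    then show ?thesis
    proof (rule numerical.cong[where m = 1])
      fix n :: nat assume "1 \<le> n"
      then obtain n' where "n = Suc n'" by (cases n) auto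
      then show "(if 1 \<le> n then int ((n - 1 + k) choose k) else 0)
          = int ((n + k) choose k) + (-1) * int ((n + l) choose l)"
        by (simp add: Suc)
    qed
  qed
next
  case (add f g)
  show ?case by (rule numerical.cong[OF numerical.add[OF add.IH], of 0]) simp
next
  case (scale f c)
  show ?case by (rule numerical.cong[OF numerical.scale[OF scale.IH], of 0 _ c]) simp
next
  case (cong f m g)
  show ?case by (rule numerical.cong[OF cong.IH, of "Suc m"]) (use cong.hyps in auto)
qed

lemma numerical_delay: "numerical f \<Longrightarrow> numerical (\<lambda>n. if s \<le> n then f (n - s) else 0)"
proof (induction s)
  case (Suc s)
  show ?case
    by (rule numerical.cong[OF numerical_delay_1[OF Suc.IH[OF Suc.prems]], of 0]) auto
qed simp

lemma numerical_delayed_sums: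
  assumes "numerical f"
  shows "numerical (\<lambda>n. \<Sum>t\<in>{s..n}. f (n - t))"
proof (rule numerical.cong[OF numerical_delay[OF numerical_partial_sums[OF assms]], of 0 _ s])
  fix n
  have "(\<Sum>t\<in>{s..n}. f (n - t)) = (\<Sum>t\<le>n - s. f t)" if "s \<le> n"
    by (rule sum.reindex_bij_witness[where i = "\<lambda>t. n - t" and j = "\<lambda>t. n - t"]) (use that in auto)
  then show "(\<Sum>t\<in>{s..n}. f (n - t)) = (if s \<le> n then \<Sum>t\<le>n - s. f t else 0)" by auto
qed

text \<open>
  Sums of products of functions of one variable each. The representation holds for all arguments, not
  only for large ones, since partial sums in one direction involve small values of that variable.
\<close>
inductive multi_numerical :: "nat \<Rightarrow> ((nat \<Rightarrow> nat) \<Rightarrow> int) \<Rightarrow> bool" for d where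
  prod: "(\<And>i. i \<le> d \<Longrightarrow> numerical (f i)) \<Longrightarrow> multi_numerical d (\<lambda>n. \<Prod>i\<le>d. f i (n i))"
| add: "multi_numerical d F \<Longrightarrow> multi_numerical d G \<Longrightarrow> multi_numerical d (\<lambda>n. F n + G n)"
| scale: "multi_numerical d F \<Longrightarrow> multi_numerical d (\<lambda>n. c * F n)"

lemma multi_numerical_zero: "multi_numerical d (\<lambda>n. 0)"
  using multi_numerical.scale[OF multi_numerical.prod[of d "\<lambda>_ _. 0"], of 0] numerical_const
  by simp

lemma multi_numerical_sum:
  "finite S \<Longrightarrow> (\<And>s. s \<in> S \<Longrightarrow> multi_numerical d (F s)) \<Longrightarrow> multi_numerical d (\<lambda>n. \<Sum>s\<in>S. F s n)"
  by (induction S rule: finite_induct) (auto intro: multi_numerical_zero multi_numerical.add)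

lemma prod_update:
  assumes "i \<le> (d::nat)"
  shows "(\<Prod>j\<le>d. f j ((n(i := v)) j)) = f i v * (\<Prod>j\<in>{..d} - {i}. f j (n j) :: 'a::comm_monoid_mult)"
proof -
  have "(\<Prod>j\<le>d. f j ((n(i := v)) j)) = f i ((n(i := v)) i) * (\<Prod>j\<in>{..d} - {i}. f j ((n(i := v)) j))"
    using assms by (intro prod.remove) auto
  moreover have "(\<Prod>j\<in>{..d} - {i}. f j ((n(i := v)) j)) = (\<Prod>j\<in>{..d} - {i}. f j (n j))"
    by (rule prod.cong) auto
  ultimately show ?thesis by simp
qed

lemma prod_fun_upd:
  assumes "i \<le> (d::nat)"
  shows "(\<Prod>j\<le>d. (f(i := g)) j (n j)) = g (n i) * (\<Prod>j\<in>{..d} - {i}. f j (n j) :: 'a::comm_monoid_mult)"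
proof -
  have "(\<Prod>j\<le>d. (f(i := g)) j (n j)) = (f(i := g)) i (n i) * (\<Prod>j\<in>{..d} - {i}. (f(i := g)) j (n j))"
    using assms by (intro prod.remove) auto
  moreover have "(\<Prod>j\<in>{..d} - {i}. (f(i := g)) j (n j)) = (\<Prod>j\<in>{..d} - {i}. f j (n j))"
    by (rule prod.cong) auto
  ultimately show ?thesis by simp
qed

lemma multi_numerical_delay:
  assumes "multi_numerical d F" and i: "i \<le> d"
  shows "multi_numerical d (\<lambda>n. if s \<le> n i then F (n(i := n i - s)) else 0)"
  using assms(1)
proof (induction rule: multi_numerical.induct)
  case (prod f)
  define g where "g = (\<lambda>m. if s \<le> m then f i (m - s) else 0)"
  have "multi_numerical d (\<lambda>n. \<Prod>j\<le>d. (f(i := g)) j (n j))"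
    by (rule multi_numerical.prod) (use prod numerical_delay[of "f i" s] i in \<open>auto simp: g_def\<close>)
  moreover have "(\<lambda>n. \<Prod>j\<le>d. (f(i := g)) j (n j)) =
      (\<lambda>n. if s \<le> n i then (\<Prod>j\<le>d. f j ((n(i := n i - s)) j)) else 0)"
    unfolding prod_fun_upd[OF i] prod_update[OF i] g_def by auto
  ultimately show ?case by simp
next
  case (add F G)
  have "(\<lambda>n. if s \<le> n i then F (n(i := n i - s)) + G (n(i := n i - s)) else 0) =
    (\<lambda>n. (if s \<le> n i then F (n(i := n i - s)) else 0) + (if s \<le> n i then G (n(i := n i - s)) else 0))"
    by auto
  then show ?case using multi_numerical.add[OF add.IH] by simp
next
  case (scale F c)
  have "(\<lambda>n. if s \<le> n i then c * F (n(i := n i - s)) else 0) =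
    (\<lambda>n. c * (if s \<le> n i then F (n(i := n i - s)) else 0))" by auto
  then show ?case using multi_numerical.scale[OF scale.IH] by simp
qed

lemma multi_numerical_delayed_sums:
  assumes "multi_numerical d F" and i: "i \<le> d"
  shows "multi_numerical d (\<lambda>n. \<Sum>t\<in>{s..n i}. F (n(i := n i - t)))"
  using assms(1)
proof (induction rule: multi_numerical.induct)
  case (prod f)
  define g where "g = (\<lambda>m. \<Sum>t\<in>{s..m}. f i (m - t))"
  have "multi_numerical d (\<lambda>n. \<Prod>j\<le>d. (f(i := g)) j (n j))"
    by (rule multi_numerical.prod) (use prod numerical_delayed_sums[of "f i" s] i in \<open>auto simp: g_def\<close>)
  moreover have "(\<lambda>n. \<Prod>j\<le>d. (f(i := g)) j (n j)) =
      (\<lambda>n. \<Sum>t\<in>{s..n i}. \<Prod>j\<le>d. f j ((n(i := n i - t)) j))"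
    unfolding prod_fun_upd[OF i] prod_update[OF i] g_def by (simp add: sum_distrib_right)
  ultimately show ?case by simp
next
  case (add F G)
  show ?case unfolding sum.distrib by (rule multi_numerical.add[OF add.IH])
next
  case (scale F c)
  show ?case unfolding sum_distrib_left[symmetric] by (rule multi_numerical.scale[OF scale.IH])
qed

text \<open>
  The monomials of multidegree \<open>n\<close> in \<open>r\<close> variables, the variable \<open>j\<close> having degree the unit vector in
  direction \<open>col j\<close>.
\<close>
definition exponents :: "nat \<Rightarrow> (nat \<Rightarrow> nat) \<Rightarrow> nat \<Rightarrow> (nat \<Rightarrow> nat) \<Rightarrow> (nat \<Rightarrow> nat) set" where
  "exponents d col r n =
    {\<alpha>. (\<forall>j\<ge>r. \<alpha> j = 0) \<and> (\<forall>i\<le>d. (\<Sum>j | j < r \<and> col j = i. \<alpha> j) = n i)}"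

lemma exponents_0: "exponents d col 0 n = (if \<forall>i\<le>d. n i = 0 then {\<lambda>j. 0} else {})"
  by (auto simp: exponents_def)

lemma exponents_Suc:
  assumes "col r \<le> d"
  shows "exponents d col (Suc r) n =
    (\<Union>t\<le>n (col r). (\<lambda>\<alpha>. \<alpha>(r := t)) ` exponents d col r (n(col r := n (col r) - t)))"
proof -
  have upd: "(\<Sum>j | j < Suc r \<and> col j = i. \<beta> j) =
      (if col r = i then \<beta> r else 0) + (\<Sum>j | j < r \<and> col j = i. \<beta> j)" for \<beta> :: "nat \<Rightarrow> nat" and i
  proof -
    have "{j. j < Suc r \<and> col j = i} =
        (if col r = i then insert r {j. j < r \<and> col j = i} else {j. j < r \<and> col j = i})"
      by (auto simp: less_Suc_eq)
    then show ?thesis by simp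
  qed
  have same: "(\<Sum>j | j < r \<and> col j = i. (\<beta>(r := t)) j) = (\<Sum>j | j < r \<and> col j = i. \<beta> j)"
    for \<beta> :: "nat \<Rightarrow> nat" and i t
    by (rule sum.cong) auto
  show ?thesis
  proof (intro equalityI subsetI)
    fix \<beta> assume "\<beta> \<in> exponents d col (Suc r) n"
    then have \<beta>: "\<forall>j\<ge>Suc r. \<beta> j = 0"
      "\<And>i. i \<le> d \<Longrightarrow> (if col r = i then \<beta> r else 0) + (\<Sum>j | j < r \<and> col j = i. \<beta> j) = n i"
      unfolding exponents_def upd by auto
    from \<beta>(2)[OF assms] have le: "\<beta> r \<le> n (col r)" by simp
    have "\<beta>(r := 0) \<in> exponents d col r (n(col r := n (col r) - \<beta> r))"
      unfolding exponents_def mem_Collect_eq same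
    proof (intro conjI allI impI)
      fix j assume "r \<le> j"
      then show "(\<beta>(r := 0)) j = 0" using \<beta>(1) by (cases "j = r") auto
    next
      fix i assume "i \<le> d"
      from \<beta>(2)[OF this] le show "(\<Sum>j | j < r \<and> col j = i. \<beta> j) = (n(col r := n (col r) - \<beta> r)) i"
        by (auto split: if_splits)
    qed
    moreover have "\<beta> = (\<beta>(r := 0))(r := \<beta> r)" by auto
    ultimately show "\<beta> \<in> (\<Union>t\<le>n (col r). (\<lambda>\<alpha>. \<alpha>(r := t)) ` exponents d col r (n(col r := n (col r) - t)))"
      using le by blast
  next
    fix \<beta> assume "\<beta> \<in> (\<Union>t\<le>n (col r). (\<lambda>\<alpha>. \<alpha>(r := t)) ` exponents d col r (n(col r := n (col r) - t)))"
    then obtain t \<alpha> where *: "t \<le> n (col r)" "\<beta> = \<alpha>(r := t)" "\<forall>j\<ge>r. \<alpha> j = 0"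
      "\<And>i. i \<le> d \<Longrightarrow> (\<Sum>j | j < r \<and> col j = i. \<alpha> j) = (n(col r := n (col r) - t)) i"
      unfolding exponents_def by auto
    show "\<beta> \<in> exponents d col (Suc r) n"
      unfolding exponents_def mem_Collect_eq upd *(2) same using * by (auto split: if_splits)
  qed
qed

lemma exponents_support: "\<alpha> \<in> exponents d col r n \<Longrightarrow> j \<ge> r \<Longrightarrow> \<alpha> j = 0"
  by (simp add: exponents_def)

lemma finite_exponents: "(\<And>j. j < r \<Longrightarrow> col j \<le> d) \<Longrightarrow> finite (exponents d col r n)"
  by (induction r arbitrary: n) (auto simp: exponents_0 exponents_Suc)

lemma sum_exponents_Suc:
  assumes col: "\<And>j. j < Suc r \<Longrightarrow> col j \<le> d"
  shows "(\<Sum>\<alpha>\<in>exponents d col (Suc r) n. G \<alpha>) =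
    (\<Sum>t\<le>n (col r). \<Sum>\<alpha>\<in>exponents d col r (n(col r := n (col r) - t)). G (\<alpha>(r := t)))"
proof -
  have inj: "inj_on (\<lambda>\<alpha>. \<alpha>(r := t)) (exponents d col r m)" for t m
  proof (rule inj_onI)
    fix \<alpha> \<beta> :: "nat \<Rightarrow> nat"
    assume "\<alpha> \<in> exponents d col r m" "\<beta> \<in> exponents d col r m" and eq: "\<alpha>(r := t) = \<beta>(r := t)"
    then have "\<alpha> r = \<beta> r" by (simp add: exponents_support[of _ d col r m])
    then show "\<alpha> = \<beta>" using fun_cong[OF eq] by (metis ext fun_upd_apply)
  qed
  have "exponents d col (Suc r) n =
      (\<Union>t\<in>{..n (col r)}. (\<lambda>\<alpha>. \<alpha>(r := t)) ` exponents d col r (n(col r := n (col r) - t)))"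
    by (rule exponents_Suc) (simp add: col)
  moreover have "(\<Sum>\<alpha>\<in>(\<Union>t\<in>{..n (col r)}. (\<lambda>\<alpha>. \<alpha>(r := t)) ` exponents d col r (n(col r := n (col r) - t))). G \<alpha>) =
      (\<Sum>t\<le>n (col r). \<Sum>\<alpha>\<in>(\<lambda>\<alpha>. \<alpha>(r := t)) ` exponents d col r (n(col r := n (col r) - t)). G \<alpha>)"
  proof (rule sum.UNION_disjoint)
    show "\<forall>t\<in>{..n (col r)}. finite ((\<lambda>\<alpha>. \<alpha>(r := t)) ` exponents d col r (n(col r := n (col r) - t)))"
      using col by (auto intro!: finite_imageI finite_exponents)
    show "\<forall>t\<in>{..n (col r)}. \<forall>s\<in>{..n (col r)}. t \<noteq> s \<longrightarrow>
      (\<lambda>\<alpha>. \<alpha>(r := t)) ` exponents d col r (n(col r := n (col r) - t)) \<inter>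
      (\<lambda>\<alpha>. \<alpha>(r := s)) ` exponents d col r (n(col r := n (col r) - s)) = {}"
    proof (intro ballI impI)
      fix t s :: nat assume "t \<noteq> s"
      then have "\<alpha>(r := t) \<noteq> \<beta>(r := s)" for \<alpha> \<beta> :: "nat \<Rightarrow> nat" by (metis fun_upd_same)
      then show "(\<lambda>\<alpha>. \<alpha>(r := t)) ` exponents d col r (n(col r := n (col r) - t)) \<inter>
        (\<lambda>\<alpha>. \<alpha>(r := s)) ` exponents d col r (n(col r := n (col r) - s)) = {}" by blast
    qed
  qed simp
  ultimately show ?thesis by (simp add: sum.reindex[OF inj])
qed

text \<open>
  Removing the last variable, of direction \<open>i\<close>, turns the sum into a convolution in \<open>n\<^sub>i\<close>. Its weight is
  constant from \<open>c\<close> on, so it consists of finitely many delays and one delayed partial sum.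
\<close>
lemma multi_numerical_exponents_sum:
  assumes "\<And>j. j < r \<Longrightarrow> col j \<le> d"
  shows "multi_numerical d (\<lambda>n. \<Sum>\<alpha>\<in>exponents d col r n. g (\<lambda>j. min (\<alpha> j) c))"
  using assms
proof (induction r arbitrary: g)
  case 0
  have "multi_numerical d (\<lambda>n. g (\<lambda>j. 0) * (\<Prod>i\<le>d. if n i = 0 then 1 else 0))"
    using multi_numerical.scale[OF multi_numerical.prod[of d "\<lambda>_ m. if m = 0 then 1 else 0"]] numerical_delta
    by blast
  moreover have "(\<lambda>n :: nat \<Rightarrow> nat. g (\<lambda>j. 0) * (\<Prod>i\<le>d. if n i = 0 then 1 else 0)) =
      (\<lambda>n. \<Sum>\<alpha>\<in>exponents d col 0 n. g (\<lambda>j. min (\<alpha> j) c))"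
    by (rule ext) (auto simp: exponents_0)
  ultimately show ?case by simp
next
  case (Suc r)
  define i where "i = col r"
  have i: "i \<le> d" using Suc.prems i_def by simp
  define G where "G s n = (\<Sum>\<alpha>\<in>exponents d col r n. g ((\<lambda>j. min (\<alpha> j) c)(r := s)))" for s n
  have G: "multi_numerical d (G s)" for s
    unfolding G_def by (rule Suc.IH[of "\<lambda>\<beta>. g (\<beta>(r := s))"]) (use Suc.prems in auto)
  have "(\<Sum>\<alpha>\<in>exponents d col (Suc r) n. g (\<lambda>j. min (\<alpha> j) c)) =
      (\<Sum>t<c. if t \<le> n i then G t (n(i := n i - t)) else 0) + (\<Sum>t\<in>{c..n i}. G c (n(i := n i - t)))" for n
  proof -
    have m: "(\<lambda>j. min ((\<alpha>(r := t)) j) c) = (\<lambda>j. min (\<alpha> j) c)(r := min t c)" for \<alpha> and t :: nat by auto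
    have "(\<Sum>\<alpha>\<in>exponents d col (Suc r) n. g (\<lambda>j. min (\<alpha> j) c)) =
        (\<Sum>t\<le>n (col r). \<Sum>\<alpha>\<in>exponents d col r (n(col r := n (col r) - t)). g (\<lambda>j. min ((\<alpha>(r := t)) j) c))"
      by (rule sum_exponents_Suc) (rule Suc.prems)
    also have "\<dots> = (\<Sum>t\<le>n i. G (min t c) (n(i := n i - t)))"
      unfolding G_def i_def m ..
    also have "{..n i} = {t. t < c \<and> t \<le> n i} \<union> {c..n i}" by auto
    also have "(\<Sum>t\<in>{t. t < c \<and> t \<le> n i} \<union> {c..n i}. G (min t c) (n(i := n i - t))) =
      (\<Sum>t | t < c \<and> t \<le> n i. G (min t c) (n(i := n i - t))) + (\<Sum>t\<in>{c..n i}. G (min t c) (n(i := n i - t)))"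
      by (rule sum.union_disjoint) auto
    also have "(\<Sum>t\<in>{c..n i}. G (min t c) (n(i := n i - t))) = (\<Sum>t\<in>{c..n i}. G c (n(i := n i - t)))"
      by (rule sum.cong) (auto simp: min_def)
    also have "(\<Sum>t | t < c \<and> t \<le> n i. G (min t c) (n(i := n i - t))) =
      (\<Sum>t<c. if t \<le> n i then G t (n(i := n i - t)) else 0)"
    proof -
      have "{t. t < c \<and> t \<le> n i} = {..<c} \<inter> {t. t \<le> n i}" by auto
      then have "(\<Sum>t | t < c \<and> t \<le> n i. G (min t c) (n(i := n i - t))) =
          (\<Sum>t<c. if t \<in> {t. t \<le> n i} then G (min t c) (n(i := n i - t)) else 0)"
        by (simp only: sum.inter_restrict[OF finite_lessThan])
      also have "\<dots> = (\<Sum>t<c. if t \<le> n i then G t (n(i := n i - t)) else 0)"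
        by (rule sum.cong) auto
      finally show ?thesis .
    qed
    finally show ?thesis .
  qed
  moreover have "multi_numerical d (\<lambda>n. (\<Sum>t<c. if t \<le> n i then G t (n(i := n i - t)) else 0) +
      (\<Sum>t\<in>{c..n i}. G c (n(i := n i - t))))"
    by (intro multi_numerical.add multi_numerical_sum multi_numerical_delay multi_numerical_delayed_sums G i) auto
  ultimately show ?case by simp
qed

section \<open>Uniqueness of coefficients in the binomial basis\<close>

definition binomial_sum :: "nat \<Rightarrow> ((nat \<Rightarrow> nat) \<Rightarrow> int) \<Rightarrow> (nat \<Rightarrow> nat) \<Rightarrow> int" where
  "binomial_sum d e n = (\<Sum>k | e k \<noteq> 0. e k * (\<Prod>i\<le>d. int ((n i + k i) choose k i)))"

lemma binomial_sum_superset: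
  "finite S \<Longrightarrow> {k. e k \<noteq> 0} \<subseteq> S \<Longrightarrow> binomial_sum d e n = (\<Sum>k\<in>S. e k * (\<Prod>i\<le>d. int ((n i + k i) choose k i)))"
  unfolding binomial_sum_def by (rule sum.mono_neutral_left) auto

definition coeff_family :: "nat \<Rightarrow> ((nat \<Rightarrow> nat) \<Rightarrow> int) \<Rightarrow> bool" where
  "coeff_family d e \<longleftrightarrow> finite {k. e k \<noteq> 0} \<and> {k. e k \<noteq> 0} \<subseteq> multi_indices d"

lemma coeff_family_lin: "coeff_family d (\<lambda>k. a * e k + b * e' k)"
  if "coeff_family d e" "coeff_family d e'"
proof -
  have "{k. a * e k + b * e' k \<noteq> 0} \<subseteq> {k. e k \<noteq> 0} \<union> {k. e' k \<noteq> 0}" by auto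
  with that show ?thesis
    unfolding coeff_family_def by (meson finite_Un finite_subset le_sup_iff subset_trans)
qed

lemma binomial_sum_lin:
  assumes "coeff_family d e" "coeff_family d e'"
  shows "binomial_sum d (\<lambda>k. a * e k + b * e' k) n = a * binomial_sum d e n + b * binomial_sum d e' n"
proof -
  let ?S = "{k. e k \<noteq> 0} \<union> {k. e' k \<noteq> 0}"
  have fin: "finite ?S" using assms unfolding coeff_family_def by simp
  show ?thesis
    by (subst (1 2 3) binomial_sum_superset[OF fin])
      (auto simp: algebra_simps sum.distrib sum_distrib_left)
qed

lemma for_all_large_conj: "for_all_large d (\<lambda>n. P n \<and> Q n)" if "for_all_large d P" "for_all_large d Q"
proof -
  from that obtain c c' where "\<forall>n\<in>multi_indices d. (\<forall>i\<le>d. c \<le> n i) \<longrightarrow> P n"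
    "\<forall>n\<in>multi_indices d. (\<forall>i\<le>d. c' \<le> n i) \<longrightarrow> Q n" unfolding for_all_large_def by blast
  then show ?thesis unfolding for_all_large_def by (intro exI[of _ "max c c'"]) auto
qed

lemma for_all_large_mono: "for_all_large d P \<Longrightarrow> (\<And>n. n \<in> multi_indices d \<Longrightarrow> P n \<Longrightarrow> Q n) \<Longrightarrow> for_all_large d Q"
  unfolding for_all_large_def by meson

lemma for_all_large_ge: "for_all_large d (\<lambda>n. \<forall>i\<le>d. c \<le> n i)"
  unfolding for_all_large_def by blast

lemma for_all_large_decr:
  assumes "for_all_large d P" and "i \<le> d"
  shows "for_all_large d (\<lambda>n. n i \<ge> 1 \<and> P (n(i := n i - 1)))"
proof -
  obtain c where c: "\<forall>n\<in>multi_indices d. (\<forall>i\<le>d. c \<le> n i) \<longrightarrow> P n"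
    using assms(1) unfolding for_all_large_def by blast
  show ?thesis unfolding for_all_large_def
  proof (intro exI[of _ "Suc c"] ballI impI)
    fix n assume n: "n \<in> multi_indices d" "\<forall>i\<le>d. Suc c \<le> n i"
    then have "n(i := n i - 1) \<in> multi_indices d" "\<forall>j\<le>d. c \<le> (n(i := n i - 1)) j"
      by (auto simp: multi_indices_def intro: Suc_leD)
    with c n assms(2) show "n i \<ge> 1 \<and> P (n(i := n i - 1))" by auto
  qed
qed

definition eventually_binomial_sum :: "nat \<Rightarrow> ((nat \<Rightarrow> nat) \<Rightarrow> int) \<Rightarrow> bool" where
  "eventually_binomial_sum d F \<longleftrightarrow> (\<exists>e. coeff_family d e \<and> for_all_large d (\<lambda>n. F n = binomial_sum d e n))"

lemma eventually_binomial_sum_lin: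
  assumes "eventually_binomial_sum d F" "eventually_binomial_sum d G"
  shows "eventually_binomial_sum d (\<lambda>n. a * F n + b * G n)"
proof -
  from assms obtain e e' where e: "coeff_family d e" "for_all_large d (\<lambda>n. F n = binomial_sum d e n)"
    "coeff_family d e'" "for_all_large d (\<lambda>n. G n = binomial_sum d e' n)"
    unfolding eventually_binomial_sum_def by blast
  show ?thesis unfolding eventually_binomial_sum_def
    by (intro exI[of _ "\<lambda>k. a * e k + b * e' k"] conjI coeff_family_lin e
        for_all_large_mono[OF for_all_large_conj[OF e(2,4)]])
      (simp add: binomial_sum_lin e)
qed

lemma eventually_binomial_sum_cong:
  assumes "eventually_binomial_sum d F" and "for_all_large d (\<lambda>n. G n = F n)"
  shows "eventually_binomial_sum d G"
proof -
  from assms obtain e where e: "coeff_family d e" "for_all_large d (\<lambda>n. F n = binomial_sum d e n)"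
    unfolding eventually_binomial_sum_def by blast
  show ?thesis unfolding eventually_binomial_sum_def
    by (intro exI[of _ e] conjI e for_all_large_mono[OF for_all_large_conj[OF e(2) assms(2)]]) simp
qed

lemma eventually_binomial_sum_basis:
  "eventually_binomial_sum d (\<lambda>n. \<Prod>i\<le>d. int ((n i + k i) choose k i))"
proof -
  define k' where "k' i = (if i \<le> d then k i else 0)" for i
  define e where "e l = (if l = k' then 1 else 0 :: int)" for l
  have e: "{l. e l \<noteq> 0} = {k'}" by (auto simp: e_def)
  have "binomial_sum d e n = (\<Prod>i\<le>d. int ((n i + k i) choose k i))" for n
    unfolding binomial_sum_def e by (simp add: e_def k'_def)
  moreover have "coeff_family d e"
    unfolding coeff_family_def e by (simp add: multi_indices_def k'_def)
  ultimately show ?thesis unfolding eventually_binomial_sum_def for_all_large_def by auto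
qed

text \<open>
  Expanding the factors one at a time: the first \<open>s\<close> are arbitrary, the others are basis functions.
\<close>
lemma eventually_binomial_sum_prod:
  assumes "\<And>i. i \<le> d \<Longrightarrow> numerical (f i)"
  shows "eventually_binomial_sum d (\<lambda>n. \<Prod>i\<le>d. f i (n i))"
proof -
  have "eventually_binomial_sum d (\<lambda>n. \<Prod>i\<le>d. f i (n i))"
    if "s \<le> Suc d" "\<And>i. i < s \<Longrightarrow> numerical (f i)" "\<And>i. s \<le> i \<Longrightarrow> i \<le> d \<Longrightarrow> \<exists>k. f i = (\<lambda>n. int ((n + k) choose k))"
    for s and f :: "nat \<Rightarrow> nat \<Rightarrow> int"
    using that
  proof (induction s arbitrary: f)
    case 0
    then have "\<forall>i. \<exists>k. i \<le> d \<longrightarrow> f i = (\<lambda>n. int ((n + k) choose k))" by auto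
    then obtain k where "\<And>i. i \<le> d \<Longrightarrow> f i = (\<lambda>n. int ((n + k i) choose k i))" by metis
    then have "(\<lambda>n. \<Prod>i\<le>d. f i (n i)) = (\<lambda>n. \<Prod>i\<le>d. int ((n i + k i) choose k i))" by simp
    then show ?case using eventually_binomial_sum_basis by simp
  next
    case (Suc s)
    then have s: "s \<le> d" by simp
    have "eventually_binomial_sum d (\<lambda>n. \<Prod>i\<le>d. (f(s := g)) i (n i))" if "numerical g" for g
      using that
    proof (induction rule: numerical.induct)
      case (basis k)
      show ?case
      proof (rule Suc.IH)
        fix i assume "s \<le> i" "i \<le> d"
        then show "\<exists>k'. (f(s := \<lambda>n. int ((n + k) choose k))) i = (\<lambda>n. int ((n + k') choose k'))"
          using Suc.prems(3)[of i] by (cases "i = s") auto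
      qed (use Suc.prems s in auto)
    next
      case (add g h)
      then show ?case using eventually_binomial_sum_lin[OF add.IH, of 1 1]
        by (simp add: prod_fun_upd[OF s] algebra_simps del: fun_upd_apply)
    next
      case (scale g c)
      then show ?case using eventually_binomial_sum_lin[OF scale.IH scale.IH, of c 0]
        by (simp add: prod_fun_upd[OF s] algebra_simps del: fun_upd_apply)
    next
      case (cong g m h)
      show ?case
        by (rule eventually_binomial_sum_cong[OF cong.IH], rule for_all_large_mono[OF for_all_large_ge[of d m]])
          (simp add: prod_fun_upd[OF s] cong.hyps s del: fun_upd_apply)
    qed
    from this[OF Suc.prems(2)[of s]] show ?case by simp
  qed
  from this[of "Suc d" f] assms show ?thesis by auto
qed

lemma multi_numerical_eventually_binomial_sum: "multi_numerical d F \<Longrightarrow> eventually_binomial_sum d F"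
proof (induction rule: multi_numerical.induct)
  case (prod f)
  then show ?case by (rule eventually_binomial_sum_prod)
next
  case (add F G)
  then show ?case using eventually_binomial_sum_lin[OF add.IH, of 1 1] by simp
next
  case (scale F c)
  then show ?case using eventually_binomial_sum_lin[OF scale.IH scale.IH, of c 0] by simp
qed

text \<open>
  The effect on coefficients of taking the difference in direction \<open>i\<close>.
\<close>
definition shift_coeffs :: "nat \<Rightarrow> ((nat \<Rightarrow> nat) \<Rightarrow> int) \<Rightarrow> (nat \<Rightarrow> nat) \<Rightarrow> int" where
  "shift_coeffs i e k = e (k(i := Suc (k i)))"

lemma coeff_family_shift:
  assumes "coeff_family d e"
  shows "coeff_family d (shift_coeffs i e)"
proof -
  have "inj (\<lambda>k :: nat \<Rightarrow> nat. k(i := Suc (k i)))"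
    by (rule injI) (metis fun_upd_same fun_upd_upd fun_upd_triv nat.inject)
  then have "finite ((\<lambda>k. k(i := Suc (k i))) -` {k. e k \<noteq> 0})"
    using assms unfolding coeff_family_def by (intro finite_vimageI) auto
  moreover have "(\<lambda>k. k(i := Suc (k i))) -` {k. e k \<noteq> 0} = {k. shift_coeffs i e k \<noteq> 0}"
    by (auto simp: shift_coeffs_def)
  moreover have "k \<in> multi_indices d" if "shift_coeffs i e k \<noteq> 0" for k
  proof -
    have "k(i := Suc (k i)) \<in> multi_indices d"
      using assms that unfolding coeff_family_def shift_coeffs_def by blast
    then have "(k(i := Suc (k i))) j = 0" if "j > d" for j using that unfolding multi_indices_def by blast
    then have "k j = 0" if "j > d" for j using that by (metis fun_upd_apply nat.distinct(1))
    then show ?thesis unfolding multi_indices_def by blast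
  qed
  ultimately show ?thesis unfolding coeff_family_def by auto
qed

text \<open>
  Pascal's rule: \<open>(m + k choose k) - (m - 1 + k choose k) = (m + k - 1 choose k - 1)\<close>, and the left-hand
  side vanishes for \<open>k = 0\<close>.
\<close>
lemma binomial_sum_shift:
  assumes e: "coeff_family d e" and i: "i \<le> d" and n: "1 \<le> n i"
  shows "binomial_sum d (shift_coeffs i e) n = binomial_sum d e n - binomial_sum d e (n(i := n i - 1))"
proof -
  let ?f = "\<lambda>k j m. int ((m + k j) choose k j)"
  let ?B = "\<lambda>k n. \<Prod>j\<le>d. ?f k j (n j)"
  let ?S = "{k. e k \<noteq> 0}"
  have fin: "finite ?S" using e unfolding coeff_family_def by simp
  obtain m where m: "n i = Suc m" using n by (cases "n i") auto
  have B: "?B k n - ?B k (n(i := n i - 1)) = (if k i = 0 then 0 else ?B (k(i := k i - 1)) n)" for k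
  proof -
    define Q where "Q = (\<Prod>j\<in>{..d} - {i}. ?f k j (n j))"
    have 1: "?B k n = ?f k i (n i) * Q"
      using prod_update[OF i, of "?f k" n "n i"] unfolding Q_def by simp
    have 2: "?B k (n(i := n i - 1)) = ?f k i (n i - 1) * Q"
      using prod_update[OF i, of "?f k" n "n i - 1"] unfolding Q_def by simp
    have "?B (k(i := k i - 1)) n = ?f (k(i := k i - 1)) i (n i) * (\<Prod>j\<in>{..d} - {i}. ?f (k(i := k i - 1)) j (n j))"
      by (rule prod.remove) (use i in auto)
    also have "(\<Prod>j\<in>{..d} - {i}. ?f (k(i := k i - 1)) j (n j)) = Q"
      unfolding Q_def by (rule prod.cong) auto
    finally have 3: "?B (k(i := k i - 1)) n = int ((n i + (k i - 1)) choose (k i - 1)) * Q" by simp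
    show ?thesis unfolding 1 2 3 by (cases "k i") (simp_all add: m algebra_simps)
  qed
  have "binomial_sum d e n - binomial_sum d e (n(i := n i - 1)) =
      (\<Sum>k\<in>?S. e k * (?B k n - ?B k (n(i := n i - 1))))"
    unfolding binomial_sum_def by (simp add: sum_subtractf right_diff_distrib)
  also have "\<dots> = (\<Sum>k\<in>?S. if k i = 0 then 0 else e k * ?B (k(i := k i - 1)) n)"
    unfolding B by (rule sum.cong) auto
  also have "\<dots> = (\<Sum>k\<in>{k \<in> ?S. k i \<noteq> 0}. e k * ?B (k(i := k i - 1)) n)"
    by (rule sum.mono_neutral_cong_right[OF fin]) auto
  also have "\<dots> = (\<Sum>k | shift_coeffs i e k \<noteq> 0. shift_coeffs i e k * ?B k n)"
    by (rule sum.reindex_bij_witness[where i = "\<lambda>k. k(i := Suc (k i))" and j = "\<lambda>k. k(i := k i - 1)"])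
      (auto simp: shift_coeffs_def)
  finally show ?thesis unfolding binomial_sum_def by simp
qed

text \<open>
  Uniqueness of the coefficients, by induction on a bound for the total degree. Differences of a
  function vanishing for large \<open>n\<close> vanish for large \<open>n\<close>, so by induction all shifts of \<open>e\<close> are zero; only
  the constant term is left, and it is the value of the function.
\<close>
lemma binomial_sum_zero_imp:
  assumes "coeff_family d e" and "for_all_large d (\<lambda>n. binomial_sum d e n = 0)"
  shows "e k = 0"
proof -
  have "\<forall>k. e k = 0"
    if "coeff_family d e" "for_all_large d (\<lambda>n. binomial_sum d e n = 0)"
      "\<And>k. e k \<noteq> 0 \<Longrightarrow> (\<Sum>i\<le>d. k i) < D" for D e
    using that
  proof (induction D arbitrary: e)
    case 0
    then show ?case by auto
  next
    case (Suc D)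
    have shift: "\<forall>k. shift_coeffs i e k = 0" if i: "i \<le> d" for i
    proof (rule Suc.IH)
      show "coeff_family d (shift_coeffs i e)" by (rule coeff_family_shift[OF Suc.prems(1)])
      show "for_all_large d (\<lambda>n. binomial_sum d (shift_coeffs i e) n = 0)"
        by (rule for_all_large_mono[OF for_all_large_conj[OF Suc.prems(2) for_all_large_decr[OF Suc.prems(2) i]]])
          (simp add: binomial_sum_shift[OF Suc.prems(1) i] del: fun_upd_apply)
    next
      fix k assume "shift_coeffs i e k \<noteq> 0"
      then have "(\<Sum>j\<le>d. (k(i := Suc (k i))) j) < Suc D" unfolding shift_coeffs_def by (rule Suc.prems(3))
      moreover have "(\<Sum>j\<le>d. (k(i := Suc (k i))) j) = Suc (\<Sum>j\<le>d. k j)"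
      proof -
        have "(\<Sum>j\<le>d. (k(i := Suc (k i))) j) = Suc (k i) + (\<Sum>j\<in>{..d} - {i}. (k(i := Suc (k i))) j)"
          using i by (subst sum.remove[of _ i]) auto
        also have "(\<Sum>j\<in>{..d} - {i}. (k(i := Suc (k i))) j) = (\<Sum>j\<in>{..d} - {i}. k j)"
          by (rule sum.cong) auto
        also have "Suc (k i) + (\<Sum>j\<in>{..d} - {i}. k j) = Suc (\<Sum>j\<le>d. k j)"
          using i by (simp add: sum.remove[of "{..d}" i])
        finally show ?thesis .
      qed
      ultimately show "(\<Sum>j\<le>d. k j) < D" by simp
    qed
    have nz: "e k = 0" if nonzero: "k \<noteq> (\<lambda>_. 0)" for k
    proof (rule ccontr)
      assume "e k \<noteq> 0"
      then have "k \<in> multi_indices d" using Suc.prems(1) unfolding coeff_family_def by auto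
      moreover obtain i where "k i \<noteq> 0" using nonzero by (auto simp: fun_eq_iff)
      ultimately have "i \<le> d" by (cases "i \<le> d") (simp_all add: multi_indices_def)
      then have "shift_coeffs i e (k(i := k i - 1)) = 0" using shift by blast
      then have "e (k(i := Suc (k i - 1))) = 0" by (simp add: shift_coeffs_def)
      with \<open>k i \<noteq> 0\<close> \<open>e k \<noteq> 0\<close> show False by (simp add: fun_upd_idem)
    qed
    obtain c where c: "\<And>n. n \<in> multi_indices d \<Longrightarrow> \<forall>i\<le>d. c \<le> n i \<Longrightarrow> binomial_sum d e n = 0"
      using Suc.prems(2) unfolding for_all_large_def by blast
    have "binomial_sum d e (\<lambda>i. if i \<le> d then c else 0) = 0"
      by (rule c) (auto simp: multi_indices_def)
    moreover have "binomial_sum d e n = e (\<lambda>_. 0)" for n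
      using nz by (subst binomial_sum_superset[of "{\<lambda>_. 0}"]) auto
    ultimately have "e (\<lambda>_. 0) = 0" by simp
    show ?case
    proof
      fix k show "e k = 0" using nz[of k] \<open>e (\<lambda>_. 0) = 0\<close> by (cases "k = (\<lambda>_. 0)") simp_all
    qed
  qed
  moreover obtain D where "\<And>k. e k \<noteq> 0 \<Longrightarrow> (\<Sum>i\<le>d. k i) < D"
  proof -
    have "finite ((\<lambda>k. \<Sum>i\<le>d. k i) ` {k. e k \<noteq> 0})" using assms(1) unfolding coeff_family_def by simp
    then obtain D where D: "\<forall>m\<in>(\<lambda>k. \<Sum>i\<le>d. k i) ` {k. e k \<noteq> 0}. m < D"
      using finite_nat_set_iff_bounded by blast
    show thesis by (rule that[of D]) (use D in auto)
  qed
  ultimately have "\<forall>k. e k = 0" using assms by metis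
  then show ?thesis ..
qed

section \<open>Submodules and relative lengths\<close>

context module
begin

abbreviation scalar (infixl "\<bullet>" 70) where
  "a \<bullet> m \<equiv> a \<odot>\<^bsub>M\<^esub> m"

abbreviation sum_of_subsets (infixl "\<uplus>" 60) where
  "A \<uplus> B \<equiv> A <+>\<^bsub>M\<^esub> B"

lemma submodule_zero: "submodule H R M \<Longrightarrow> \<zero>\<^bsub>M\<^esub> \<in> H"
  using submodule.axioms(1) subgroup.one_closed by fastforce

lemma submodule_carrier: "submodule H R M \<Longrightarrow> x \<in> H \<Longrightarrow> x \<in> carrier M"
  using submoduleE(1) by blast

lemma submoduleI_smult:
  assumes "H \<subseteq> carrier M" "\<zero>\<^bsub>M\<^esub> \<in> H" "\<And>a b. a \<in> H \<Longrightarrow> b \<in> H \<Longrightarrow> a \<oplus>\<^bsub>M\<^esub> b \<in> H"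
    and smult: "\<And>a x. a \<in> carrier R \<Longrightarrow> x \<in> H \<Longrightarrow> a \<bullet> x \<in> H"
  shows "submodule H R M"
proof (rule submoduleI)
  fix x assume x: "x \<in> H"
  then have "(\<ominus> \<one>) \<bullet> x = \<ominus>\<^bsub>M\<^esub> x" using assms(1) smult_l_minus[of \<one> x] by auto
  with smult[of "\<ominus> \<one>" x] x show "\<ominus>\<^bsub>M\<^esub> x \<in> H" by simp
qed (use assms in auto)

lemma submodule_diff:
  assumes "submodule H R M" "x \<in> H" "x \<oplus>\<^bsub>M\<^esub> y \<in> H" "y \<in> carrier M"
  shows "y \<in> H"
proof -
  have "y = \<ominus>\<^bsub>M\<^esub> x \<oplus>\<^bsub>M\<^esub> (x \<oplus>\<^bsub>M\<^esub> y)"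
    using assms submodule_carrier[OF assms(1,2)] M.r_neg1 by simp
  then show ?thesis using submoduleE(3,5)[OF assms(1)] assms(2,3) by metis
qed

lemma zero_submodule: "submodule {\<zero>\<^bsub>M\<^esub>} R M"
  by (rule submoduleI) auto

lemma submodule_Int: "submodule A R M \<Longrightarrow> submodule B R M \<Longrightarrow> submodule (A \<inter> B) R M"
  by (rule submoduleI) (auto simp: submoduleE submodule_zero dest: submodule_carrier)

lemma submodule_Inter:
  assumes "\<And>H. H \<in> S \<Longrightarrow> submodule H R M" "S \<noteq> {}"
  shows "submodule (\<Inter>S) R M"
  using assms by (intro submoduleI) (auto simp: submoduleE submodule_zero dest: submodule_carrier)

lemma mem_sum_iff: "x \<in> A \<uplus> B \<longleftrightarrow> (\<exists>a\<in>A. \<exists>b\<in>B. x = a \<oplus>\<^bsub>M\<^esub> b)"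
  by (auto simp: set_add_def')

lemma submodule_sum:
  assumes A: "submodule A R M" and B: "submodule B R M"
  shows "submodule (A \<uplus> B) R M"
proof (rule submoduleI_smult)
  note carr = submodule_carrier[OF A] submodule_carrier[OF B]
  show "A \<uplus> B \<subseteq> carrier M" by (auto simp: mem_sum_iff carr)
  show "\<zero>\<^bsub>M\<^esub> \<in> A \<uplus> B"
    unfolding mem_sum_iff using submodule_zero[OF A] submodule_zero[OF B] by (intro bexI) auto
  fix x assume "x \<in> A \<uplus> B"
  then obtain a b where ab: "a \<in> A" "b \<in> B" "x = a \<oplus>\<^bsub>M\<^esub> b" unfolding mem_sum_iff by blast
  {
    fix r assume "r \<in> carrier R"
    then have "r \<bullet> x = r \<bullet> a \<oplus>\<^bsub>M\<^esub> r \<bullet> b" using ab by (simp add: carr smult_r_distr)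
    then show "r \<bullet> x \<in> A \<uplus> B"
      unfolding mem_sum_iff using ab submoduleE(4)[OF A \<open>r \<in> carrier R\<close>] submoduleE(4)[OF B \<open>r \<in> carrier R\<close>] by blast
  }
  fix y assume "y \<in> A \<uplus> B"
  then obtain c e where ce: "c \<in> A" "e \<in> B" "y = c \<oplus>\<^bsub>M\<^esub> e" unfolding mem_sum_iff by blast
  then have "x \<oplus>\<^bsub>M\<^esub> y = (a \<oplus>\<^bsub>M\<^esub> c) \<oplus>\<^bsub>M\<^esub> (b \<oplus>\<^bsub>M\<^esub> e)" using ab by (simp add: carr M.a_ac)
  then show "x \<oplus>\<^bsub>M\<^esub> y \<in> A \<uplus> B"
    unfolding mem_sum_iff using ab ce submoduleE(5)[OF A] submoduleE(5)[OF B] by blast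
qed

lemma sum_upper1: "submodule A R M \<Longrightarrow> submodule B R M \<Longrightarrow> A \<subseteq> A \<uplus> B"
  by (force simp: mem_sum_iff dest: submodule_carrier submodule_zero)

lemma sum_upper2: "submodule A R M \<Longrightarrow> submodule B R M \<Longrightarrow> B \<subseteq> A \<uplus> B"
  by (force simp: mem_sum_iff dest: submodule_carrier submodule_zero)

lemma sum_least: "submodule H R M \<Longrightarrow> A \<subseteq> H \<Longrightarrow> B \<subseteq> H \<Longrightarrow> A \<uplus> B \<subseteq> H"
  unfolding mem_sum_iff subset_eq by (metis submoduleE(5) mem_sum_iff)

lemma sum_mono: "A \<subseteq> A' \<Longrightarrow> B \<subseteq> B' \<Longrightarrow> A \<uplus> B \<subseteq> A' \<uplus> B'"
  unfolding subset_iff mem_sum_iff by blast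

lemma sum_absorb: "submodule A R M \<Longrightarrow> submodule B R M \<Longrightarrow> B \<subseteq> A \<Longrightarrow> A \<uplus> B = A"
  by (meson equalityI order_refl sum_least sum_upper1)

text \<open>
  Whatever is said below about intersecting with a submodule, or adding one, rests on this fact.
\<close>
lemma modular_law:
  assumes A: "submodule A R M" and B: "submodule B R M" and C: "submodule C R M" and "A \<subseteq> C"
  shows "(A \<uplus> B) \<inter> C = A \<uplus> (B \<inter> C)"
proof
  show "(A \<uplus> B) \<inter> C \<subseteq> A \<uplus> (B \<inter> C)"
  proof
    fix x assume "x \<in> (A \<uplus> B) \<inter> C"
    then obtain a b where ab: "a \<in> A" "b \<in> B" "x = a \<oplus>\<^bsub>M\<^esub> b" "x \<in> C"
      unfolding Int_iff mem_sum_iff by blast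
    then have "b \<in> C" using submodule_diff[OF C] \<open>A \<subseteq> C\<close> submodule_carrier[OF B] by blast
    with ab show "x \<in> A \<uplus> (B \<inter> C)" unfolding mem_sum_iff by blast
  qed
  have "A \<uplus> (B \<inter> C) \<subseteq> C" using \<open>A \<subseteq> C\<close> by (intro sum_least[OF C]) auto
  moreover have "A \<uplus> (B \<inter> C) \<subseteq> A \<uplus> B" by (rule sum_mono) auto
  ultimately show "A \<uplus> (B \<inter> C) \<subseteq> (A \<uplus> B) \<inter> C" by blast
qed

text \<open>
  Comparable submodules with the same trace on \<open>Q\<close> and the same sum with \<open>Q\<close> coincide. This is what
  makes length additive and the ascending chain condition stable under extensions.
\<close>
lemma eq_of_Int_sum_eq:
  assumes "submodule W R M" "submodule Y R M" "submodule Q R M" "W \<subseteq> Y"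
    and "W \<inter> Q = Y \<inter> Q" and "W \<uplus> Q = Y \<uplus> Q"
  shows "W = Y"
proof -
  have "Y = (W \<uplus> Q) \<inter> Y" using assms sum_upper1[of Y Q] by auto
  also have "\<dots> = W \<uplus> (Q \<inter> Y)" by (rule modular_law) (use assms in auto)
  also have "\<dots> = W \<uplus> (W \<inter> Q)" using assms by (simp add: Int_commute)
  also have "\<dots> = W" by (rule sum_absorb) (use assms submodule_Int in auto)
  finally show ?thesis by simp
qed

lemma mod_span_submodule: "S \<subseteq> carrier M \<Longrightarrow> submodule (mod_span R M S) R M"
  unfolding mod_span_def using carrier_is_submodule by (intro submodule_Inter) auto

lemma mod_span_superset: "S \<subseteq> mod_span R M S"
  unfolding mod_span_def by blast

lemma mod_span_least: "submodule H R M \<Longrightarrow> S \<subseteq> H \<Longrightarrow> mod_span R M S \<subseteq> H"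
  unfolding mod_span_def by blast

definition between :: "'c set \<Rightarrow> 'c set \<Rightarrow> 'c set set" where
  "between P Q = {H. submodule H R M \<and> P \<subseteq> H \<and> H \<subseteq> Q}"

definition len :: "'c set \<Rightarrow> 'c set \<Rightarrow> enat" where
  "len P Q = height (between P Q)"

lemma len_add:
  assumes P: "submodule P R M" and Q: "submodule Q R M" and S: "submodule S R M"
    and "P \<subseteq> Q" "Q \<subseteq> S"
  shows "len P S = len P Q + len Q S"
proof (rule antisym)
  show "len P S \<le> len P Q + len Q S"
    unfolding len_def
  proof (rule height_le_add[where f = "\<lambda>W. W \<inter> Q" and g = "\<lambda>W. W \<uplus> Q"])
    fix W assume "W \<in> between P S"
    then have W: "submodule W R M" "P \<subseteq> W" "W \<subseteq> S" unfolding between_def by auto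
    show "W \<inter> Q \<in> between P Q" unfolding between_def using W assms submodule_Int by auto
    show "W \<uplus> Q \<in> between Q S"
      unfolding between_def using W assms submodule_sum sum_upper2 sum_least by auto
  next
    fix W Y assume "W \<in> between P S" "Y \<in> between P S" and le: "W \<subseteq> Y"
    then have WY: "submodule W R M" "submodule Y R M" unfolding between_def by auto
    show "W \<uplus> Q \<subseteq> Y \<uplus> Q" using le by (rule sum_mono) simp
    show "W = Y" if "W \<inter> Q = Y \<inter> Q" "W \<uplus> Q = Y \<uplus> Q"
      by (rule eq_of_Int_sum_eq[OF WY Q le that])
  qed auto
  show "len P Q + len Q S \<le> len P S"
    unfolding len_def by (rule height_add_le) (use assms in \<open>auto simp: between_def\<close>)
qed

lemma len_antimono: "P \<subseteq> P' \<Longrightarrow> len P' Q \<le> len P Q"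
  unfolding len_def by (rule height_mono_map[where f = "\<lambda>W. W"]) (auto simp: between_def)

lemma len_refl: "submodule P R M \<Longrightarrow> len P P = 0"
proof -
  assume "submodule P R M"
  then have "between P P = {P}" by (auto simp: between_def)
  then have "\<not> has_chain (between P P) (Suc t)" for t
    unfolding has_chain_def by (metis le0 less_irrefl singletonD Suc_leI zero_less_Suc)
  then have "len P P \<le> enat 0"
    unfolding len_def height_le_enat_iff by (metis le0 not0_implies_Suc)
  then show ?thesis by (simp add: zero_enat_def[symmetric])
qed

text \<open>
  The second isomorphism theorem, \<open>(A + B)/A \<cong> B/(A \<inter> B)\<close>, as an isomorphism of intervals.
\<close>
lemma len_sum:
  assumes A: "submodule A R M" and B: "submodule B R M"
  shows "len A (A \<uplus> B) = len (A \<inter> B) B"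
proof (rule antisym)
  have 1: "A \<uplus> (Y \<inter> B) = Y" if "Y \<in> between A (A \<uplus> B)" for Y
  proof -
    from that have Y: "submodule Y R M" "A \<subseteq> Y" "Y \<subseteq> A \<uplus> B" by (auto simp: between_def)
    have "Y = (A \<uplus> B) \<inter> Y" using Y by auto
    also have "\<dots> = A \<uplus> (B \<inter> Y)" by (rule modular_law) (use assms Y in auto)
    finally show ?thesis by (simp add: Int_commute)
  qed
  have 2: "(A \<uplus> W) \<inter> B = W" if "W \<in> between (A \<inter> B) B" for W
  proof -
    from that have W: "submodule W R M" "A \<inter> B \<subseteq> W" "W \<subseteq> B" by (auto simp: between_def)
    have "A \<uplus> W = W \<uplus> A"
      by (rule antisym; rule sum_least) (use submodule_sum sum_upper1 sum_upper2 A W in auto)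
    then have "(A \<uplus> W) \<inter> B = W \<uplus> (A \<inter> B)" using modular_law[OF W(1) A B W(3)] by simp
    also have "\<dots> = W" by (rule sum_absorb) (use W submodule_Int[OF A B] in auto)
    finally show ?thesis .
  qed
  show "len A (A \<uplus> B) \<le> len (A \<inter> B) B"
    unfolding len_def
  proof (rule height_mono_map[where f = "\<lambda>Y. Y \<inter> B"])
    fix W Y assume WY: "W \<in> between A (A \<uplus> B)" "Y \<in> between A (A \<uplus> B)" "W \<subset> Y"
    then have "W \<inter> B \<noteq> Y \<inter> B" using 1[OF WY(1)] 1[OF WY(2)] by (metis order_less_irrefl)
    then show "W \<inter> B \<subset> Y \<inter> B" using WY(3) by blast
  qed (use submodule_Int[OF _ B] in \<open>auto simp: between_def\<close>)
  show "len (A \<inter> B) B \<le> len A (A \<uplus> B)"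
    unfolding len_def
  proof (rule height_mono_map[where f = "\<lambda>W. A \<uplus> W"])
    fix W assume "W \<in> between (A \<inter> B) B"
    then have W: "submodule W R M" "W \<subseteq> B" by (auto simp: between_def)
    show "A \<uplus> W \<in> between A (A \<uplus> B)"
      unfolding between_def using submodule_sum[OF A W(1)] sum_upper1[OF A W(1)] sum_mono[OF order_refl W(2)] by auto
  next
    fix W Y assume WY: "W \<in> between (A \<inter> B) B" "Y \<in> between (A \<inter> B) B" "W \<subset> Y"
    then have "A \<uplus> W \<noteq> A \<uplus> Y" using 2[OF WY(1)] 2[OF WY(2)] by (metis order_less_irrefl)
    then show "A \<uplus> W \<subset> A \<uplus> Y"
      using sum_mono[of A A W Y] WY(3) by blast
  qed
qed

definition colon :: "'c set \<Rightarrow> 'a \<Rightarrow> 'c set" where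
  "colon P a = {m \<in> carrier M. a \<bullet> m \<in> P}"

lemma colon_submodule:
  assumes "submodule P R M" "a \<in> carrier R"
  shows "submodule (colon P a) R M"
  using assms
  by (intro submoduleI)
    (auto simp: colon_def submodule_zero submoduleE smult_r_minus smult_r_distr
      smult_assoc1[symmetric] m_comm[of a], simp add: smult_assoc1 submoduleE)

lemma colon_superset: "submodule P R M \<Longrightarrow> a \<in> carrier R \<Longrightarrow> P \<subseteq> colon P a"
  by (auto simp: colon_def submoduleE dest: submodule_carrier)

definition mul :: "'a \<Rightarrow> 'c set \<Rightarrow> 'c set" where
  "mul a W = (\<lambda>m. a \<bullet> m) ` W"

lemma mul_submodule:
  assumes W: "submodule W R M" and a: "a \<in> carrier R"
  shows "submodule (mul a W) R M"
proof (rule submoduleI_smult)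
  note carr = submodule_carrier[OF W]
  show "mul a W \<subseteq> carrier M" using a by (auto simp: mul_def carr)
  show "\<zero>\<^bsub>M\<^esub> \<in> mul a W" unfolding mul_def using submodule_zero[OF W] a by force
  fix x assume "x \<in> mul a W"
  then obtain u where u: "u \<in> W" "x = a \<bullet> u" unfolding mul_def by blast
  {
    fix r assume r: "r \<in> carrier R"
    have "r \<bullet> x = a \<bullet> (r \<bullet> u)"
      using u a r by (simp add: carr smult_assoc1[symmetric] m_comm)
    then show "r \<bullet> x \<in> mul a W" unfolding mul_def using submoduleE(4)[OF W r] u by blast
  }
  fix y assume "y \<in> mul a W"
  then obtain v where v: "v \<in> W" "y = a \<bullet> v" unfolding mul_def by blast
  have "x \<oplus>\<^bsub>M\<^esub> y = a \<bullet> (u \<oplus>\<^bsub>M\<^esub> v)" using u v a by (simp add: carr smult_r_distr)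
  then show "x \<oplus>\<^bsub>M\<^esub> y \<in> mul a W" unfolding mul_def using submoduleE(5)[OF W] u v by blast
qed

lemma mul_mono: "W \<subseteq> Y \<Longrightarrow> mul a W \<subseteq> mul a Y"
  by (auto simp: mul_def)

text \<open>
  Multiplication by \<open>a\<close> induces an isomorphism of \<open>M/(P : a)\<close> onto \<open>(P + aM)/P\<close>, so it matches the
  submodules between \<open>(P : a) + A\<close> and \<open>(P : a) + B\<close> with those between \<open>P + aA\<close> and \<open>P + aB\<close>.
\<close>
lemma len_mul:
  assumes P: "submodule P R M" and a: "a \<in> carrier R"
    and W: "submodule W R M" and Y: "submodule Y R M"
  shows "len (P \<uplus> mul a W) (P \<uplus> mul a Y) = len (colon P a \<uplus> W) (colon P a \<uplus> Y)"
proof (rule antisym)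
  let ?K = "colon P a"
  have K: "submodule ?K R M" by (rule colon_submodule[OF P a])
  have sub: "submodule (P \<uplus> mul a Z) R M" if "submodule Z R M" for Z
    using submodule_sum[OF P mul_submodule[OF that a]] .
  have 1: "colon (P \<uplus> mul a Z) a = ?K \<uplus> Z" if Z: "submodule Z R M" for Z
  proof
    show "colon (P \<uplus> mul a Z) a \<subseteq> ?K \<uplus> Z"
    proof
      fix m assume m: "m \<in> colon (P \<uplus> mul a Z) a"
      then obtain p z where pz: "p \<in> P" "z \<in> Z" "a \<bullet> m = p \<oplus>\<^bsub>M\<^esub> a \<bullet> z" "m \<in> carrier M"
        unfolding colon_def mem_sum_iff mul_def by blast
      have carr: "p \<in> carrier M" "z \<in> carrier M" "a \<bullet> z \<in> carrier M"
        using pz P Z a submodule_carrier by auto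
      have "a \<bullet> (m \<oplus>\<^bsub>M\<^esub> \<ominus>\<^bsub>M\<^esub> z) = p"
        using pz carr a by (simp add: smult_r_distr smult_r_minus M.a_assoc M.r_neg)
      then have "m \<oplus>\<^bsub>M\<^esub> \<ominus>\<^bsub>M\<^esub> z \<in> ?K" unfolding colon_def using pz carr by simp
      moreover have "m = (m \<oplus>\<^bsub>M\<^esub> \<ominus>\<^bsub>M\<^esub> z) \<oplus>\<^bsub>M\<^esub> z" using pz carr by (simp add: M.a_assoc M.l_neg)
      ultimately show "m \<in> ?K \<uplus> Z" unfolding mem_sum_iff using pz by blast
    qed
    have "?K \<subseteq> colon (P \<uplus> mul a Z) a" "Z \<subseteq> colon (P \<uplus> mul a Z) a"
      using sum_upper1[OF P mul_submodule[OF Z a]] sum_upper2[OF P mul_submodule[OF Z a]] Z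
      by (auto simp: colon_def mul_def dest: submodule_carrier)
    then show "?K \<uplus> Z \<subseteq> colon (P \<uplus> mul a Z) a"
      by (intro sum_least colon_submodule sub Z a)
  qed
  have colon_mono: "U \<subseteq> V \<Longrightarrow> colon U a \<subseteq> colon V a" for U V by (auto simp: colon_def)
  have 2: "P \<uplus> mul a (colon V a) = V" if "V \<in> between (P \<uplus> mul a W) (P \<uplus> mul a Y)" for V
  proof
    from that have V: "submodule V R M" "P \<uplus> mul a W \<subseteq> V" "V \<subseteq> P \<uplus> mul a Y"
      by (auto simp: between_def)
    then have PV: "P \<subseteq> V" using sum_upper1[OF P mul_submodule[OF W a]] by blast
    then show "P \<uplus> mul a (colon V a) \<subseteq> V" by (intro sum_least V) (auto simp: mul_def colon_def)
    show "V \<subseteq> P \<uplus> mul a (colon V a)"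
    proof
      fix v assume v: "v \<in> V"
      then have "v \<in> P \<uplus> mul a Y" using V(3) by blast
      then obtain p y where py: "p \<in> P" "y \<in> Y" "v = p \<oplus>\<^bsub>M\<^esub> a \<bullet> y"
        unfolding mem_sum_iff mul_def by blast
      then have "a \<bullet> y \<in> V"
        using submodule_diff[OF V(1), of p "a \<bullet> y"] PV v a Y submodule_carrier by auto
      then have "y \<in> colon V a" using py Y submodule_carrier by (auto simp: colon_def)
      then show "v \<in> P \<uplus> mul a (colon V a)" unfolding mem_sum_iff mul_def using py by blast
    qed
  qed
  have 3: "colon (P \<uplus> mul a Z) a = Z" if "Z \<in> between (?K \<uplus> W) (?K \<uplus> Y)" for Z
  proof -
    from that have Z: "submodule Z R M" "?K \<uplus> W \<subseteq> Z" by (auto simp: between_def)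
    then have "?K \<subseteq> Z" using sum_upper1[OF K W] by blast
    then have "?K \<uplus> Z = Z" using sum_upper2[OF K Z(1)] sum_least[OF Z(1)] by blast
    then show ?thesis using 1[OF Z(1)] by simp
  qed
  have aK: "P \<uplus> mul a (?K \<uplus> Z) = P \<uplus> mul a Z" if Z: "submodule Z R M" for Z
  proof
    have "mul a (?K \<uplus> Z) \<subseteq> P \<uplus> mul a Z" using 1[OF Z] by (auto simp: mul_def colon_def)
    then show "P \<uplus> mul a (?K \<uplus> Z) \<subseteq> P \<uplus> mul a Z"
      by (intro sum_least sub Z sum_upper1 P mul_submodule a)
    show "P \<uplus> mul a Z \<subseteq> P \<uplus> mul a (?K \<uplus> Z)"
      by (intro sum_mono mul_mono sum_upper2 K Z) simp
  qed
  show "len (P \<uplus> mul a W) (P \<uplus> mul a Y) \<le> len (?K \<uplus> W) (?K \<uplus> Y)"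
    unfolding len_def
  proof (rule height_mono_map[where f = "\<lambda>V. colon V a"])
    fix V assume "V \<in> between (P \<uplus> mul a W) (P \<uplus> mul a Y)"
    then have V: "submodule V R M" "P \<uplus> mul a W \<subseteq> V" "V \<subseteq> P \<uplus> mul a Y"
      by (auto simp: between_def)
    show "colon V a \<in> between (?K \<uplus> W) (?K \<uplus> Y)"
      using colon_submodule[OF V(1) a] colon_mono[OF V(2)] colon_mono[OF V(3)]
      unfolding between_def 1[OF W] 1[OF Y] by simp
  next
    fix U V assume "U \<in> between (P \<uplus> mul a W) (P \<uplus> mul a Y)"
      "V \<in> between (P \<uplus> mul a W) (P \<uplus> mul a Y)" "U \<subset> V"
    then have "colon U a \<noteq> colon V a" using 2[of U] 2[of V] by (metis order_less_irrefl)
    then show "colon U a \<subset> colon V a" using colon_mono[of U V] \<open>U \<subset> V\<close> by blast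
  qed
  show "len (?K \<uplus> W) (?K \<uplus> Y) \<le> len (P \<uplus> mul a W) (P \<uplus> mul a Y)"
    unfolding len_def
  proof (rule height_mono_map[where f = "\<lambda>Z. P \<uplus> mul a Z"])
    fix Z assume "Z \<in> between (?K \<uplus> W) (?K \<uplus> Y)"
    then have Z: "submodule Z R M" "?K \<uplus> W \<subseteq> Z" "Z \<subseteq> ?K \<uplus> Y"
      by (auto simp: between_def)
    show "P \<uplus> mul a Z \<in> between (P \<uplus> mul a W) (P \<uplus> mul a Y)"
      using sub[OF Z(1)] sum_mono[OF order_refl mul_mono[OF Z(2)], of P a]
        sum_mono[OF order_refl mul_mono[OF Z(3)], of P a]
      unfolding between_def aK[OF W] aK[OF Y] by simp
  next
    fix U V assume "U \<in> between (?K \<uplus> W) (?K \<uplus> Y)"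
      "V \<in> between (?K \<uplus> W) (?K \<uplus> Y)" "U \<subset> V"
    then have "P \<uplus> mul a U \<noteq> P \<uplus> mul a V" using 3[of U] 3[of V] by (metis order_less_irrefl)
    then show "P \<uplus> mul a U \<subset> P \<uplus> mul a V"
      using sum_mono[OF order_refl mul_mono[of U V], of P a] \<open>U \<subset> V\<close> by blast
  qed
qed

text \<open>
  The length count for one weak-(FC)-element \<open>a\<close>. Here \<open>B \<subseteq> A\<close> are \<open>M\<^bsub>n+\<epsilon>\<^sub>0\<^esub> \<subseteq> M\<^sub>n\<close> and \<open>D \<subseteq> C\<close> are
  \<open>M\<^bsub>m+\<epsilon>\<^sub>0\<^esub> \<subseteq> M\<^sub>m\<close> with \<open>m = n - \<epsilon>\<^sub>i\<close>. Insert \<open>P + B + aC\<close> between \<open>P + B\<close> and \<open>P + A\<close>. The upper part is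
  the length modulo \<open>P' = P + aM\<close>, as \<open>P'\<close> meets \<open>P + A\<close> in \<open>P + aC\<close>. The lower part is
  \<open>(P + aC)/(P + aD)\<close>, which is \<open>C/D\<close> modulo \<open>P : a\<close>, and that is \<open>C/D\<close> modulo \<open>P\<close> since \<open>P : a\<close> meets
  \<open>P + C\<close> only in \<open>P\<close>.
\<close>
lemma len_quotient_by_mul:
  assumes P: "submodule P R M" and a: "a \<in> carrier R"
    and A: "submodule A R M" and B: "submodule B R M" and C: "submodule C R M" and D: "submodule D R M"
    and "B \<subseteq> A" "D \<subseteq> C" "mul a C \<subseteq> A" "mul a D \<subseteq> B"
    and AC: "(P \<uplus> mul a (carrier M)) \<inter> (P \<uplus> A) \<subseteq> P \<uplus> mul a C"
    and BD: "(P \<uplus> mul a (carrier M)) \<inter> (P \<uplus> B) \<subseteq> P \<uplus> mul a D"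
    and K: "colon P a \<inter> (P \<uplus> C) \<subseteq> P"
  defines "P' \<equiv> P \<uplus> mul a (carrier M)"
  shows "len (P \<uplus> B) (P \<uplus> A) =
    len (P \<uplus> D) (P \<uplus> C) + len (P' \<uplus> B) (P' \<uplus> A)"
proof -
  define U where "U = P \<uplus> B"
  define V where "V = P \<uplus> A"
  define W where "W = P \<uplus> mul a C"
  define K' where "K' = colon P a"
  note mC = mul_submodule[OF C a] and mD = mul_submodule[OF D a]
    and mM = mul_submodule[OF carrier_is_submodule a]
  have s: "submodule U R M" "submodule V R M" "submodule W R M" "submodule P' R M" "submodule K' R M"
    unfolding U_def V_def W_def P'_def K'_def
    by (intro submodule_sum P A B mC mM colon_submodule a)+
  have "U \<subseteq> V" unfolding U_def V_def using \<open>B \<subseteq> A\<close> by (rule sum_mono[OF order_refl])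
  have "W \<subseteq> V" unfolding W_def V_def using \<open>mul a C \<subseteq> A\<close> by (rule sum_mono[OF order_refl])
  have "W \<subseteq> P'" unfolding W_def P'_def by (intro sum_mono mul_mono submoduleE(1) C) simp
  have "P \<subseteq> P'" "P \<subseteq> U" "P \<subseteq> V" "P \<subseteq> W" "A \<subseteq> V" "B \<subseteq> U" "mul a D \<subseteq> W"
    unfolding P'_def U_def V_def W_def
    using sum_upper1 sum_upper2 P A B mM mC mul_mono[OF \<open>D \<subseteq> C\<close>, of a] by (blast, blast, blast, blast, blast, blast, blast)
  have "P \<subseteq> K'" unfolding K'_def by (rule colon_superset[OF P a])
  have UW: "U \<subseteq> U \<uplus> W" "submodule (U \<uplus> W) R M" "U \<uplus> W \<subseteq> V"
    using sum_upper1[OF s(1,3)] submodule_sum[OF s(1,3)] sum_least[OF s(2) \<open>U \<subseteq> V\<close> \<open>W \<subseteq> V\<close>] by auto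
  have "U \<inter> W = P \<uplus> mul a D"
  proof
    show "U \<inter> W \<subseteq> P \<uplus> mul a D" using BD \<open>W \<subseteq> P'\<close> unfolding U_def P'_def by blast
    show "P \<uplus> mul a D \<subseteq> U \<inter> W"
      using \<open>P \<subseteq> U\<close> \<open>P \<subseteq> W\<close> \<open>mul a D \<subseteq> B\<close> \<open>B \<subseteq> U\<close> \<open>mul a D \<subseteq> W\<close>
      by (intro sum_least submodule_Int s) blast+
  qed
  then have "len U (U \<uplus> W) = len (P \<uplus> mul a D) (P \<uplus> mul a C)"
    using len_sum[OF s(1,3)] unfolding W_def by simp
  also have "\<dots> = len (K' \<uplus> D) (K' \<uplus> C)" unfolding K'_def by (rule len_mul[OF P a D C])
  also have "\<dots> = len (P \<uplus> D) (P \<uplus> C)"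
  proof -
    note PD = submodule_sum[OF P D] and PC = submodule_sum[OF P C] and KD = submodule_sum[OF s(5) D]
      and KC = submodule_sum[OF s(5) C]
    have "(K' \<uplus> D) \<uplus> (P \<uplus> C) = K' \<uplus> C"
    proof
      show "(K' \<uplus> D) \<uplus> (P \<uplus> C) \<subseteq> K' \<uplus> C"
        using \<open>D \<subseteq> C\<close> \<open>P \<subseteq> K'\<close> by (intro sum_least KC sum_mono) auto
      have "K' \<subseteq> (K' \<uplus> D) \<uplus> (P \<uplus> C)" "C \<subseteq> (K' \<uplus> D) \<uplus> (P \<uplus> C)"
        using sum_upper1[OF s(5) D] sum_upper2[OF P C] sum_upper1[OF KD PC] sum_upper2[OF KD PC] by auto
      then show "K' \<uplus> C \<subseteq> (K' \<uplus> D) \<uplus> (P \<uplus> C)"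
        by (intro sum_least submodule_sum KD PC)
    qed
    moreover have "(K' \<uplus> D) \<inter> (P \<uplus> C) = P \<uplus> D"
    proof
      have "K' \<uplus> D \<subseteq> (P \<uplus> D) \<uplus> K'"
        using sum_upper2[OF P D] sum_upper1[OF PD s(5)] sum_upper2[OF PD s(5)]
        by (intro sum_least submodule_sum PD s) auto
      then have "(K' \<uplus> D) \<inter> (P \<uplus> C) \<subseteq> ((P \<uplus> D) \<uplus> K') \<inter> (P \<uplus> C)" by blast
      also have "\<dots> = (P \<uplus> D) \<uplus> (K' \<inter> (P \<uplus> C))"
        using \<open>D \<subseteq> C\<close> by (intro modular_law PD s PC sum_mono) auto
      also have "\<dots> \<subseteq> P \<uplus> D"
        by (rule sum_least[OF PD order_refl]) (use K sum_upper1[OF P D] in \<open>auto simp: K'_def\<close>)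
      finally show "(K' \<uplus> D) \<inter> (P \<uplus> C) \<subseteq> P \<uplus> D" .
      show "P \<uplus> D \<subseteq> (K' \<uplus> D) \<inter> (P \<uplus> C)"
        using sum_mono[OF \<open>P \<subseteq> K'\<close> order_refl, of D] sum_mono[OF order_refl \<open>D \<subseteq> C\<close>, of P] by blast
    qed
    ultimately show ?thesis using len_sum[OF KD PC] by simp
  qed
  finally have first: "len U (U \<uplus> W) = len (P \<uplus> D) (P \<uplus> C)" .
  note PB = submodule_sum[OF s(4) B] and PA = submodule_sum[OF s(4) A]
  have "(P' \<uplus> B) \<uplus> V = P' \<uplus> A"
  proof
    show "(P' \<uplus> B) \<uplus> V \<subseteq> P' \<uplus> A"
      unfolding V_def using \<open>B \<subseteq> A\<close> \<open>P \<subseteq> P'\<close> by (intro sum_least PA sum_mono) auto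
    have "P' \<subseteq> (P' \<uplus> B) \<uplus> V" "A \<subseteq> (P' \<uplus> B) \<uplus> V"
      using sum_upper1[OF s(4) B] \<open>A \<subseteq> V\<close> sum_upper1[OF PB s(2)] sum_upper2[OF PB s(2)] by auto
    then show "P' \<uplus> A \<subseteq> (P' \<uplus> B) \<uplus> V" by (intro sum_least submodule_sum PB s)
  qed
  moreover have "(P' \<uplus> B) \<inter> V = U \<uplus> W"
  proof
    have "P' \<uplus> B \<subseteq> U \<uplus> P'"
      using sum_upper1[OF s(1,4)] sum_upper2[OF s(1,4)] \<open>B \<subseteq> U\<close> by (intro sum_least submodule_sum s) auto
    then have "(P' \<uplus> B) \<inter> V \<subseteq> (U \<uplus> P') \<inter> V" by blast
    also have "\<dots> = U \<uplus> (P' \<inter> V)" by (rule modular_law[OF s(1,4,2) \<open>U \<subseteq> V\<close>])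
    also have "\<dots> \<subseteq> U \<uplus> W" using AC unfolding P'_def V_def W_def by (intro sum_mono) auto
    finally show "(P' \<uplus> B) \<inter> V \<subseteq> U \<uplus> W" .
    have "U \<subseteq> P' \<uplus> B" unfolding U_def using \<open>P \<subseteq> P'\<close> by (intro sum_mono) auto
    moreover have "W \<subseteq> P' \<uplus> B" using \<open>W \<subseteq> P'\<close> sum_upper1[OF s(4) B] by blast
    ultimately show "U \<uplus> W \<subseteq> (P' \<uplus> B) \<inter> V"
      using UW(3) sum_least[OF PB] by auto
  qed
  ultimately have second: "len (U \<uplus> W) V = len (P' \<uplus> B) (P' \<uplus> A)"
    using len_sum[OF PB s(2)] by simp
  have "len U V = len U (U \<uplus> W) + len (U \<uplus> W) V"
    by (rule len_add[OF s(1) UW(2) s(2) UW(1,3)])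
  then have "len U V = len (P \<uplus> D) (P \<uplus> C) + len (P' \<uplus> B) (P' \<uplus> A)"
    unfolding first second .
  then show ?thesis unfolding U_def V_def .
qed

end

section \<open>Noetherian modules\<close>

lemma (in noetherian_ring) ascending_wf_ideals: "ascending_wf {I. ideal I R}"
  unfolding ascending_wf_def wf_iff_no_infinite_down_chain
proof
  assume "\<exists>f. \<forall>i. (f (Suc i), f i) \<in> {(I', I). I \<in> {I. ideal I R} \<and> I' \<in> {I. ideal I R} \<and> I \<subset> I'}"
  then obtain f where f: "\<And>i::nat. ideal (f i) R" "\<And>i. f i \<subset> f (Suc i)" by blast
  have mono: "f i \<subseteq> f j" if "i \<le> j" for i j
    using that by (rule lift_Suc_mono_le[of f, rotated]) (use f in blast)
  have "subset.chain {I. ideal I R} (range f)"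
    unfolding subset_chain_def using f(1) mono by (auto simp del: subset_iff) (meson nle_le subsetD)
  then have "\<Union>(range f) \<in> range f" by (intro ideal_chain_is_trivial) auto
  then obtain m where "\<Union>(range f) = f m" by blast
  then have "f (Suc m) \<subseteq> f m" by blast
  with f(2) show False by blast
qed

context module
begin

definition noetherian :: bool where
  "noetherian \<longleftrightarrow> ascending_wf {H. submodule H R M}"

lemma ascending_wf_between_trans:
  assumes Q: "submodule Q R M" and S: "submodule S R M" and "P \<subseteq> Q" "Q \<subseteq> S"
    and PQ: "ascending_wf (between P Q)" and QS: "ascending_wf (between Q S)"
  shows "ascending_wf (between P S)"
proof (rule ascending_wf_pair[OF PQ QS, where f = "\<lambda>H. H \<inter> Q" and g = "\<lambda>H. H \<uplus> Q"])
  fix H assume "H \<in> between P S"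
  then have H: "submodule H R M" "P \<subseteq> H" "H \<subseteq> S" unfolding between_def by auto
  show "H \<inter> Q \<in> between P Q" unfolding between_def using H assms submodule_Int by auto
  show "H \<uplus> Q \<in> between Q S"
    unfolding between_def using H assms submodule_sum sum_upper2 sum_least by auto
next
  fix H G assume "H \<in> between P S" "G \<in> between P S" and le: "H \<subseteq> G"
  then have HG: "submodule H R M" "submodule G R M" unfolding between_def by auto
  show "H \<uplus> Q \<subseteq> G \<uplus> Q" using le by (rule sum_mono) simp
  show "H = G" if "H \<inter> Q = G \<inter> Q" "H \<uplus> Q = G \<uplus> Q"
    by (rule eq_of_Int_sum_eq[OF HG Q le that])
qed auto

definition cyclic :: "'c \<Rightarrow> 'c set" where
  "cyclic s = (\<lambda>r. r \<bullet> s) ` carrier R"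

lemma cyclic_submodule: "s \<in> carrier M \<Longrightarrow> submodule (cyclic s) R M"
proof (rule submoduleI_smult)
  assume s: "s \<in> carrier M"
  show "cyclic s \<subseteq> carrier M" using s by (auto simp: cyclic_def)
  show "\<zero>\<^bsub>M\<^esub> \<in> cyclic s" unfolding cyclic_def using s by (intro image_eqI[of _ _ \<zero>]) auto
  fix x assume "x \<in> cyclic s"
  then obtain r where r: "r \<in> carrier R" "x = r \<bullet> s" unfolding cyclic_def by blast
  show "a \<bullet> x \<in> cyclic s" if "a \<in> carrier R" for a
    unfolding cyclic_def using s r that by (intro image_eqI[of _ _ "a \<otimes> r"]) (auto simp: smult_assoc1)
  fix y assume "y \<in> cyclic s"
  then obtain t where "t \<in> carrier R" "y = t \<bullet> s" unfolding cyclic_def by blast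
  then show "x \<oplus>\<^bsub>M\<^esub> y \<in> cyclic s"
    unfolding cyclic_def using s r by (intro image_eqI[of _ _ "r \<oplus> t"]) (auto simp: smult_l_distr)
qed

lemma cyclic_self: "s \<in> carrier M \<Longrightarrow> s \<in> cyclic s"
  unfolding cyclic_def by (intro image_eqI[of _ _ \<one>]) auto

lemma cyclic_least: "submodule H R M \<Longrightarrow> s \<in> H \<Longrightarrow> cyclic s \<subseteq> H"
  by (auto simp: cyclic_def submoduleE(4))

text \<open>
  The ideal \<open>H : m\<close>. That a property of generators of an ideal extends to the whole ideal is
  deduced from this being an ideal.
\<close>
definition conductor :: "'c set \<Rightarrow> 'c \<Rightarrow> 'a set" where
  "conductor H m = {r \<in> carrier R. r \<bullet> m \<in> H}"

lemma conductor_ideal: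
  assumes H: "submodule H R M" and m: "m \<in> carrier M"
  shows "ideal (conductor H m) R"
proof (rule idealI)
  show "ring R" by (rule R.ring_axioms)
  show "subgroup (conductor H m) (add_monoid R)"
  proof (rule R.add.subgroupI)
    have "\<zero> \<in> conductor H m" using m submodule_zero[OF H] by (simp add: conductor_def)
    then show "conductor H m \<noteq> {}" by blast
  qed (use m in \<open>auto simp: conductor_def smult_l_minus smult_l_distr submoduleE[OF H]\<close>)
  show "x \<otimes> a \<in> conductor H m" if "a \<in> conductor H m" "x \<in> carrier R" for a x
    using that m submoduleE(4)[OF H] by (simp add: conductor_def smult_assoc1)
  then show "a \<otimes> x \<in> conductor H m" if "a \<in> conductor H m" "x \<in> carrier R" for a x
    using that by (metis (no_types, lifting) R.m_comm conductor_def mem_Collect_eq)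
qed

lemma genideal_smult_mem:
  assumes "submodule H R M" "m \<in> carrier M" "S \<subseteq> carrier R" "\<And>s. s \<in> S \<Longrightarrow> s \<bullet> m \<in> H" "b \<in> Idl S"
  shows "b \<bullet> m \<in> H"
proof -
  have "Idl S \<subseteq> conductor H m"
    by (rule R.genideal_minimal[OF conductor_ideal]) (use assms in \<open>auto simp: conductor_def\<close>)
  with assms(5) show ?thesis by (auto simp: conductor_def)
qed

text \<open>
  A submodule between \<open>P\<close> and \<open>P + Rs\<close> is determined by the ideal of all \<open>r\<close> with \<open>rs\<close> in it.
\<close>
lemma ascending_wf_cyclic_extension:
  assumes "noetherian_ring R" and P: "submodule P R M" and s: "s \<in> carrier M"
  shows "ascending_wf (between P (P \<uplus> cyclic s))"
proof (rule ascending_wf_map[OF noetherian_ring.ascending_wf_ideals[OF assms(1)], where f = "\<lambda>H. conductor H s"])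
  fix H assume "H \<in> between P (P \<uplus> cyclic s)"
  then show "conductor H s \<in> {I. ideal I R}" using s by (auto simp: between_def intro: conductor_ideal)
next
  fix H G assume "H \<in> between P (P \<uplus> cyclic s)" "G \<in> between P (P \<uplus> cyclic s)" "H \<subset> G"
  then have HG: "submodule H R M" "submodule G R M" "P \<subseteq> H" "P \<subseteq> G" "G \<subseteq> P \<uplus> cyclic s" "H \<subset> G"
    by (auto simp: between_def)
  then obtain g where g: "g \<in> G" "g \<notin> H" by blast
  then have "g \<in> P \<uplus> cyclic s" using HG(5) by blast
  then obtain p r where r: "p \<in> P" "r \<in> carrier R" "g = p \<oplus>\<^bsub>M\<^esub> r \<bullet> s"
    unfolding mem_sum_iff cyclic_def by blast
  have "r \<bullet> s \<in> G" by (rule submodule_diff[OF HG(2), of p]) (use r g HG s in auto)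
  moreover have "r \<bullet> s \<notin> H"
  proof
    assume "r \<bullet> s \<in> H"
    then have "g \<in> H" using r(1) r(3) HG(3) submoduleE(5)[OF HG(1), of p "r \<bullet> s"] by blast
    with g show False by blast
  qed
  ultimately show "conductor H s \<subset> conductor G s"
    using r(2) HG(6) unfolding conductor_def by blast
qed

lemma noetherian_if_fin_gen:
  assumes R: "noetherian_ring R" and "fin_gen_module R M"
  shows noetherian
proof -
  obtain S where S: "S \<subseteq> carrier M" "finite S" "mod_span R M S = carrier M"
    using assms(2) unfolding fin_gen_module_def by blast
  have "ascending_wf (between {\<zero>\<^bsub>M\<^esub>} (mod_span R M S))"
    using S(2,1)
  proof (induction S rule: finite_induct)
    case empty
    have "mod_span R M {} \<subseteq> {\<zero>\<^bsub>M\<^esub>}" by (rule mod_span_least[OF zero_submodule]) auto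
    then have e: "{(H, H'). H' \<in> between {\<zero>\<^bsub>M\<^esub>} (mod_span R M {}) \<and> H \<in> between {\<zero>\<^bsub>M\<^esub>} (mod_span R M {}) \<and> H' \<subset> H} = {}"
      by (auto simp: between_def)
    show ?case unfolding ascending_wf_def by (subst e) (rule wf_on_bot)
  next
    case (insert s S)
    have s: "s \<in> carrier M" "S \<subseteq> carrier M" using insert.prems by auto
    note sub = mod_span_submodule[OF s(2)] cyclic_submodule[OF s(1)]
    have "mod_span R M (insert s S) \<subseteq> mod_span R M S \<uplus> cyclic s"
      using mod_span_superset[of S] cyclic_self[OF s(1)] sum_upper1[OF sub] sum_upper2[OF sub]
      by (intro mod_span_least submodule_sum sub) blast+
    moreover have "ascending_wf (between {\<zero>\<^bsub>M\<^esub>} (mod_span R M S \<uplus> cyclic s))"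
      using ascending_wf_between_trans[OF sub(1) submodule_sum[OF sub] _ sum_upper1[OF sub]]
        insert.IH[OF s(2)] ascending_wf_cyclic_extension[OF R sub(1) s(1)] submodule_zero[OF sub(1)]
      by auto
    ultimately show ?case by (elim ascending_wf_subset) (auto simp: between_def)
  qed
  moreover have "{H. submodule H R M} \<subseteq> between {\<zero>\<^bsub>M\<^esub>} (mod_span R M S)"
    using S(3) submodule_zero submoduleE(1) by (auto simp: between_def)
  ultimately show ?thesis unfolding noetherian_def by (rule ascending_wf_subset)
qed

lemma noetherian_stable:
  assumes noetherian and "\<And>n::nat. submodule (u n) R M" and "\<And>m n. m \<le> n \<Longrightarrow> u m \<subseteq> u n"
  shows "\<exists>m. \<forall>n\<ge>m. u n = u m"
  using ascending_wf_chain_stable[of "{H. submodule H R M}" u] assms unfolding noetherian_def by simp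

text \<open>
  Treat the elements of \<open>S\<close> one after the other: replace \<open>q\<close> by \<open>s\<^sup>v q\<close> with the largest \<open>v\<close> for which
  this is still outside \<open>H\<close>. What was achieved for earlier elements survives multiplication.
\<close>
lemma exists_multiple_killed_into:
  assumes "finite S" "S \<subseteq> carrier R" and H: "submodule H R M" and q: "q \<in> carrier M" "q \<notin> H"
    and pow: "\<And>s. s \<in> S \<Longrightarrow> \<exists>u::nat. (s [^] u) \<bullet> q \<in> H"
  shows "\<exists>m\<in>carrier M. m \<notin> H \<and> (\<forall>s\<in>S. s \<bullet> m \<in> H)"
proof -
  have "\<exists>r\<in>carrier R. r \<bullet> q \<notin> H \<and> (\<forall>s\<in>S. s \<bullet> (r \<bullet> q) \<in> H)"
    using assms(1,2) pow
  proof (induction S rule: finite_induct)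
    case empty
    show ?case using q by (intro bexI[of _ \<one>]) auto
  next
    case (insert b S)
    then obtain r where r: "r \<in> carrier R" "r \<bullet> q \<notin> H" "\<forall>s\<in>S. s \<bullet> (r \<bullet> q) \<in> H" by auto
    have b: "b \<in> carrier R" and S: "S \<subseteq> carrier R" using insert.prems by auto
    obtain u :: nat where u: "(b [^] u) \<bullet> q \<in> H" using insert.prems by blast
    have comm: "s \<bullet> (t \<bullet> m) = t \<bullet> (s \<bullet> m)"
      if "s \<in> carrier R" "t \<in> carrier R" "m \<in> carrier M" for s t m
      using that by (simp add: smult_assoc1[symmetric] R.m_comm)
    have "(b [^] u) \<bullet> (r \<bullet> q) \<in> H"
      using submoduleE(4)[OF H r(1) u] comm[of "b [^] u" r q] b r q by simp
    moreover have "\<not> (b [^] (0::nat)) \<bullet> (r \<bullet> q) \<in> H" using r q by simp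
    ultimately obtain v :: nat where v: "\<not> (b [^] v) \<bullet> (r \<bullet> q) \<in> H"
      "(b [^] Suc v) \<bullet> (r \<bullet> q) \<in> H"
      using nat_induct[of "\<lambda>v. \<not> (b [^] v) \<bullet> (r \<bullet> q) \<in> H"] by blast
    have e: "(b [^] v \<otimes> r) \<bullet> q = (b [^] v) \<bullet> (r \<bullet> q)" using b r q by (simp add: smult_assoc1)
    show ?case
    proof (intro bexI[of _ "b [^] v \<otimes> r"] conjI ballI)
      show "(b [^] v \<otimes> r) \<bullet> q \<notin> H" using v e by simp
      show "b [^] v \<otimes> r \<in> carrier R" using b r by simp
      fix s assume "s \<in> insert b S"
      then show "s \<bullet> ((b [^] v \<otimes> r) \<bullet> q) \<in> H"
      proof
        assume "s = b"
        have "(b [^] Suc v) \<bullet> (r \<bullet> q) = b \<bullet> ((b [^] v) \<bullet> (r \<bullet> q))"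
          using b r q by (simp add: smult_assoc1[symmetric] R.m_comm R.m_lcomm)
        with v(2) show ?thesis unfolding e \<open>s = b\<close> by simp
      next
        assume s: "s \<in> S"
        then have "s \<in> carrier R" using S by blast
        then show ?thesis
          unfolding e using submoduleE(4)[OF H, of "b [^] v" "s \<bullet> (r \<bullet> q)"] comm[of s "b [^] v" "r \<bullet> q"] b r q s
          by simp
      qed
    qed
  qed
  then obtain r where r: "r \<in> carrier R" "r \<bullet> q \<notin> H" "\<forall>s\<in>S. s \<bullet> (r \<bullet> q) \<in> H" by blast
  then show ?thesis using q(1) by (intro bexI[of _ "r \<bullet> q"]) auto
qed

lemma colon_pow_mono:
  assumes L: "submodule L R M" and s: "s \<in> carrier R" and "u \<le> (v::nat)"
  shows "colon L (s [^] u) \<subseteq> colon L (s [^] v)"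
proof
  fix m assume m: "m \<in> colon L (s [^] u)"
  have "s [^] v = s [^] (v - u) \<otimes> s [^] u" using s \<open>u \<le> v\<close> by (simp add: R.nat_pow_mult)
  then show "m \<in> colon L (s [^] v)"
    using m s submoduleE(4)[OF L] by (simp add: colon_def smult_assoc1)
qed

text \<open>
  A substitute for the Artin-Rees lemma: the submodule \<open>L\<close> contains \<open>I\<^sup>c M\<close> for the ideal \<open>I\<close> generated
  by \<open>S\<close>, but meets the torsion submodule \<open>K\<close> only in \<open>P\<close>. Take \<open>L\<close> maximal with \<open>L \<inter> K = P\<close>. For \<open>s \<in> S\<close>
  the chain \<open>L : s\<^sup>u\<close> stops at some \<open>u\<close>; since \<open>s\<^sup>t K \<subseteq> P\<close> for some \<open>t\<close>, again by the chain condition,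
  the submodule \<open>L + s\<^sup>u M\<close> still meets \<open>K\<close> in \<open>P\<close>, whence \<open>s\<^sup>u M \<subseteq> L\<close>. That all \<open>s\<close> act nilpotently on \<open>M/L\<close> then gives a power of \<open>I\<close> that
  kills \<open>M/L\<close>.
\<close>
lemma ideal_power_meets_torsion_trivially:
  assumes noetherian and P: "submodule P R M" and K: "submodule K R M" and "P \<subseteq> K"
    and S: "finite S" "S \<subseteq> carrier R"
    and tors: "\<And>s m. s \<in> S \<Longrightarrow> m \<in> K \<Longrightarrow> \<exists>t::nat. (s [^] t) \<bullet> m \<in> P"
  obtains L c where "submodule L R M" "P \<subseteq> L" "L \<inter> K = P"
    "\<And>b m. b \<in> Idl S [^]\<^bsub>ideals_set R\<^esub> (c::nat) \<Longrightarrow> m \<in> carrier M \<Longrightarrow> b \<bullet> m \<in> L"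
proof -
  have N: "ascending_wf {H. submodule H R M}" using assms(1) unfolding noetherian_def .
  obtain L where L: "L \<in> {H. submodule H R M \<and> P \<subseteq> H \<and> H \<inter> K = P}"
    and max: "\<And>H. H \<in> {H. submodule H R M \<and> P \<subseteq> H \<and> H \<inter> K = P} \<Longrightarrow> L \<subseteq> H \<Longrightarrow> H = L"
    by (rule ascending_wf_maximal[OF N, of "{H. submodule H R M \<and> P \<subseteq> H \<and> H \<inter> K = P}"])
      (use P \<open>P \<subseteq> K\<close> in auto)
  then have L: "submodule L R M" "P \<subseteq> L" "L \<inter> K = P" by auto
  have pow: "\<exists>u::nat. \<forall>m\<in>carrier M. (s [^] u) \<bullet> m \<in> L" if "s \<in> S" for s
  proof -
    have s: "s \<in> carrier R" using that S by blast
    obtain t :: nat where t: "\<forall>n\<ge>t. colon P (s [^] n) = colon P (s [^] t)"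
      using noetherian_stable[OF assms(1), of "\<lambda>n. colon P (s [^] n)"] s
        colon_submodule[OF P] colon_pow_mono[OF P s] by auto
    have t: "(s [^] t) \<bullet> m \<in> P" if m: "m \<in> K" for m
    proof -
      obtain t' :: nat where "(s [^] t') \<bullet> m \<in> P" using tors[OF \<open>s \<in> S\<close> m] by blast
      then have "m \<in> colon P (s [^] t')" using submodule_carrier[OF K m] by (simp add: colon_def)
      also have "\<dots> \<subseteq> colon P (s [^] max t t')" by (rule colon_pow_mono[OF P s]) simp
      also have "\<dots> = colon P (s [^] t)" using t max.cobounded1 by blast
      finally show ?thesis by (simp add: colon_def)
    qed
    \<comment> \<open>Stability of the chain allows cancelling the factor \<open>s\<^sup>t\<close> below.\<close>
    obtain u :: nat where u: "\<forall>n\<ge>u. colon L (s [^] n) = colon L (s [^] u)"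
      using noetherian_stable[OF assms(1), of "\<lambda>n. colon L (s [^] n)"] s
        colon_submodule[OF L(1)] colon_pow_mono[OF L(1) s] by auto
    have su: "s [^] u \<in> carrier R" using s by simp
    let ?L' = "L \<uplus> mul (s [^] u) (carrier M)"
    note mM = mul_submodule[OF carrier_is_submodule su]
    have sub: "submodule ?L' R M" "L \<subseteq> ?L'" "mul (s [^] u) (carrier M) \<subseteq> ?L'"
      using submodule_sum[OF L(1) mM] sum_upper1[OF L(1) mM] sum_upper2[OF L(1) mM] by auto
    have "?L' \<inter> K \<subseteq> P"
    proof
      fix y assume "y \<in> ?L' \<inter> K"
      then have yK: "y \<in> K" and "y \<in> ?L'" by auto
      then obtain l m where y: "l \<in> L" "m \<in> carrier M" "y = l \<oplus>\<^bsub>M\<^esub> (s [^] u) \<bullet> m"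
        unfolding mem_sum_iff mul_def by blast
      have l: "l \<in> carrier M" using y(1) L(1) submodule_carrier by blast
      have "(s [^] t) \<bullet> y = (s [^] t) \<bullet> l \<oplus>\<^bsub>M\<^esub> (s [^] (t + u)) \<bullet> m"
        using y s l by (simp add: smult_r_distr smult_assoc1 R.nat_pow_mult[symmetric])
      then have sum: "(s [^] t) \<bullet> l \<oplus>\<^bsub>M\<^esub> (s [^] (t + u)) \<bullet> m \<in> L" using t[OF yK] L(2) by auto
      have "(s [^] t) \<bullet> l \<in> L" using submoduleE(4)[OF L(1)] s y by simp
      then have "(s [^] (t + u)) \<bullet> m \<in> L"
        by (rule submodule_diff[OF L(1) _ sum]) (use s y in simp)
      then have "m \<in> colon L (s [^] (t + u))" using y by (simp add: colon_def)
      then have "m \<in> colon L (s [^] u)" using u le_add2 by blast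
      then have "y \<in> L" using y submoduleE(5)[OF L(1)] by (simp add: colon_def)
      with yK L(3) show "y \<in> P" by blast
    qed
    then have "?L' \<inter> K = P" using sub(2) L(2) \<open>P \<subseteq> K\<close> by blast
    then have "?L' = L" by (intro max) (use sub L(2) in auto)
    then show ?thesis using sub(3) by (intro exI[of _ u]) (auto simp: mul_def)
  qed
  note IS = R.genideal_ideal[OF S(2)]
  have pow_ideal: "ideal (Idl S [^]\<^bsub>ideals_set R\<^esub> (c::nat)) R" for c
  proof (induction c)
    case 0 show ?case by (simp add: ideals_set_def R.oneideal)
  next
    case (Suc c) then show ?case using R.ideal_prod_is_ideal[OF Suc IS] by (simp add: ideals_set_def)
  qed
  have "\<exists>c. \<forall>m\<in>carrier M. \<forall>b\<in>Idl S [^]\<^bsub>ideals_set R\<^esub> (c::nat). b \<bullet> m \<in> L"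
  proof -
    \<comment> \<open>The union of this chain is all of \<open>M\<close>: an element outside would have a multiple outside that the
        generators, hence one more power of the ideal, carry into it.\<close>
    define D where "D c = {m \<in> carrier M. \<forall>b\<in>Idl S [^]\<^bsub>ideals_set R\<^esub> (c::nat). b \<bullet> m \<in> L}" for c
    have carr: "b \<in> carrier R" if "b \<in> Idl S [^]\<^bsub>ideals_set R\<^esub> (c::nat)" for b c
      by (rule ideal.Icarr[OF pow_ideal that])
    have D_sub: "submodule (D c) R M" for c
    proof (rule submoduleI)
      fix a m assume "a \<in> carrier R" "m \<in> D c"
      then show "a \<bullet> m \<in> D c"
        using ideal.I_r_closed[OF pow_ideal] by (auto simp: D_def smult_assoc1[symmetric] carr)
    qed (auto simp: D_def carr submodule_zero[OF L(1)] smult_r_minus smult_r_distr submoduleE[OF L(1)])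
    have Suc: "Idl S [^]\<^bsub>ideals_set R\<^esub> Suc c = (Idl S [^]\<^bsub>ideals_set R\<^esub> c) \<cdot> (Idl S)" for c
      by (simp add: ideals_set_def)
    have "D c \<subseteq> D (Suc c)" for c
      using R.ideal_prod_inter[OF pow_ideal IS] unfolding D_def Suc by blast
    then have D_mono: "D c \<subseteq> D c'" if "c \<le> c'" for c c' using that by (rule lift_Suc_mono_le)
    obtain c where c: "\<forall>c'\<ge>c. D c' = D c" using noetherian_stable[of D, OF assms(1) D_sub D_mono] by auto
    have "D c = carrier M"
    proof (rule ccontr)
      assume "D c \<noteq> carrier M"
      then obtain q where q: "q \<in> carrier M" "q \<notin> D c" unfolding D_def by blast
      have "L \<subseteq> D c" using submodule_carrier[OF L(1)] submoduleE(4)[OF L(1)] carr unfolding D_def by blast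
      then have "\<exists>u::nat. (s [^] u) \<bullet> q \<in> D c" if "s \<in> S" for s using pow[OF that] q(1) by blast
      from exists_multiple_killed_into[OF S D_sub q this]
      obtain m where m: "m \<in> carrier M" "m \<notin> D c" "\<forall>s\<in>S. s \<bullet> m \<in> D c" by blast
      have in_D: "b \<bullet> m \<in> D c" if "b \<in> Idl S" for b
        by (rule genideal_smult_mem[OF D_sub m(1) S(2) _ that]) (use m(3) in blast)
      have "b \<bullet> m \<in> L" if "b \<in> (Idl S [^]\<^bsub>ideals_set R\<^esub> c) \<cdot> (Idl S)" for b
        using that
      proof (induction rule: ideal_prod.induct)
        case (prod i j)
        then have "i \<in> carrier R" "j \<in> carrier R" using carr ideal.Icarr[OF IS] by auto
        then show ?case using in_D[OF prod(2)] prod(1) m(1) by (simp add: smult_assoc1 D_def)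
      next
        case (sum a b)
        have "a \<in> carrier R" "b \<in> carrier R"
          using sum.hyps ideal.Icarr[OF R.ideal_prod_is_ideal[OF pow_ideal IS]] by auto
        then show ?case using sum.IH m(1) submoduleE(5)[OF L(1)] by (simp add: smult_l_distr)
      qed
      then have "m \<in> D (Suc c)" unfolding D_def Suc using m(1) by blast
      moreover have "D (Suc c) = D c" using c le_SucI by blast
      ultimately show False using m(2) by blast
    qed
    then show ?thesis unfolding D_def by blast
  qed
  then show thesis using that L by blast
qed

text \<open>
  The extension is a quotient of \<open>R/\<nn>\<close>, hence zero or simple.
\<close>
lemma len_simple_extension:
  assumes mx: "maximalideal \<nn> R" and H: "submodule H R M" and q: "q \<in> carrier M"
    and nq: "\<And>b. b \<in> \<nn> \<Longrightarrow> b \<bullet> q \<in> H"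
  shows "len H (H \<uplus> cyclic q) \<le> 1"
proof -
  have two: "G = H \<or> G = H \<uplus> cyclic q" if "G \<in> between H (H \<uplus> cyclic q)" for G
  proof (cases "G \<subseteq> H")
    case False
    from that have G: "submodule G R M" "H \<subseteq> G" "G \<subseteq> H \<uplus> cyclic q" by (auto simp: between_def)
    obtain z where z: "z \<in> G" "z \<notin> H" using False by blast
    then have "z \<in> H \<uplus> cyclic q" using G by blast
    then obtain h r where r: "h \<in> H" "r \<in> carrier R" "z = h \<oplus>\<^bsub>M\<^esub> r \<bullet> q"
      unfolding mem_sum_iff cyclic_def by blast
    have rG: "r \<bullet> q \<in> G" by (rule submodule_diff[OF G(1), of h]) (use r z G q in auto)
    have "r \<notin> \<nn>" using nq[of r] r z submoduleE(5)[OF H r(1), of "r \<bullet> q"] by blast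
    moreover have "r \<in> conductor G q" using rG r by (simp add: conductor_def)
    moreover have "\<nn> \<subseteq> conductor G q"
      using nq G(2) ideal.Icarr[OF maximalideal.axioms(1)[OF mx]] by (auto simp: conductor_def)
    moreover have "conductor G q \<subseteq> carrier R" by (auto simp: conductor_def)
    ultimately have "conductor G q = carrier R"
      using maximalideal.I_maximal[OF mx conductor_ideal[OF G(1) q]] by blast
    then have "\<one> \<in> conductor G q" by simp
    then have "q \<in> G" using q by (simp add: conductor_def)
    then have "H \<uplus> cyclic q \<subseteq> G" using G by (intro sum_least cyclic_least)
    with G show ?thesis by blast
  qed (use that in \<open>auto simp: between_def\<close>)
  have "t \<le> 1" if "has_chain (between H (H \<uplus> cyclic q)) t" for t
  proof (rule ccontr)
    assume "\<not> t \<le> 1"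
    then have "has_chain (between H (H \<uplus> cyclic q)) 2" using has_chain_le[OF that, of 2] by simp
    then obtain C where C: "\<And>j. j \<le> 2 \<Longrightarrow> C j \<in> between H (H \<uplus> cyclic q)"
      "\<And>j. j < 2 \<Longrightarrow> C j \<subset> C (Suc j)" unfolding has_chain_def by blast
    then have "C 0 \<subset> C 1" "C 1 \<subset> C 2" by (auto simp: numeral_2_eq_2)
    moreover have "C 2 \<subseteq> H \<uplus> cyclic q" "H \<subseteq> C 0" using C(1)[of 2] C(1)[of 0] by (auto simp: between_def)
    ultimately show False using two[OF C(1)[of 1]] by auto
  qed
  then show ?thesis unfolding len_def one_enat_def height_le_enat_iff by blast
qed

text \<open>
  Take \<open>H\<close> maximal among the submodules of finite length over \<open>P\<close>. If \<open>H \<noteq> M\<close>, some element outside \<open>H\<close>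
  is multiplied into \<open>H\<close> by the maximal ideal, and adjoining it increases the length by at most one.
\<close>
lemma finite_len_above_primary:
  assumes noetherian and R: "noetherian_ring R" and mx: "maximalideal \<nn> R" and P: "submodule P R M"
    and pow: "\<And>b m. b \<in> \<nn> \<Longrightarrow> m \<in> carrier M \<Longrightarrow> \<exists>u::nat. (b [^] u) \<bullet> m \<in> P"
  shows "len P (carrier M) \<noteq> \<infinity>"
proof -
  have N: "ascending_wf {H. submodule H R M}" using assms(1) unfolding noetherian_def .
  let ?Q = "{H. submodule H R M \<and> P \<subseteq> H \<and> len P H \<noteq> \<infinity>}"
  obtain H where "H \<in> ?Q" and max: "\<And>G. G \<in> ?Q \<Longrightarrow> H \<subseteq> G \<Longrightarrow> G = H"
    by (rule ascending_wf_maximal[OF N, of ?Q]) (use P len_refl[OF P] in \<open>auto simp: zero_enat_def\<close>)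
  then have H: "submodule H R M" "P \<subseteq> H" "len P H \<noteq> \<infinity>" by auto
  have "H = carrier M"
  proof (rule ccontr)
    assume "H \<noteq> carrier M"
    then obtain q where q: "q \<in> carrier M" "q \<notin> H" using submodule_carrier[OF H(1)] by blast
    obtain S where S: "S \<subseteq> carrier R" "finite S" "\<nn> = Idl S"
      using noetherian_ring.finetely_gen[OF R maximalideal.axioms(1)[OF mx]] by blast
    have "S \<subseteq> \<nn>" unfolding S(3) by (rule R.genideal_self[OF S(1)])
    then have "\<exists>u::nat. (s [^] u) \<bullet> q \<in> H" if "s \<in> S" for s using pow[of s q] that q(1) H(2) by blast
    from exists_multiple_killed_into[OF S(2,1) H(1) q this]
    obtain m where m: "m \<in> carrier M" "m \<notin> H" "\<forall>s\<in>S. s \<bullet> m \<in> H" by blast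
    have le1: "len H (H \<uplus> cyclic m) \<le> 1"
    proof (rule len_simple_extension[OF mx H(1) m(1)])
      fix b assume "b \<in> \<nn>"
      then show "b \<bullet> m \<in> H"
        using genideal_smult_mem[OF H(1) m(1) S(1)] m(3) unfolding S(3) by blast
    qed
    have "len H (H \<uplus> cyclic m) \<noteq> \<infinity>"
    proof
      assume "len H (H \<uplus> cyclic m) = \<infinity>"
      with le1 show False by simp
    qed
    moreover note Hm = submodule_sum[OF H(1) cyclic_submodule[OF m(1)]] sum_upper1[OF H(1) cyclic_submodule[OF m(1)]]
    moreover have "len P (H \<uplus> cyclic m) = len P H + len H (H \<uplus> cyclic m)"
      by (rule len_add[OF P H(1) Hm(1) H(2) Hm(2)])
    ultimately have "H \<uplus> cyclic m \<in> ?Q" using H by auto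
    then have "H \<uplus> cyclic m = H" using max Hm(2) by blast
    then show False using m(2) cyclic_self[OF m(1)] sum_upper2[OF H(1) cyclic_submodule[OF m(1)]] by blast
  qed
  with H show ?thesis by simp
qed

end

section \<open>Products of powers of ideals\<close>

lemma ideals_set_simps:
  "carrier (ideals_set R) = {I. ideal I R}" "monoid.mult (ideals_set R) = ideal_prod R"
  "monoid.one (ideals_set R) = carrier R"
  by (simp_all add: ideals_set_def)

lemma sum_enat: "(\<Sum>x\<in>A. enat (f x)) = enat (\<Sum>x\<in>A. f x)"
  by (induction A rule: infinite_finite_induct) (simp_all add: zero_enat_def)

locale module_with_ideals = module R M for R (structure) and M (structure) +
  fixes d :: nat and I :: "nat \<Rightarrow> 'a set"
  assumes ideals: "\<And>i. i \<le> d \<Longrightarrow> ideal (I i) R"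
begin

abbreviation power_product :: "(nat \<Rightarrow> nat) \<Rightarrow> 'a set" where
  "power_product n \<equiv> multi_power R d I n"

sublocale IS: comm_monoid "ideals_set R"
  by (rule R.ideals_set_is_comm_monoid)

lemma power_closed: "i \<le> d \<Longrightarrow> I i [^]\<^bsub>ideals_set R\<^esub> (n::nat) \<in> carrier (ideals_set R)"
  using ideals by (intro IS.nat_pow_closed) (simp add: ideals_set_simps)

lemma power_product_ideal: "ideal (power_product n) R"
proof -
  have "power_product n \<in> carrier (ideals_set R)"
    unfolding multi_power_def by (rule IS.finprod_closed) (use power_closed in auto)
  then show ?thesis by (simp add: ideals_set_simps)
qed

lemma power_product_carrier: "b \<in> power_product n \<Longrightarrow> b \<in> carrier R"
  by (rule ideal.Icarr[OF power_product_ideal])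

lemma power_product_cong: "(\<And>i. i \<le> d \<Longrightarrow> n i = n' i) \<Longrightarrow> power_product n = power_product n'"
  unfolding multi_power_def by (rule IS.finprod_cong') (use power_closed in auto)

lemma power_product_zero: "(\<And>i. i \<le> d \<Longrightarrow> n i = 0) \<Longrightarrow> power_product n = carrier R"
proof -
  assume "\<And>i. i \<le> d \<Longrightarrow> n i = 0"
  then have "power_product n = (\<Otimes>\<^bsub>ideals_set R\<^esub> i \<in> {..d}. \<one>\<^bsub>ideals_set R\<^esub>)"
    unfolding multi_power_def by (intro IS.finprod_cong') auto
  also have "\<dots> = \<one>\<^bsub>ideals_set R\<^esub>" by simp
  finally show ?thesis by (simp add: ideals_set_simps)
qed

lemma power_product_add: "power_product (\<lambda>i. n i + m i) = power_product n \<cdot> power_product m"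
proof -
  have "power_product (\<lambda>i. n i + m i) = (\<Otimes>\<^bsub>ideals_set R\<^esub> i \<in> {..d}.
      I i [^]\<^bsub>ideals_set R\<^esub> n i \<otimes>\<^bsub>ideals_set R\<^esub> I i [^]\<^bsub>ideals_set R\<^esub> m i)"
    unfolding multi_power_def
    by (rule IS.finprod_cong') (use power_closed ideals in \<open>auto simp: ideals_set_simps(1) IS.nat_pow_mult\<close>)
  also have "\<dots> = power_product n \<otimes>\<^bsub>ideals_set R\<^esub> power_product m"
    unfolding multi_power_def by (rule IS.finprod_multf) (use power_closed in auto)
  finally show ?thesis by (simp add: ideals_set_simps)
qed

lemma power_product_unit: "i \<le> d \<Longrightarrow> power_product (\<lambda>j. if j = i then 1 else 0) = I i"
proof -
  assume i: "i \<le> d"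
  have I: "I j \<in> carrier (ideals_set R)" if "j \<le> d" for j using ideals[OF that] by (simp add: ideals_set_simps)
  have "power_product (\<lambda>j. if j = i then 1 else 0) =
      (\<Otimes>\<^bsub>ideals_set R\<^esub> j \<in> {..d}. if i = j then I j else \<one>\<^bsub>ideals_set R\<^esub>)"
    unfolding multi_power_def by (rule IS.finprod_cong') (use I in auto)
  also have "\<dots> = I i" by (rule IS.finprod_singleton) (use i I in auto)
  finally show ?thesis .
qed

lemma power_product_Suc: "i \<le> d \<Longrightarrow> power_product (n(i := Suc (n i))) = power_product n \<cdot> I i"
proof -
  assume "i \<le> d"
  moreover have "n(i := Suc (n i)) = (\<lambda>j. n j + (if j = i then 1 else 0))" by auto
  ultimately show ?thesis by (simp only: power_product_add power_product_unit)
qed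

lemma power_product_antimono:
  assumes "\<And>i. i \<le> d \<Longrightarrow> m i \<le> n i"
  shows "power_product n \<subseteq> power_product m"
proof -
  have "power_product n = power_product (\<lambda>i. m i + (n i - m i))"
    by (rule power_product_cong) (simp add: assms)
  also have "\<dots> \<subseteq> power_product m"
    unfolding power_product_add using R.ideal_prod_inter[OF power_product_ideal power_product_ideal] by blast
  finally show ?thesis .
qed

lemma power_product_const:
  "power_product (\<lambda>i. c) = (\<Otimes>\<^bsub>ideals_set R\<^esub> i \<in> {..d}. I i) [^]\<^bsub>ideals_set R\<^esub> c"
proof (induction c)
  case 0
  show ?case by (simp add: power_product_zero ideals_set_simps)
next
  case (Suc c)
  have "power_product (\<lambda>i. 1) = (\<Otimes>\<^bsub>ideals_set R\<^esub> i \<in> {..d}. I i)"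
    unfolding multi_power_def by (rule IS.finprod_cong') (use ideals in \<open>auto simp: ideals_set_simps(1)\<close>)
  then show ?case using power_product_add[of "\<lambda>i. c" "\<lambda>i. 1"] Suc by (simp add: ideals_set_simps)
qed

text \<open>
  Denoted \<open>M\<^sub>n\<close> in the comments.
\<close>
definition power_submodule :: "(nat \<Rightarrow> nat) \<Rightarrow> 'c set" where
  "power_submodule n = ideal_smult R (power_product n) M"

lemma power_submodule_submodule: "submodule (power_submodule n) R M"
  unfolding power_submodule_def ideal_smult_def
  by (rule mod_span_submodule) (auto dest: power_product_carrier)

lemma smult_in_power_submodule: "b \<in> power_product n \<Longrightarrow> m \<in> carrier M \<Longrightarrow> b \<bullet> m \<in> power_submodule n"
  unfolding power_submodule_def ideal_smult_def by (rule subsetD[OF mod_span_superset]) blast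

lemma power_submodule_least:
  assumes "submodule H R M" "\<And>b m. b \<in> power_product n \<Longrightarrow> m \<in> carrier M \<Longrightarrow> b \<bullet> m \<in> H"
  shows "power_submodule n \<subseteq> H"
  unfolding power_submodule_def ideal_smult_def by (rule mod_span_least) (use assms in auto)

lemma power_submodule_antimono:
  "(\<And>i. i \<le> d \<Longrightarrow> m i \<le> n i) \<Longrightarrow> power_submodule n \<subseteq> power_submodule m"
  by (rule power_submodule_least[OF power_submodule_submodule])
    (use smult_in_power_submodule power_product_antimono in blast)

lemma smult_power_submodule:
  assumes a: "a \<in> power_product n'" and m: "m \<in> power_submodule n"
  shows "a \<bullet> m \<in> power_submodule (\<lambda>i. n i + n' i)"
proof -
  have aR: "a \<in> carrier R" using a power_product_carrier by blast
  have "power_submodule n \<subseteq> colon (power_submodule (\<lambda>i. n i + n' i)) a"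
  proof (rule power_submodule_least[OF colon_submodule[OF power_submodule_submodule aR]])
    fix b u assume b: "b \<in> power_product n" and u: "u \<in> carrier M"
    then have bR: "b \<in> carrier R" using power_product_carrier by blast
    have "b \<otimes> a \<in> power_product (\<lambda>i. n i + n' i)"
      unfolding power_product_add using b a by (rule ideal_prod.prod)
    then have "(b \<otimes> a) \<bullet> u \<in> power_submodule (\<lambda>i. n i + n' i)" using u by (rule smult_in_power_submodule)
    moreover have "(b \<otimes> a) \<bullet> u = a \<bullet> (b \<bullet> u)"
      using aR bR u by (simp add: R.m_comm[of b a] smult_assoc1)
    ultimately show "b \<bullet> u \<in> colon (power_submodule (\<lambda>i. n i + n' i)) a"
      using bR u by (simp add: colon_def)
  qed
  with m show ?thesis by (auto simp: colon_def)
qed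

lemma mul_power_submodule:
  assumes i: "i \<le> d" and a: "a \<in> I i"
  shows "mul a (power_submodule n) \<subseteq> power_submodule (n(i := Suc (n i)))"
proof -
  have "a \<in> power_product (\<lambda>j. if j = i then 1 else 0)" using power_product_unit[OF i] a by blast
  moreover have "(\<lambda>j. n j + (if j = i then 1 else 0)) = n(i := Suc (n i))" by auto
  ultimately show ?thesis using smult_power_submodule by (fastforce simp: mul_def)
qed

lemma power_submodule_Suc_le: "power_submodule (n(i := Suc (n i))) \<subseteq> power_submodule n"
  by (rule power_submodule_antimono) simp

end

section \<open>Existence of the Hilbert polynomial\<close>

text \<open>
  The generators of all ideals in one list, where \<open>col j\<close> names the ideal to which \<open>x j\<close> belongs. An
  element occurring in several ideals is listed once for each of them.
\<close>
locale module_with_ideal_generators = module_with_ideals +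
  fixes r :: nat and x :: "nat \<Rightarrow> 'a" and col :: "nat \<Rightarrow> nat"
  assumes x_closed: "\<And>j. j < r \<Longrightarrow> x j \<in> carrier R" and col_le: "\<And>j. j < r \<Longrightarrow> col j \<le> d"
    and generators: "\<And>i. i \<le> d \<Longrightarrow> I i = Idl {x j |j. j < r \<and> col j = i}"
begin

definition monomial :: "(nat \<Rightarrow> nat) \<Rightarrow> 'a" where
  "monomial \<alpha> = (\<Otimes>j\<in>{..<r}. x j [^] \<alpha> j)"

lemma monomial_closed [simp]: "monomial \<alpha> \<in> carrier R"
  unfolding monomial_def by (rule R.finprod_closed) (auto simp: x_closed)

lemma monomial_zero: "monomial (\<lambda>j. 0) = \<one>"
  unfolding monomial_def by simp

lemma monomial_add: "monomial (\<lambda>j. \<alpha> j + \<beta> j) = monomial \<alpha> \<otimes> monomial \<beta>"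
proof -
  have "monomial (\<lambda>j. \<alpha> j + \<beta> j) = (\<Otimes>j\<in>{..<r}. x j [^] \<alpha> j \<otimes> x j [^] \<beta> j)"
    unfolding monomial_def by (rule R.finprod_cong') (auto simp: x_closed R.nat_pow_mult)
  also have "\<dots> = monomial \<alpha> \<otimes> monomial \<beta>"
    unfolding monomial_def by (rule R.finprod_multf) (auto simp: x_closed)
  finally show ?thesis .
qed

lemma monomial_Suc:
  assumes j: "j < r"
  shows "monomial (\<alpha>(j := Suc (\<alpha> j))) = monomial \<alpha> \<otimes> x j"
proof -
  have "monomial (\<lambda>i. if i = j then 1 else 0) = (\<Otimes>i\<in>{..<r}. if j = i then x i else \<one>)"
    unfolding monomial_def by (rule R.finprod_cong') (auto simp: x_closed)
  also have "\<dots> = x j" by (rule R.finprod_singleton) (use j x_closed in auto)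
  finally have 1: "monomial (\<lambda>i. if i = j then 1 else 0) = x j" .
  have "\<alpha>(j := Suc (\<alpha> j)) = (\<lambda>i. \<alpha> i + (if i = j then 1 else 0))" by auto
  then show ?thesis by (simp only: monomial_add 1)
qed

definition multidegree :: "(nat \<Rightarrow> nat) \<Rightarrow> nat \<Rightarrow> nat" where
  "multidegree \<alpha> i = (if i \<le> d then \<Sum>j | j < r \<and> col j = i. \<alpha> j else 0)"

lemma multidegree_add: "multidegree (\<lambda>j. \<alpha> j + \<beta> j) = (\<lambda>i. multidegree \<alpha> i + multidegree \<beta> i)"
  by (auto simp: multidegree_def sum.distrib)

lemma multidegree_Suc:
  assumes j: "j < r"
  shows "multidegree (\<alpha>(j := Suc (\<alpha> j))) = (multidegree \<alpha>)(col j := Suc (multidegree \<alpha> (col j)))"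
proof
  fix i
  have "multidegree (\<alpha>(j := Suc (\<alpha> j))) = multidegree (\<lambda>l. \<alpha> l + (if l = j then 1 else 0))"
    by (rule arg_cong[where f = multidegree]) auto
  moreover have "multidegree (\<lambda>l. if l = j then 1 else 0) i = (if i = col j then 1 else 0)"
    using j col_le[OF j] by (auto simp: multidegree_def)
  ultimately show "multidegree (\<alpha>(j := Suc (\<alpha> j))) i = ((multidegree \<alpha>)(col j := Suc (multidegree \<alpha> (col j)))) i"
    by (simp add: multidegree_add)
qed

lemma exponents_iff:
  "n \<in> multi_indices d \<Longrightarrow> \<alpha> \<in> exponents d col r n \<longleftrightarrow> (\<forall>j\<ge>r. \<alpha> j = 0) \<and> multidegree \<alpha> = n"
  by (auto simp: exponents_def multidegree_def multi_indices_def fun_eq_iff)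

lemma multidegree_multi_indices: "multidegree \<alpha> \<in> multi_indices d"
  by (auto simp: multi_indices_def multidegree_def)

lemma monomial_in_power_product: "monomial \<alpha> \<in> power_product (multidegree \<alpha>)"
proof (induction "\<Sum>j<r. \<alpha> j" arbitrary: \<alpha>)
  case 0
  then have "power_product (multidegree \<alpha>) = carrier R"
    by (intro power_product_zero) (auto simp: multidegree_def)
  then show ?case by simp
next
  case (Suc k)
  then have "\<exists>j<r. \<alpha> j \<noteq> 0" by (metis lessThan_iff nat.distinct(1) sum.neutral)
  then obtain j where j: "j < r" "\<alpha> j \<noteq> 0" by blast
  define \<beta> where "\<beta> = \<alpha>(j := \<alpha> j - 1)"
  have \<alpha>: "\<alpha> = \<beta>(j := Suc (\<beta> j))" using j by (auto simp: \<beta>_def)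
  have "(\<Sum>i<r. \<alpha> i) = Suc (\<Sum>i<r. \<beta> i)"
  proof -
    have "(\<Sum>i\<in>{..<r} - {j}. \<alpha> i) = (\<Sum>i\<in>{..<r} - {j}. \<beta> i)" by (rule sum.cong) (auto simp: \<beta>_def)
    moreover have "\<alpha> j = Suc (\<beta> j)" using j by (simp add: \<beta>_def)
    ultimately show ?thesis using j sum.remove[of "{..<r}" j \<alpha>] sum.remove[of "{..<r}" j \<beta>] by simp
  qed
  with Suc.hyps(2) have "k = (\<Sum>i<r. \<beta> i)" by simp
  then have "monomial \<beta> \<in> power_product (multidegree \<beta>)" by (rule Suc.hyps(1))
  moreover have "x j \<in> I (col j)"
  proof -
    have "{x l |l. l < r \<and> col l = col j} \<subseteq> Idl {x l |l. l < r \<and> col l = col j}"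
      by (rule R.genideal_self) (auto simp: x_closed)
    then show ?thesis unfolding generators[OF col_le[OF j(1)]] using j(1) by blast
  qed
  ultimately have "monomial \<beta> \<otimes> x j \<in> power_product (multidegree \<beta>) \<cdot> I (col j)" by (rule ideal_prod.prod)
  then show ?case
    unfolding \<alpha> monomial_Suc[OF j(1)] multidegree_Suc[OF j(1)] power_product_Suc[OF col_le[OF j(1)]] .
qed

text \<open>
  The monomials of multidegree \<open>n\<close> generate \<open>M\<^sub>n\<close>: one factor \<open>I\<^sub>i\<close> is split off and replaced by its
  generators.
\<close>
lemma power_submodule_le_monomials:
  assumes H: "submodule H R M" and "n \<in> multi_indices d"
    and "\<And>\<alpha> m. \<alpha> \<in> exponents d col r n \<Longrightarrow> m \<in> carrier M \<Longrightarrow> monomial \<alpha> \<bullet> m \<in> H"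
  shows "power_submodule n \<subseteq> H"
  using assms
proof (induction "\<Sum>i\<le>d. n i" arbitrary: n H)
  case 0
  then have "n i = 0" for i by (cases "i \<le> d") (auto simp: multi_indices_def)
  then have "(\<lambda>j. 0) \<in> exponents d col r n" by (simp add: exponents_def)
  from 0(4)[OF this] have "carrier M \<subseteq> H" by (auto simp: monomial_zero)
  then show ?case using submoduleE(1)[OF power_submodule_submodule] by blast
next
  case (Suc k)
  then have "\<exists>i\<le>d. n i \<noteq> 0" by (metis atMost_iff nat.distinct(1) sum.neutral)
  then obtain i where i: "i \<le> d" "n i \<noteq> 0" by blast
  define p where "p = n(i := n i - 1)"
  have n: "n = p(i := Suc (p i))" using i by (auto simp: p_def)
  have p: "p \<in> multi_indices d" using Suc.prems(2) i by (auto simp: p_def multi_indices_def)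
  have "(\<Sum>j\<le>d. n j) = Suc (\<Sum>j\<le>d. p j)"
  proof -
    have "(\<Sum>j\<in>{..d} - {i}. n j) = (\<Sum>j\<in>{..d} - {i}. p j)" by (rule sum.cong) (auto simp: p_def)
    moreover have "n i = Suc (p i)" using i by (simp add: p_def)
    ultimately show ?thesis using i sum.remove[of "{..d}" i n] sum.remove[of "{..d}" i p] by simp
  qed
  with Suc.hyps(2) have k: "k = (\<Sum>j\<le>d. p j)" by simp
  have gen: "x j \<bullet> u \<in> H" if j: "j < r" "col j = i" and u: "u \<in> power_submodule p" for j u
  proof -
    have "power_submodule p \<subseteq> colon H (x j)"
    proof (rule Suc.hyps(1)[OF k colon_submodule[OF Suc.prems(1) x_closed[OF j(1)]] p])
      fix \<beta> m assume \<beta>: "\<beta> \<in> exponents d col r p" and m: "m \<in> carrier M"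
      then have \<beta>: "\<forall>l\<ge>r. \<beta> l = 0" "multidegree \<beta> = p" using exponents_iff[OF p] by auto
      have "multidegree (\<beta>(j := Suc (\<beta> j))) = n" unfolding multidegree_Suc[OF j(1)] \<beta>(2) j(2) n[symmetric] ..
      with \<beta>(1) j(1) have "\<beta>(j := Suc (\<beta> j)) \<in> exponents d col r n"
        unfolding exponents_iff[OF Suc.prems(2)] by simp
      from Suc.prems(3)[OF this m] have "(monomial \<beta> \<otimes> x j) \<bullet> m \<in> H" unfolding monomial_Suc[OF j(1)] .
      then show "monomial \<beta> \<bullet> m \<in> colon H (x j)"
        using m x_closed[OF j(1)] by (simp add: colon_def R.m_comm[of "monomial \<beta>"] smult_assoc1)
    qed
    with u show ?thesis by (auto simp: colon_def)
  qed
  show ?case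
  proof (rule power_submodule_least[OF Suc.prems(1)])
    fix b m assume b: "b \<in> power_product n" and m: "m \<in> carrier M"
    have "b \<in> power_product p \<cdot> I i" using b power_product_Suc[OF i(1), of p] n by simp
    then show "b \<bullet> m \<in> H"
    proof (induction rule: ideal_prod.induct)
      case (prod q c)
      then have qc: "q \<in> carrier R" "c \<in> carrier R" using power_product_carrier ideal.Icarr[OF ideals[OF i(1)]] by auto
      have qm: "q \<bullet> m \<in> power_submodule p" using prod m smult_in_power_submodule by blast
      have "c \<bullet> (q \<bullet> m) \<in> H"
      proof (rule genideal_smult_mem[OF Suc.prems(1)])
        show "c \<in> Idl {x j |j. j < r \<and> col j = i}" using prod generators[OF i(1)] by simp
      qed (use qc m x_closed gen qm in auto)
      then show ?case using qc m by (simp add: R.m_comm[of q] smult_assoc1)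
    next
      case (sum a b)
      have "a \<in> carrier R" "b \<in> carrier R"
        using sum.hyps ideal.Icarr[OF R.ideal_prod_is_ideal[OF power_product_ideal ideals[OF i(1)]]] by auto
      then show ?case using sum.IH m submoduleE(5)[OF Suc.prems(1)] by (simp add: smult_l_distr)
    qed
  qed
qed

text \<open>
  The filtration of \<open>M\<^sub>n\<close> over \<open>M\<^bsub>n+\<epsilon>\<^sub>0\<^esub>\<close> by the sets \<open>D\<close> of monomials that are admitted.
\<close>
definition monomial_filtration :: "(nat \<Rightarrow> nat) \<Rightarrow> (nat \<Rightarrow> nat) set \<Rightarrow> 'c set" where
  "monomial_filtration n D =
    mod_span R M (power_submodule (n(0 := Suc (n 0))) \<union> {monomial \<alpha> \<bullet> m |\<alpha> m. \<alpha> \<in> D \<and> m \<in> carrier M})"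

definition lex_below :: "(nat \<Rightarrow> nat) \<Rightarrow> (nat \<Rightarrow> nat) set" where
  "lex_below \<alpha> = {\<beta> \<in> exponents d col r (multidegree \<alpha>). less_fun \<beta> \<alpha>}"

text \<open>
  The submodule \<open>L(\<alpha>)\<close> of possible leading coefficients of relations with leading monomial \<open>x\<^sup>\<alpha>\<close>.
\<close>
definition leading_colon :: "(nat \<Rightarrow> nat) \<Rightarrow> 'c set" where
  "leading_colon \<alpha> = colon (monomial_filtration (multidegree \<alpha>) (lex_below \<alpha>)) (monomial \<alpha>)"

lemma filtration_submodule: "submodule (monomial_filtration n D) R M"
  unfolding monomial_filtration_def
  by (rule mod_span_submodule) (use submoduleE(1)[OF power_submodule_submodule] in auto)

lemma filtration_base: "power_submodule (n(0 := Suc (n 0))) \<subseteq> monomial_filtration n D"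
  unfolding monomial_filtration_def using mod_span_superset by blast

lemma filtration_monomial: "\<alpha> \<in> D \<Longrightarrow> m \<in> carrier M \<Longrightarrow> monomial \<alpha> \<bullet> m \<in> monomial_filtration n D"
  unfolding monomial_filtration_def by (rule subsetD[OF mod_span_superset]) blast

lemma filtration_least:
  assumes "submodule H R M" "power_submodule (n(0 := Suc (n 0))) \<subseteq> H"
    "\<And>\<alpha> m. \<alpha> \<in> D \<Longrightarrow> m \<in> carrier M \<Longrightarrow> monomial \<alpha> \<bullet> m \<in> H"
  shows "monomial_filtration n D \<subseteq> H"
  unfolding monomial_filtration_def by (rule mod_span_least) (use assms in auto)

lemma filtration_empty: "monomial_filtration n {} = power_submodule (n(0 := Suc (n 0)))"
  by (rule antisym[OF filtration_least filtration_base]) (auto intro: power_submodule_submodule)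

lemma filtration_insert:
  "monomial_filtration n (insert \<alpha> D) = monomial_filtration n D \<uplus> mul (monomial \<alpha>) (carrier M)"
proof
  note s = filtration_submodule[of n D] mul_submodule[OF carrier_is_submodule monomial_closed[of \<alpha>]]
  show "monomial_filtration n (insert \<alpha> D) \<subseteq> monomial_filtration n D \<uplus> mul (monomial \<alpha>) (carrier M)"
  proof (rule filtration_least[OF submodule_sum[OF s]])
    show "power_submodule (n(0 := Suc (n 0))) \<subseteq> monomial_filtration n D \<uplus> mul (monomial \<alpha>) (carrier M)"
      using filtration_base sum_upper1[OF s] by (rule order_trans)
    fix \<beta> m assume "\<beta> \<in> insert \<alpha> D" "m \<in> carrier M"
    then have "monomial \<beta> \<bullet> m \<in> monomial_filtration n D \<or> monomial \<beta> \<bullet> m \<in> mul (monomial \<alpha>) (carrier M)"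
      using filtration_monomial[of \<beta> D m n] by (auto simp: mul_def)
    then show "monomial \<beta> \<bullet> m \<in> monomial_filtration n D \<uplus> mul (monomial \<alpha>) (carrier M)"
      using sum_upper1[OF s] sum_upper2[OF s] by blast
  qed
  show "monomial_filtration n D \<uplus> mul (monomial \<alpha>) (carrier M) \<subseteq> monomial_filtration n (insert \<alpha> D)"
    by (intro sum_least filtration_least filtration_submodule filtration_base)
      (auto simp: mul_def intro: filtration_monomial)
qed

lemma filtration_all:
  assumes n: "n \<in> multi_indices d"
  shows "monomial_filtration n (exponents d col r n) = power_submodule n"
proof
  show "monomial_filtration n (exponents d col r n) \<subseteq> power_submodule n"
  proof (rule filtration_least[OF power_submodule_submodule power_submodule_Suc_le])
    fix \<alpha> m assume "\<alpha> \<in> exponents d col r n" and m: "m \<in> carrier M"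
    then have "multidegree \<alpha> = n" using exponents_iff[OF n] by simp
    then have "monomial \<alpha> \<in> power_product n" using monomial_in_power_product[of \<alpha>] by simp
    then show "monomial \<alpha> \<bullet> m \<in> power_submodule n" using m by (rule smult_in_power_submodule)
  qed
  show "power_submodule n \<subseteq> monomial_filtration n (exponents d col r n)"
    by (rule power_submodule_le_monomials[OF filtration_submodule n filtration_monomial])
qed

lemma leading_colon_submodule: "submodule (leading_colon \<alpha>) R M"
  unfolding leading_colon_def by (intro colon_submodule filtration_submodule monomial_closed)

text \<open>
  Multiplication by \<open>x\<^bsup>\<beta>-\<alpha>\<^esup>\<close> carries the terms below \<open>x\<^sup>\<alpha>\<close> to terms below \<open>x\<^sup>\<beta>\<close>, because the
  lexicographic order is compatible with products of monomials.
\<close>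
lemma leading_colon_mono:
  assumes \<alpha>: "\<forall>j\<ge>r. \<alpha> j = 0" and \<beta>: "\<forall>j\<ge>r. \<beta> j = 0" and le: "\<alpha> \<le> \<beta>"
  shows "leading_colon \<alpha> \<subseteq> leading_colon \<beta>"
proof -
  define \<gamma> where "\<gamma> j = \<beta> j - \<alpha> j" for j
  have \<beta>_eq: "\<beta> = (\<lambda>j. \<alpha> j + \<gamma> j)" using le by (auto simp: \<gamma>_def le_fun_def)
  let ?T = "monomial_filtration (multidegree \<beta>) (lex_below \<beta>)"
  have "monomial_filtration (multidegree \<alpha>) (lex_below \<alpha>) \<subseteq> colon ?T (monomial \<gamma>)"
  proof (rule filtration_least[OF colon_submodule[OF filtration_submodule monomial_closed]])
    show "power_submodule ((multidegree \<alpha>)(0 := Suc (multidegree \<alpha> 0))) \<subseteq> colon ?T (monomial \<gamma>)"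
    proof
      fix m assume m: "m \<in> power_submodule ((multidegree \<alpha>)(0 := Suc (multidegree \<alpha> 0)))"
      have "monomial \<gamma> \<bullet> m \<in> power_submodule (\<lambda>i. ((multidegree \<alpha>)(0 := Suc (multidegree \<alpha> 0))) i + multidegree \<gamma> i)"
        by (rule smult_power_submodule[OF monomial_in_power_product m])
      also have "(\<lambda>i. ((multidegree \<alpha>)(0 := Suc (multidegree \<alpha> 0))) i + multidegree \<gamma> i) =
          (multidegree \<beta>)(0 := Suc (multidegree \<beta> 0))"
        unfolding \<beta>_eq multidegree_add by auto
      finally have "monomial \<gamma> \<bullet> m \<in> ?T" using filtration_base by blast
      then show "m \<in> colon ?T (monomial \<gamma>)"
        using submodule_carrier[OF power_submodule_submodule m] by (simp add: colon_def)
    qed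
    fix \<delta> m assume \<delta>: "\<delta> \<in> lex_below \<alpha>" and m: "m \<in> carrier M"
    have "(\<lambda>j. \<gamma> j + \<delta> j) \<in> lex_below \<beta>"
      unfolding lex_below_def exponents_iff[OF multidegree_multi_indices]
    proof (intro CollectI conjI)
      have d: "\<forall>j\<ge>r. \<delta> j = 0" "multidegree \<delta> = multidegree \<alpha>" "less_fun \<delta> \<alpha>"
        using \<delta> unfolding lex_below_def exponents_iff[OF multidegree_multi_indices] by auto
      show "\<forall>j\<ge>r. \<gamma> j + \<delta> j = 0" using d(1) \<beta> by (simp add: \<gamma>_def)
      show "multidegree (\<lambda>j. \<gamma> j + \<delta> j) = multidegree \<beta>"
        unfolding \<beta>_eq multidegree_add d(2) by auto
      show "less_fun (\<lambda>j. \<gamma> j + \<delta> j) \<beta>"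
        using d(3) unfolding \<beta>_eq less_fun_def by auto
    qed
    then have "monomial (\<lambda>j. \<gamma> j + \<delta> j) \<bullet> m \<in> ?T" using m by (rule filtration_monomial)
    then show "monomial \<delta> \<bullet> m \<in> colon ?T (monomial \<gamma>)"
      using m by (simp add: monomial_add colon_def smult_assoc1)
  qed
  then have *: "monomial \<gamma> \<bullet> u \<in> ?T"
    if "u \<in> monomial_filtration (multidegree \<alpha>) (lex_below \<alpha>)" for u
    using that by (auto simp: colon_def)
  show ?thesis
  proof
    fix m assume "m \<in> leading_colon \<alpha>"
    then have m: "m \<in> carrier M" "monomial \<gamma> \<bullet> (monomial \<alpha> \<bullet> m) \<in> ?T"
      using * by (auto simp: leading_colon_def colon_def)
    have "monomial \<beta> \<bullet> m = monomial \<gamma> \<bullet> (monomial \<alpha> \<bullet> m)"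
      unfolding \<beta>_eq monomial_add using m(1) by (simp add: R.m_comm[of "monomial \<alpha>"] smult_assoc1)
    with m show "m \<in> leading_colon \<beta>" by (simp add: leading_colon_def colon_def)
  qed
qed

lemma leading_colon_superset: "ideal_smult R (I 0) M \<subseteq> leading_colon \<alpha>"
  unfolding ideal_smult_def
proof (rule mod_span_least[OF leading_colon_submodule], safe)
  fix b m assume b: "b \<in> I 0" and m: "m \<in> carrier M"
  then have bR: "b \<in> carrier R" using ideal.Icarr[OF ideals] by blast
  have "monomial \<alpha> \<otimes> b \<in> power_product ((multidegree \<alpha>)(0 := Suc (multidegree \<alpha> 0)))"
    unfolding power_product_Suc[OF le0] by (rule ideal_prod.prod[OF monomial_in_power_product b])
  from smult_in_power_submodule[OF this m] filtration_base
  have "(monomial \<alpha> \<otimes> b) \<bullet> m \<in> monomial_filtration (multidegree \<alpha>) (lex_below \<alpha>)" by blast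
  then show "b \<bullet> m \<in> leading_colon \<alpha>"
    using bR m by (simp add: leading_colon_def colon_def smult_assoc1)
qed

lemma lex_maximum:
  assumes "finite D" "D \<noteq> {}" and "\<And>\<alpha>. \<alpha> \<in> D \<Longrightarrow> \<forall>j\<ge>r. \<alpha> j = 0"
  shows "\<exists>\<alpha>\<in>D. \<forall>\<beta>\<in>D. \<beta> \<noteq> \<alpha> \<longrightarrow> less_fun \<beta> \<alpha>"
  using assms
proof (induction rule: finite_ne_induct)
  case (insert \<gamma> D)
  then obtain \<alpha> where \<alpha>: "\<alpha> \<in> D" "\<forall>\<beta>\<in>D. \<beta> \<noteq> \<alpha> \<longrightarrow> less_fun \<beta> \<alpha>" by auto
  have "{k. \<gamma> k \<noteq> \<alpha> k} \<subseteq> {..<r}"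
  proof
    fix k assume "k \<in> {k. \<gamma> k \<noteq> \<alpha> k}"
    moreover have "\<gamma> k = \<alpha> k" if "r \<le> k" using insert.prems[of \<gamma>] insert.prems[of \<alpha>] \<alpha>(1) that by simp
    ultimately show "k \<in> {..<r}" by (auto simp: not_le[symmetric])
  qed
  then have "finite {k. \<gamma> k \<noteq> \<alpha> k}" by (rule finite_subset) simp
  then have "less_fun \<gamma> \<alpha> \<or> less_fun \<alpha> \<gamma>"
    using less_fun_trichotomy[of \<gamma> \<alpha>] insert.hyps \<alpha>(1) by blast
  then show ?case
  proof
    assume "less_fun \<gamma> \<alpha>"
    with \<alpha> show ?thesis by (intro bexI[of _ \<alpha>]) auto
  next
    assume "less_fun \<alpha> \<gamma>"
    with \<alpha> show ?thesis by (intro bexI[of _ \<gamma>]) (auto intro: less_fun_trans)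
  qed
qed simp

text \<open>
  Adding the lexicographically largest monomial \<open>x\<^sup>\<alpha>\<close> of a downward closed set \<open>D\<close> extends the filtration
  by \<open>x\<^sup>\<alpha> M\<close>, and all monomials below \<open>x\<^sup>\<alpha>\<close> are already present; so the new factor is \<open>M/L(\<alpha>)\<close>.
\<close>
lemma len_filtration:
  assumes n: "n \<in> multi_indices d" and "D \<subseteq> exponents d col r n"
    and "\<And>\<alpha> \<beta>. \<alpha> \<in> D \<Longrightarrow> \<beta> \<in> exponents d col r n \<Longrightarrow> less_fun \<beta> \<alpha> \<Longrightarrow> \<beta> \<in> D"
  shows "len (power_submodule (n(0 := Suc (n 0)))) (monomial_filtration n D) =
    (\<Sum>\<alpha>\<in>D. len (leading_colon \<alpha>) (carrier M))"
proof -
  have "finite D" using assms(2) finite_exponents[of r col d n, OF col_le] by (rule finite_subset) simp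
  then show ?thesis using assms(2,3)
  proof (induction D rule: finite_psubset_induct)
    case (psubset D)
    show ?case
    proof (cases "D = {}")
      case True
      show ?thesis unfolding True filtration_empty len_refl[OF power_submodule_submodule] by simp
    next
      case False
      have supp: "\<forall>j\<ge>r. \<alpha> j = 0" if "\<alpha> \<in> D" for \<alpha>
        using that psubset.prems(1) by (auto simp: exponents_def)
      obtain \<alpha> where \<alpha>: "\<alpha> \<in> D" "\<forall>\<beta>\<in>D. \<beta> \<noteq> \<alpha> \<longrightarrow> less_fun \<beta> \<alpha>"
        using lex_maximum[OF psubset.hyps(1) False supp] by blast
      have deg: "multidegree \<alpha> = n" using \<alpha>(1) psubset.prems(1) exponents_iff[OF n] by blast
      have below: "D - {\<alpha>} = lex_below \<alpha>"
        unfolding lex_below_def deg using \<alpha> psubset.prems less_fun_irrefl by blast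
      have "len (power_submodule (n(0 := Suc (n 0)))) (monomial_filtration n (D - {\<alpha>})) =
          (\<Sum>\<beta>\<in>D - {\<alpha>}. len (leading_colon \<beta>) (carrier M))"
      proof (rule psubset.IH)
        show "D - {\<alpha>} \<subset> D" "D - {\<alpha>} \<subseteq> exponents d col r n" using \<alpha>(1) psubset.prems(1) by auto
        fix \<gamma> \<beta> assume "\<gamma> \<in> D - {\<alpha>}" "\<beta> \<in> exponents d col r n" "less_fun \<beta> \<gamma>"
        then show "\<beta> \<in> D - {\<alpha>}" using \<alpha>(2) psubset.prems(2)[of \<gamma> \<beta>] less_fun_asym by blast
      qed
      moreover have "len (monomial_filtration n (D - {\<alpha>})) (monomial_filtration n D) = len (leading_colon \<alpha>) (carrier M)"
      proof -
        define T where "T = monomial_filtration n (D - {\<alpha>})"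
        have T: "submodule T R M" unfolding T_def by (rule filtration_submodule)
        have L: "colon T (monomial \<alpha>) = leading_colon \<alpha>" unfolding T_def leading_colon_def below deg ..
        have "monomial_filtration n D = T \<uplus> mul (monomial \<alpha>) (carrier M)"
          unfolding T_def filtration_insert[symmetric] using \<alpha>(1) by (simp add: insert_absorb)
        moreover have "T = T \<uplus> mul (monomial \<alpha>) {\<zero>\<^bsub>M\<^esub>}"
          by (rule sum_absorb[symmetric, OF T mul_submodule[OF zero_submodule monomial_closed]])
            (simp add: mul_def submodule_zero[OF T])
        ultimately have "len T (monomial_filtration n D) =
            len (leading_colon \<alpha> \<uplus> {\<zero>\<^bsub>M\<^esub>}) (leading_colon \<alpha> \<uplus> carrier M)"
          \<comment> \<open>Multiplication by \<open>x\<^sup>\<alpha>\<close> compares the interval from \<open>{0}\<close> to \<open>M\<close>, taken modulo \<open>L(\<alpha>)\<close>.\<close>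
          using len_mul[OF T monomial_closed zero_submodule carrier_is_submodule] L by metis
        also have "leading_colon \<alpha> \<uplus> {\<zero>\<^bsub>M\<^esub>} = leading_colon \<alpha>"
          by (rule sum_absorb[OF leading_colon_submodule zero_submodule])
            (simp add: submodule_zero[OF leading_colon_submodule])
        also have "leading_colon \<alpha> \<uplus> carrier M = carrier M"
          using sum_upper2[OF leading_colon_submodule carrier_is_submodule]
            submoduleE(1)[OF submodule_sum[OF leading_colon_submodule carrier_is_submodule]] by blast
        finally show ?thesis unfolding T_def .
      qed
      moreover have "len (power_submodule (n(0 := Suc (n 0)))) (monomial_filtration n D) =
          len (power_submodule (n(0 := Suc (n 0)))) (monomial_filtration n (D - {\<alpha>})) +
          len (monomial_filtration n (D - {\<alpha>})) (monomial_filtration n D)"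
        by (intro len_add filtration_least power_submodule_submodule filtration_submodule filtration_base
            filtration_monomial) auto
      ultimately show ?thesis
        using sum.remove[OF psubset.hyps(1) \<alpha>(1), of "\<lambda>\<alpha>. len (leading_colon \<alpha>) (carrier M)"]
        by (simp add: add.commute del: fun_upd_apply)
    qed
  qed
qed

text \<open>
  The factors \<open>M/L(\<alpha>)\<close> are quotients of \<open>M/I\<^sub>0 M\<close>, hence of finite length, and there are only finitely
  many of them, as \<open>L(\<alpha>) = L(min(\<alpha>, c))\<close>. The length of \<open>M\<^sub>n/M\<^bsub>n+\<epsilon>\<^sub>0\<^esub>\<close> thus becomes a sum of the kind
  treated by \<open>multi_numerical_exponents_sum\<close>.
\<close>
lemma hilbert_polynomial_exists_with_generators:
  assumes noetherian and fin: "len (ideal_smult R (I 0) M) (carrier M) \<noteq> \<infinity>"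
  shows "\<exists>e. coeff_family d e \<and> for_all_large d (\<lambda>n. \<exists>l.
    len (power_submodule (n(0 := Suc (n 0)))) (power_submodule n) = enat l \<and> int l = binomial_sum d e n)"
proof -
  \<comment> \<open>Monotonicity holds for exponents supported on the \<open>r\<close> variables; restricting extends it to all.\<close>
  define restrict where "restrict \<alpha> j = (if j < r then \<alpha> j else 0 :: nat)" for \<alpha> j
  have restrict_mono: "\<alpha> \<le> \<beta> \<Longrightarrow> restrict \<alpha> \<le> restrict \<beta>" for \<alpha> \<beta>
    by (auto simp: restrict_def le_fun_def)
  have mono: "leading_colon (restrict \<alpha>) \<subseteq> leading_colon (restrict \<beta>)" if "\<alpha> \<le> \<beta>" for \<alpha> \<beta>
    by (rule leading_colon_mono[OF _ _ restrict_mono[OF that]]) (auto simp: restrict_def)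
  obtain c where c: "\<And>\<alpha>. \<forall>j. j \<notin> {..<r} \<longrightarrow> \<alpha> j = 0 \<Longrightarrow>
      leading_colon (restrict \<alpha>) \<subseteq> leading_colon (restrict (\<lambda>j. if j \<in> {..<r} then min (\<alpha> j) c else 0))"
    using monotone_multiindex_stable[of "{H. submodule H R M}" "\<lambda>\<alpha>. leading_colon (restrict \<alpha>)" "{..<r}" "\<lambda>_. 0"]
      assms(1) leading_colon_submodule mono unfolding noetherian_def by auto
  have stable: "leading_colon \<alpha> = leading_colon (\<lambda>j. min (\<alpha> j) c)" if \<alpha>: "\<forall>j\<ge>r. \<alpha> j = 0" for \<alpha>
  proof
    have "restrict (\<lambda>j. if j \<in> {..<r} then min (\<alpha> j) c else 0) = (\<lambda>j. min (\<alpha> j) c)" "restrict \<alpha> = \<alpha>"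
      using \<alpha> by (auto simp: restrict_def not_less fun_eq_iff)
    with c[of \<alpha>] \<alpha> show "leading_colon \<alpha> \<subseteq> leading_colon (\<lambda>j. min (\<alpha> j) c)" by (simp add: not_less)
    show "leading_colon (\<lambda>j. min (\<alpha> j) c) \<subseteq> leading_colon \<alpha>"
      by (rule leading_colon_mono) (use \<alpha> in \<open>auto simp: le_fun_def\<close>)
  qed
  define g where "g \<alpha> = the_enat (len (leading_colon \<alpha>) (carrier M))" for \<alpha>
  have g: "len (leading_colon \<alpha>) (carrier M) = enat (g \<alpha>)" for \<alpha>
  proof -
    have "len (leading_colon \<alpha>) (carrier M) \<le> len (ideal_smult R (I 0) M) (carrier M)"
      by (rule len_antimono[OF leading_colon_superset])
    with fin show ?thesis unfolding g_def by (cases "len (leading_colon \<alpha>) (carrier M)") auto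
  qed
  define F where "F n = (\<Sum>\<alpha>\<in>exponents d col r n. int (g (\<lambda>j. min (\<alpha> j) c)))" for n
  have "eventually_binomial_sum d F"
    unfolding F_def
    by (intro multi_numerical_eventually_binomial_sum multi_numerical_exponents_sum[where g = "\<lambda>\<alpha>. int (g \<alpha>)"] col_le)
  then obtain e where e: "coeff_family d e" "for_all_large d (\<lambda>n. F n = binomial_sum d e n)"
    unfolding eventually_binomial_sum_def by blast
  have len_F: "\<exists>l. len (power_submodule (n(0 := Suc (n 0)))) (power_submodule n) = enat l \<and> int l = F n"
    if n: "n \<in> multi_indices d" for n
  proof (intro exI conjI)
    have "len (power_submodule (n(0 := Suc (n 0)))) (power_submodule n) =
        (\<Sum>\<alpha>\<in>exponents d col r n. len (leading_colon \<alpha>) (carrier M))"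
      using len_filtration[OF n order_refl] unfolding filtration_all[OF n] by blast
    also have "\<dots> = (\<Sum>\<alpha>\<in>exponents d col r n. enat (g \<alpha>))" by (simp only: g)
    also have "\<dots> = enat (\<Sum>\<alpha>\<in>exponents d col r n. g \<alpha>)" by (rule sum_enat)
    finally show "len (power_submodule (n(0 := Suc (n 0)))) (power_submodule n) =
      enat (\<Sum>\<alpha>\<in>exponents d col r n. g \<alpha>)" .
    have "g \<alpha> = g (\<lambda>j. min (\<alpha> j) c)" if "\<alpha> \<in> exponents d col r n" for \<alpha>
      unfolding g_def using stable[of \<alpha>] that by (simp add: exponents_def)
    then show "int (\<Sum>\<alpha>\<in>exponents d col r n. g \<alpha>) = F n" unfolding F_def by simp
  qed
  show ?thesis
  proof (intro exI[of _ e] conjI e(1), rule for_all_large_mono[OF e(2)])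
    fix n assume n: "n \<in> multi_indices d" and F: "F n = binomial_sum d e n"
    show "\<exists>l. len (power_submodule (n(0 := Suc (n 0)))) (power_submodule n) = enat l \<and> int l = binomial_sum d e n"
      using len_F[OF n] unfolding F .
  qed
qed

end

context module_with_ideals
begin

lemma generators_exist:
  assumes "noetherian_ring R"
  shows "\<exists>r x col. module_with_ideal_generators R M d I r x col"
proof -
  have "\<exists>S. i \<le> d \<longrightarrow> S \<subseteq> carrier R \<and> finite S \<and> I i = Idl S" for i
    using noetherian_ring.finetely_gen[OF assms ideals] by blast
  then obtain S where S: "\<And>i. i \<le> d \<Longrightarrow> S i \<subseteq> carrier R \<and> finite (S i) \<and> I i = Idl (S i)" by metis
  have "finite (Sigma {..d} S)" using S by auto
  then obtain h where h: "bij_betw h {0..<card (Sigma {..d} S)} (Sigma {..d} S)"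
    using ex_bij_betw_nat_finite by blast
  define r where "r = card (Sigma {..d} S)"
  have range: "h ` {..<r} = Sigma {..d} S" using h by (simp add: bij_betw_def r_def lessThan_atLeast0)
  have "module_with_ideal_generators R M d I r (\<lambda>j. snd (h j)) (\<lambda>j. fst (h j))"
  proof unfold_locales
    fix j assume "j < r"
    then have "h j \<in> Sigma {..d} S" using range by blast
    then have *: "fst (h j) \<le> d" "snd (h j) \<in> S (fst (h j))" by auto
    then show "snd (h j) \<in> carrier R" "fst (h j) \<le> d" using S[OF *(1)] by auto
  next
    fix i assume i: "i \<le> d"
    have "S i = {snd (h j) |j. j < r \<and> fst (h j) = i}"
    proof (intro equalityI subsetI)
      fix s assume "s \<in> S i"
      then have "(i, s) \<in> h ` {..<r}" unfolding range using i by simp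
      then obtain j where "j < r" "h j = (i, s)" by auto
      then show "s \<in> {snd (h j) |j. j < r \<and> fst (h j) = i}" by force
    next
      fix s assume "s \<in> {snd (h j) |j. j < r \<and> fst (h j) = i}"
      then obtain j where j: "j < r" "fst (h j) = i" "s = snd (h j)" by blast
      then have "h j \<in> Sigma {..d} S" using range by blast
      with j show "s \<in> S i" by auto
    qed
    then show "I i = Idl {snd (h j) |j. j < r \<and> fst (h j) = i}" using S[OF i] by simp
  qed
  then show ?thesis by blast
qed

lemma hilbert_polynomial_exists:
  assumes "noetherian_ring R" and noetherian and "len (ideal_smult R (I 0) M) (carrier M) \<noteq> \<infinity>"
  shows "\<exists>e. coeff_family d e \<and> for_all_large d (\<lambda>n. \<exists>l.
    len (power_submodule (n(0 := Suc (n 0)))) (power_submodule n) = enat l \<and> int l = binomial_sum d e n)"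
proof -
  obtain r x col where "module_with_ideal_generators R M d I r x col"
    using generators_exist[OF assms(1)] by blast
  then interpret module_with_ideal_generators R M d I r x col .
  show ?thesis by (rule hilbert_polynomial_exists_with_generators[OF assms(2,3)])
qed

end

section \<open>Quotient modules\<close>

locale quotient_of_module = module R M for R (structure) and M (structure) +
  fixes P
  assumes P: "submodule P R M"
begin

abbreviation proj :: "'c \<Rightarrow> 'c set" where
  "proj x \<equiv> P +>\<^bsub>M\<^esub> x"

abbreviation quot :: "('a, 'c set) module" where
  "quot \<equiv> quot_module M P"

sublocale PM: abelian_subgroup P M
  by (rule abelian_subgroupI3[OF additive_subgroup.intro[OF submodule.axioms(1)[OF P]] M.abelian_group_axioms])

lemma proj_shift: "p \<in> P \<Longrightarrow> x \<in> carrier M \<Longrightarrow> proj (p \<oplus>\<^bsub>M\<^esub> x) = proj x"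
  by (rule PM.a_repr_independence'[symmetric]) (auto simp: a_r_coset_def')

lemma proj_eqD: "x \<in> carrier M \<Longrightarrow> proj x = proj y \<Longrightarrow> \<exists>p\<in>P. x = p \<oplus>\<^bsub>M\<^esub> y"
  using PM.a_rcos_self[of x] by (auto simp: a_r_coset_def')

lemma carrier_quot: "carrier quot = proj ` carrier M"
  by (auto simp: quot_module_def A_RCOSETS_def')

lemma proj_add: "x \<in> carrier M \<Longrightarrow> y \<in> carrier M \<Longrightarrow> proj x \<oplus>\<^bsub>quot\<^esub> proj y = proj (x \<oplus>\<^bsub>M\<^esub> y)"
  by (simp add: quot_module_def PM.a_rcos_sum)

lemma proj_zero: "\<zero>\<^bsub>quot\<^esub> = proj \<zero>\<^bsub>M\<^esub>"
  using submoduleE(1)[OF P] by (simp add: quot_module_def)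

lemma proj_smult: "r \<in> carrier R \<Longrightarrow> x \<in> carrier M \<Longrightarrow> r \<odot>\<^bsub>quot\<^esub> proj x = proj (r \<bullet> x)"
proof -
  assume r: "r \<in> carrier R" and x: "x \<in> carrier M"
  have coset: "proj (r \<bullet> y) = proj (r \<bullet> x)" if y: "y \<in> proj x" for y
  proof -
    obtain p where p: "p \<in> P" "y = p \<oplus>\<^bsub>M\<^esub> x" using y by (auto simp: a_r_coset_def')
    then have "r \<bullet> y = r \<bullet> p \<oplus>\<^bsub>M\<^esub> r \<bullet> x"
      using r x submodule_carrier[OF P p(1)] by (simp add: smult_r_distr)
    then show ?thesis using proj_shift submoduleE(4)[OF P r p(1)] r x by simp
  qed
  have "(\<Union>y\<in>proj x. proj (r \<bullet> y)) = (\<Union>y\<in>proj x. proj (r \<bullet> x))"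
    by (rule SUP_cong[OF refl coset])
  also have "\<dots> = proj (r \<bullet> x)" using PM.a_rcos_self[OF x] by blast
  finally show ?thesis unfolding quot_module_def by simp
qed

lemma quot_module_module: "module R quot"
proof (rule moduleI)
  show "cring R" by (rule R.cring_axioms)
  show "abelian_group quot"
  proof (rule abelian_groupI)
    fix A assume "A \<in> carrier quot"
    then obtain x where x: "x \<in> carrier M" "A = proj x" unfolding carrier_quot by blast
    then show "\<zero>\<^bsub>quot\<^esub> \<oplus>\<^bsub>quot\<^esub> A = A" by (simp add: proj_zero proj_add)
    show "\<exists>B\<in>carrier quot. B \<oplus>\<^bsub>quot\<^esub> A = \<zero>\<^bsub>quot\<^esub>"
      unfolding carrier_quot proj_zero using x
      by (intro bexI[of _ "proj (\<ominus>\<^bsub>M\<^esub> x)"]) (auto simp: proj_add M.l_neg)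
  qed (auto simp: carrier_quot proj_add proj_zero M.a_ac)
qed (auto simp: carrier_quot proj_add proj_smult smult_l_distr smult_r_distr smult_assoc1)

sublocale Q: module R quot
  by (rule quot_module_module)

lemma submodule_proj_image:
  assumes H: "submodule H R M"
  shows "submodule (proj ` H) R quot"
proof (rule Q.submoduleI_smult)
  note carr = submodule_carrier[OF H]
  show "proj ` H \<subseteq> carrier quot" unfolding carrier_quot using carr by blast
  show "\<zero>\<^bsub>quot\<^esub> \<in> proj ` H" unfolding proj_zero using submodule_zero[OF H] by blast
  show "r \<odot>\<^bsub>quot\<^esub> A \<in> proj ` H" if "r \<in> carrier R" "A \<in> proj ` H" for r A
    using that submoduleE(4)[OF H] by (auto simp: proj_smult carr)
  show "A \<oplus>\<^bsub>quot\<^esub> B \<in> proj ` H" if "A \<in> proj ` H" "B \<in> proj ` H" for A B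
    using that submoduleE(5)[OF H] by (auto simp: proj_add carr)
qed

definition preimage :: "'c set set \<Rightarrow> 'c set" where
  "preimage H' = {x \<in> carrier M. proj x \<in> H'}"

lemma submodule_preimage:
  assumes H': "submodule H' R quot"
  shows "submodule (preimage H') R M"
proof (rule submoduleI_smult)
  show "r \<bullet> x \<in> preimage H'" if "r \<in> carrier R" "x \<in> preimage H'" for r x
    using that Q.submoduleE(4)[OF H', of r "proj x"] by (simp add: preimage_def proj_smult)
  show "x \<oplus>\<^bsub>M\<^esub> y \<in> preimage H'" if "x \<in> preimage H'" "y \<in> preimage H'" for x y
    using that Q.submoduleE(5)[OF H', of "proj x" "proj y"] by (simp add: preimage_def proj_add)
  show "\<zero>\<^bsub>M\<^esub> \<in> preimage H'" using Q.submodule_zero[OF H'] by (simp add: preimage_def proj_zero)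
qed (auto simp: preimage_def)

lemma proj_preimage: "submodule H' R quot \<Longrightarrow> proj ` preimage H' = H'"
  using Q.submoduleE(1)[of H'] by (auto simp: preimage_def carrier_quot)

lemma preimage_proj: "submodule H R M \<Longrightarrow> preimage (proj ` H) = P \<uplus> H"
proof (intro equalityI subsetI)
  fix x assume "x \<in> preimage (proj ` H)"
  then obtain h where "x \<in> carrier M" "h \<in> H" "proj x = proj h" unfolding preimage_def by blast
  then show "x \<in> P \<uplus> H" using proj_eqD[of x h] unfolding mem_sum_iff by blast
next
  fix x assume H: "submodule H R M" and "x \<in> P \<uplus> H"
  then obtain p h where "p \<in> P" "h \<in> H" "x = p \<oplus>\<^bsub>M\<^esub> h" unfolding mem_sum_iff by blast
  then show "x \<in> preimage (proj ` H)"
    using submodule_carrier[OF H] submodule_carrier[OF P] by (auto simp: preimage_def proj_shift)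
qed

lemma preimage_proj_above: "submodule H R M \<Longrightarrow> P \<subseteq> H \<Longrightarrow> preimage (proj ` H) = H"
  unfolding preimage_proj by (intro antisym sum_least sum_upper2 P) auto

lemma preimage_mono: "A \<subseteq> B \<Longrightarrow> preimage A \<subseteq> preimage B"
  by (auto simp: preimage_def)

text \<open>
  The correspondence between submodules of \<open>M/P\<close> and submodules of \<open>M\<close> containing \<open>P\<close>.
\<close>
lemma len_quot:
  assumes A: "submodule A R M" and B: "submodule B R M"
  shows "Q.len (proj ` A) (proj ` B) = len (P \<uplus> A) (P \<uplus> B)"
proof (rule antisym)
  show "Q.len (proj ` A) (proj ` B) \<le> len (P \<uplus> A) (P \<uplus> B)"
    unfolding len_def Q.len_def
  proof (rule height_mono_map[where f = preimage])
    fix H' assume "H' \<in> Q.between (proj ` A) (proj ` B)"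
    then have H': "submodule H' R quot" "proj ` A \<subseteq> H'" "H' \<subseteq> proj ` B" by (auto simp: Q.between_def)
    show "preimage H' \<in> between (P \<uplus> A) (P \<uplus> B)"
      using submodule_preimage[OF H'(1)] preimage_mono[OF H'(2)] preimage_mono[OF H'(3)]
      unfolding preimage_proj[OF A] preimage_proj[OF B] between_def by simp
  next
    fix H' G' assume "H' \<in> Q.between (proj ` A) (proj ` B)" "G' \<in> Q.between (proj ` A) (proj ` B)"
      and less: "H' \<subset> G'"
    then have HG: "submodule H' R quot" "submodule G' R quot" by (auto simp: Q.between_def)
    then have "preimage H' \<noteq> preimage G'"
      using less proj_preimage[OF HG(1)] proj_preimage[OF HG(2)] by (metis order_less_irrefl)
    then show "preimage H' \<subset> preimage G'" using preimage_mono[of H' G'] less by blast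
  qed
  show "len (P \<uplus> A) (P \<uplus> B) \<le> Q.len (proj ` A) (proj ` B)"
    unfolding len_def Q.len_def
  proof (rule height_mono_map[where f = "\<lambda>H. proj ` H"])
    fix H assume "H \<in> between (P \<uplus> A) (P \<uplus> B)"
    then have H: "submodule H R M" "P \<uplus> A \<subseteq> H" "H \<subseteq> P \<uplus> B" by (auto simp: between_def)
    have "proj ` (P \<uplus> B) \<subseteq> proj ` B"
    proof
      fix Z assume "Z \<in> proj ` (P \<uplus> B)"
      then obtain p b where "p \<in> P" "b \<in> B" "Z = proj (p \<oplus>\<^bsub>M\<^esub> b)" by (auto simp: mem_sum_iff)
      then show "Z \<in> proj ` B" using proj_shift[of p b] submodule_carrier[OF B] by auto
    qed
    moreover have "A \<subseteq> H" using H(2) sum_upper2[OF P A] by blast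
    ultimately show "proj ` H \<in> Q.between (proj ` A) (proj ` B)"
      unfolding Q.between_def using submodule_proj_image[OF H(1)] H(3) by blast
  next
    fix H G assume "H \<in> between (P \<uplus> A) (P \<uplus> B)" "G \<in> between (P \<uplus> A) (P \<uplus> B)"
      and less: "H \<subset> G"
    then have HG: "submodule H R M" "submodule G R M" "P \<uplus> A \<subseteq> H" "P \<uplus> A \<subseteq> G"
      by (auto simp: between_def)
    then have "P \<subseteq> H" "P \<subseteq> G" using sum_upper1[OF P A] by auto
    then have "preimage (proj ` H) = H" "preimage (proj ` G) = G"
      using preimage_proj_above HG(1,2) by auto
    then have "proj ` H \<noteq> proj ` G" using less by (metis order_less_irrefl)
    then show "proj ` H \<subset> proj ` G" using less by blast
  qed
qed

lemma module_length_quot: "module_length R quot = len P (carrier M)"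
proof -
  have "module_length R quot = height {H'. submodule H' R quot}"
    unfolding module_length_def height_def has_chain_def by simp
  also have "{H'. submodule H' R quot} = Q.between (proj ` {\<zero>\<^bsub>M\<^esub>}) (proj ` carrier M)"
    using Q.submoduleE(1) Q.submodule_zero unfolding Q.between_def carrier_quot[symmetric] by (auto simp: proj_zero)
  also have "height \<dots> = len (P \<uplus> {\<zero>\<^bsub>M\<^esub>}) (P \<uplus> carrier M)"
    using len_quot[OF zero_submodule carrier_is_submodule] unfolding Q.len_def .
  also have "P \<uplus> {\<zero>\<^bsub>M\<^esub>} = P"
    by (rule sum_absorb[OF P zero_submodule]) (simp add: submodule_zero[OF P])
  also have "P \<uplus> carrier M = carrier M"
    using sum_upper2[OF P carrier_is_submodule] submoduleE(1)[OF submodule_sum[OF P carrier_is_submodule]] by blast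
  finally show ?thesis .
qed

lemma ideal_smult_quot:
  assumes b: "\<bb> \<subseteq> carrier R"
  shows "ideal_smult R \<bb> quot = proj ` ideal_smult R \<bb> M"
proof
  have gen_carrier: "{a \<bullet> m |a m. a \<in> \<bb> \<and> m \<in> carrier M} \<subseteq> carrier M"
    and gen_carrier': "{a \<odot>\<^bsub>quot\<^esub> m |a m. a \<in> \<bb> \<and> m \<in> carrier quot} \<subseteq> carrier quot" using b by auto
  have sub: "submodule (ideal_smult R \<bb> M) R M" "submodule (ideal_smult R \<bb> quot) R quot"
    unfolding ideal_smult_def by (rule mod_span_submodule[OF gen_carrier], rule Q.mod_span_submodule[OF gen_carrier'])
  show "ideal_smult R \<bb> quot \<subseteq> proj ` ideal_smult R \<bb> M"
    unfolding ideal_smult_def[of R \<bb> quot]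
  proof (rule Q.mod_span_least[OF submodule_proj_image[OF sub(1)]], clarify)
    fix a A assume a: "a \<in> \<bb>" and "A \<in> carrier quot"
    then obtain m where m: "m \<in> carrier M" "A = proj m" unfolding carrier_quot by blast
    have "a \<bullet> m \<in> ideal_smult R \<bb> M"
      unfolding ideal_smult_def by (rule subsetD[OF mod_span_superset]) (use a m in blast)
    then show "a \<odot>\<^bsub>quot\<^esub> A \<in> proj ` ideal_smult R \<bb> M" using a b m by (auto simp: proj_smult)
  qed
  have "ideal_smult R \<bb> M \<subseteq> preimage (ideal_smult R \<bb> quot)"
    unfolding ideal_smult_def[of R \<bb> M]
  proof (rule mod_span_least[OF submodule_preimage[OF sub(2)]], clarify)
    fix a m assume a: "a \<in> \<bb>" and m: "m \<in> carrier M"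
    have "a \<odot>\<^bsub>quot\<^esub> proj m \<in> ideal_smult R \<bb> quot"
      unfolding ideal_smult_def by (rule subsetD[OF Q.mod_span_superset]) (use a m carrier_quot in blast)
    then show "a \<bullet> m \<in> preimage (ideal_smult R \<bb> quot)"
      using a b m by (auto simp: preimage_def proj_smult)
  qed
  then show "proj ` ideal_smult R \<bb> M \<subseteq> ideal_smult R \<bb> quot" by (auto simp: preimage_def)
qed

end

context module
begin

lemma submodule_of_restriction:
  assumes A: "submodule A R M"
  shows "submodule H R (M\<lparr>carrier := A\<rparr>) \<longleftrightarrow> submodule H R M \<and> H \<subseteq> A"
proof -
  interpret MA: module R "M\<lparr>carrier := A\<rparr>"
    by (rule submodule.submodule_is_module[OF A module_axioms])
  show ?thesis
  proof
    assume H: "submodule H R (M\<lparr>carrier := A\<rparr>)"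
    have HA: "H \<subseteq> A" using MA.submoduleE(1)[OF H] by simp
    moreover have "submodule H R M"
    proof (rule submoduleI_smult)
      show "H \<subseteq> carrier M" using HA submoduleE(1)[OF A] by blast
    qed (use MA.submoduleE(4,5)[OF H] MA.submodule_zero[OF H] in auto)
    ultimately show "submodule H R M \<and> H \<subseteq> A" by blast
  next
    assume H: "submodule H R M \<and> H \<subseteq> A"
    then have H': "submodule H R M" by blast
    show "submodule H R (M\<lparr>carrier := A\<rparr>)"
      by (rule MA.submoduleI_smult) (use H submoduleE(4,5)[OF H'] submodule_zero[OF H'] in auto)
  qed
qed

lemma module_length_subquotient:
  assumes A: "submodule A R M" and B: "submodule B R M" and "B \<subseteq> A"
  shows "module_length R (quot_module (M\<lparr>carrier := A\<rparr>) B) = len B A"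
proof -
  interpret MA: module R "M\<lparr>carrier := A\<rparr>"
    by (rule submodule.submodule_is_module[OF A module_axioms])
  have "submodule B R (M\<lparr>carrier := A\<rparr>)"
    using B \<open>B \<subseteq> A\<close> unfolding submodule_of_restriction[OF A] by blast
  then have MB: "quotient_of_module R (M\<lparr>carrier := A\<rparr>) B"
    by (rule quotient_of_module.intro[OF MA.module_axioms quotient_of_module_axioms.intro])
  have "MA.between B A = between B A"
    unfolding MA.between_def between_def submodule_of_restriction[OF A] by blast
  then show ?thesis using quotient_of_module.module_length_quot[OF MB] by (simp add: MA.len_def len_def)
qed

end

section \<open>Passing to the quotient by a weak-(FC)-element\<close>

locale module_quotient_with_ideals = module_with_ideals R M d I + quotient_of_module R M P
  for R (structure) and M (structure) and d I P
begin

lemma quot_with_ideals: "module_with_ideals R quot d I"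
  by (rule module_with_ideals.intro[OF quot_module_module module_with_ideals_axioms.intro[OF ideals]])

sublocale QI: module_with_ideals R quot d I
  by (rule quot_with_ideals)

lemma power_submodule_quot: "QI.power_submodule n = proj ` power_submodule n"
  unfolding QI.power_submodule_def power_submodule_def
  by (rule ideal_smult_quot) (use power_product_carrier in blast)

end

context module_with_ideals
begin

lemma module_length_mixed_component:
  "module_length R (mixed_component R d I M n) = len (power_submodule (n(0 := Suc (n 0)))) (power_submodule n)"
  unfolding mixed_component_def power_submodule_def[symmetric] Suc_eq_plus1[symmetric]
  by (rule module_length_subquotient[OF power_submodule_submodule power_submodule_submodule power_submodule_Suc_le])

text \<open>
  The Hilbert function of \<open>M/P\<close>, computed from submodules of \<open>M\<close> alone.
\<close>
definition rel_hilbert_function :: "'c set \<Rightarrow> (nat \<Rightarrow> nat) \<Rightarrow> enat" where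
  "rel_hilbert_function P n =
    len (P \<uplus> power_submodule (n(0 := Suc (n 0)))) (P \<uplus> power_submodule n)"

lemma module_length_mixed_component_quot:
  assumes P: "submodule P R M"
  shows "module_length R (mixed_component R d I (quot_module M P) n) = rel_hilbert_function P n"
proof -
  interpret module_quotient_with_ideals R M d I P
    by (intro module_quotient_with_ideals.intro quotient_of_module.intro quotient_of_module_axioms.intro
        module_with_ideals_axioms module_axioms P)
  show ?thesis
    unfolding QI.module_length_mixed_component power_submodule_quot rel_hilbert_function_def
    by (rule len_quot[OF power_submodule_submodule power_submodule_submodule])
qed

lemma rel_hilbert_function_zero:
  "rel_hilbert_function {\<zero>\<^bsub>M\<^esub>} n = len (power_submodule (n(0 := Suc (n 0)))) (power_submodule n)"
proof -
  have "{\<zero>\<^bsub>M\<^esub>} \<uplus> A = A" if "submodule A R M" for A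
    using sum_upper2[OF zero_submodule that] sum_least[OF that, of "{\<zero>\<^bsub>M\<^esub>}" A] submodule_zero[OF that] by auto
  then show ?thesis unfolding rel_hilbert_function_def using power_submodule_submodule by simp
qed

text \<open>
  The conditions on a weak-(FC)-element of \<open>M/P\<close>, pulled back to \<open>M\<close>.
\<close>
lemma weak_FC_element_quotD:
  assumes P: "submodule P R M" and FC: "weak_FC_element R d I (quot_module M P) i a"
  shows "i \<le> d" "a \<in> I i"
    and "for_all_large d (\<lambda>n. (P \<uplus> mul a (carrier M)) \<inter> (P \<uplus> power_submodule (n(i := Suc (n i))))
      \<subseteq> P \<uplus> mul a (power_submodule n))"
    and "\<And>m. m \<in> colon P a \<Longrightarrow>
      \<exists>t::nat. \<forall>b\<in>(\<Otimes>\<^bsub>ideals_set R\<^esub> l \<in> {..d}. I l) [^]\<^bsub>ideals_set R\<^esub> t. b \<bullet> m \<in> P"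
proof -
  interpret module_quotient_with_ideals R M d I P
    by (intro module_quotient_with_ideals.intro quotient_of_module.intro quotient_of_module_axioms.intro
        module_with_ideals_axioms module_axioms P)
  show i: "i \<le> d" and a: "a \<in> I i" using FC unfolding weak_FC_element_def by auto
  have aR: "a \<in> carrier R" using ideal.Icarr[OF ideals[OF i] a] .
  have eq: "for_all_large d (\<lambda>n. (\<lambda>m. a \<odot>\<^bsub>quot\<^esub> m) ` carrier quot \<inter> QI.power_submodule (n(i := Suc (n i)))
      = (\<lambda>m. a \<odot>\<^bsub>quot\<^esub> m) ` QI.power_submodule n)"
    using FC unfolding weak_FC_element_def QI.power_submodule_def power_product_Suc[OF i] by blast
  show "for_all_large d (\<lambda>n. (P \<uplus> mul a (carrier M)) \<inter> (P \<uplus> power_submodule (n(i := Suc (n i))))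
      \<subseteq> P \<uplus> mul a (power_submodule n))"
  proof (rule for_all_large_mono[OF eq], rule subsetI)
    fix n y
    assume eq: "(\<lambda>m. a \<odot>\<^bsub>quot\<^esub> m) ` carrier quot \<inter> QI.power_submodule (n(i := Suc (n i)))
        = (\<lambda>m. a \<odot>\<^bsub>quot\<^esub> m) ` QI.power_submodule n"
      and y: "y \<in> (P \<uplus> mul a (carrier M)) \<inter> (P \<uplus> power_submodule (n(i := Suc (n i))))"
    note carr = submodule_carrier[OF power_submodule_submodule]
    obtain p m where pm: "p \<in> P" "m \<in> carrier M" "y = p \<oplus>\<^bsub>M\<^esub> a \<bullet> m"
      using y unfolding Int_iff mem_sum_iff mul_def by blast
    obtain q z where qz: "q \<in> P" "z \<in> power_submodule (n(i := Suc (n i)))" "y = q \<oplus>\<^bsub>M\<^esub> z"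
      using y unfolding Int_iff mem_sum_iff by blast
    have yM: "y \<in> carrier M" using pm aR submodule_carrier[OF P] by simp
    have "proj y = a \<odot>\<^bsub>quot\<^esub> proj m" using pm aR by (simp add: proj_shift proj_smult)
    moreover have "proj y = proj z" using qz carr by (simp add: proj_shift)
    ultimately have "proj y \<in> (\<lambda>m. a \<odot>\<^bsub>quot\<^esub> m) ` carrier quot \<inter> QI.power_submodule (n(i := Suc (n i)))"
      unfolding power_submodule_quot carrier_quot using pm(2) qz(2) by blast
    then have "proj y \<in> (\<lambda>m. a \<odot>\<^bsub>quot\<^esub> m) ` proj ` power_submodule n"
      unfolding eq unfolding power_submodule_quot .
    then obtain w where w: "w \<in> power_submodule n" "proj y = a \<odot>\<^bsub>quot\<^esub> proj w" by blast
    then have "proj y = proj (a \<bullet> w)" using aR carr by (simp add: proj_smult)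
    then obtain p' where "p' \<in> P" "y = p' \<oplus>\<^bsub>M\<^esub> a \<bullet> w" using proj_eqD[OF yM] by blast
    with w(1) show "y \<in> P \<uplus> mul a (power_submodule n)" unfolding mem_sum_iff mul_def by blast
  qed
  have proj_in_zero: "proj m = \<zero>\<^bsub>quot\<^esub> \<longleftrightarrow> m \<in> P" if carr: "m \<in> carrier M" for m
  proof
    assume "proj m = \<zero>\<^bsub>quot\<^esub>"
    then obtain p where "p \<in> P" "m = p \<oplus>\<^bsub>M\<^esub> \<zero>\<^bsub>M\<^esub>" using proj_eqD[OF carr, of "\<zero>\<^bsub>M\<^esub>"] proj_zero by auto
    then show "m \<in> P" using submodule_carrier[OF P] by simp
  next
    assume "m \<in> P"
    then show "proj m = \<zero>\<^bsub>quot\<^esub>" unfolding proj_zero using proj_shift[of m "\<zero>\<^bsub>M\<^esub>"] carr by simp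
  qed
  let ?II = "\<Otimes>\<^bsub>ideals_set R\<^esub> l \<in> {..d}. I l"
  fix m assume m: "m \<in> colon P a"
  then have mM: "m \<in> carrier M" and am: "a \<bullet> m \<in> P" by (auto simp: colon_def)
  have "proj m \<in> annihilated_by quot {a}"
    unfolding annihilated_by_def using mM am aR carrier_quot
    by (auto simp: proj_smult proj_in_zero)
  then have "proj m \<in> power_torsion R quot ?II" using FC unfolding weak_FC_element_def by blast
  then obtain t :: nat where t: "\<forall>b\<in>?II [^]\<^bsub>ideals_set R\<^esub> t. b \<odot>\<^bsub>quot\<^esub> proj m = \<zero>\<^bsub>quot\<^esub>"
    unfolding power_torsion_def annihilated_by_def by blast
  have "b \<bullet> m \<in> P" if "b \<in> ?II [^]\<^bsub>ideals_set R\<^esub> t" for b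
  proof -
    have "b \<in> power_product (\<lambda>i. t)" using that unfolding power_product_const .
    then have "b \<in> carrier R" by (rule power_product_carrier)
    then show ?thesis using t that mM by (auto simp: proj_smult proj_in_zero)
  qed
  then show "\<exists>t::nat. \<forall>b\<in>?II [^]\<^bsub>ideals_set R\<^esub> t. b \<bullet> m \<in> P" by blast
qed

text \<open>
  For large \<open>n\<close> the hypotheses of \<open>len_quotient_by_mul\<close> hold: the intersection condition in degrees
  \<open>n - \<epsilon>\<^sub>i\<close> and \<open>n - \<epsilon>\<^sub>i + \<epsilon>\<^sub>0\<close>, and \<open>(P : a) \<inter> (P + M\<^bsub>n-\<epsilon>\<^sub>i\<^esub>) \<subseteq> P\<close> because \<open>P : a\<close> is torsion modulo \<open>P\<close>. The
  identity is stated as a sum since lengths are extended natural numbers.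
\<close>
lemma rel_hilbert_function_step:
  assumes R: "noetherian_ring R" and N: noetherian and P: "submodule P R M"
    and FC: "weak_FC_element R d I (quot_module M P) i a"
  shows "for_all_large d (\<lambda>n. n i \<ge> 1 \<and> rel_hilbert_function P n =
    rel_hilbert_function P (n(i := n i - 1)) +
    rel_hilbert_function (P \<uplus> mul a (carrier M)) n)"
proof -
  note i = weak_FC_element_quotD(1)[OF P FC] and a = weak_FC_element_quotD(2)[OF P FC]
  have aR: "a \<in> carrier R" using ideal.Icarr[OF ideals[OF i] a] .
  let ?II = "\<Otimes>\<^bsub>ideals_set R\<^esub> l \<in> {..d}. I l"
  have "ideal ?II R"
  proof -
    have "?II \<in> carrier (ideals_set R)"
      by (rule IS.finprod_closed) (use ideals in \<open>auto simp: ideals_set_simps(1)\<close>)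
    then show ?thesis by (simp add: ideals_set_simps)
  qed
  then obtain S where S: "S \<subseteq> carrier R" "finite S" "?II = Idl S"
    using noetherian_ring.finetely_gen[OF R] by blast
  have SI: "S \<subseteq> ?II" unfolding S(3) by (rule R.genideal_self[OF S(1)])
  have spow: "s [^] t \<in> ?II [^]\<^bsub>ideals_set R\<^esub> t" if "s \<in> S" for s and t :: nat
  proof (induction t)
    case 0 show ?case by (simp add: ideals_set_simps)
  next
    case (Suc t)
    have "s [^] t \<otimes> s \<in> ?II [^]\<^bsub>ideals_set R\<^esub> t \<otimes>\<^bsub>ideals_set R\<^esub> ?II"
      unfolding ideals_set_simps using Suc SI that by (intro ideal_prod.prod) auto
    then show ?case by simp
  qed
  obtain L c where L: "submodule L R M" "P \<subseteq> L" "L \<inter> colon P a = P"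
    "\<And>b m. b \<in> Idl S [^]\<^bsub>ideals_set R\<^esub> (c::nat) \<Longrightarrow> m \<in> carrier M \<Longrightarrow> b \<bullet> m \<in> L"
  proof (rule ideal_power_meets_torsion_trivially[OF N P colon_submodule[OF P aR] colon_superset[OF P aR] S(2,1)])
    fix s m assume s: "s \<in> S" and "m \<in> colon P a"
    then obtain t :: nat where "\<forall>b\<in>?II [^]\<^bsub>ideals_set R\<^esub> t. b \<bullet> m \<in> P"
      using weak_FC_element_quotD(4)[OF P FC] by blast
    then show "\<exists>t::nat. (s [^] t) \<bullet> m \<in> P" using spow[OF s] by blast
  qed blast
  have K: "colon P a \<inter> (P \<uplus> power_submodule m) \<subseteq> P" if m: "\<forall>i\<le>d. c \<le> m i" for m
  proof -
    have "power_submodule m \<subseteq> L"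
    proof (rule power_submodule_least[OF L(1)])
      fix b u assume "b \<in> power_product m" "u \<in> carrier M"
      then show "b \<bullet> u \<in> L"
        using power_product_antimono[of "\<lambda>i. c" m] m L(4) unfolding power_product_const S(3) by blast
    qed
    then have "P \<uplus> power_submodule m \<subseteq> L" using sum_least[OF L(1,2)] by blast
    with L(3) show ?thesis by blast
  qed
  obtain c' where c': "\<And>m. m \<in> multi_indices d \<Longrightarrow> \<forall>i\<le>d. c' \<le> m i \<Longrightarrow>
      (P \<uplus> mul a (carrier M)) \<inter> (P \<uplus> power_submodule (m(i := Suc (m i))))
      \<subseteq> P \<uplus> mul a (power_submodule m)"
    using weak_FC_element_quotD(3)[OF P FC] unfolding for_all_large_def by blast
  have "for_all_large d (\<lambda>n. \<forall>j\<le>d. Suc (max c c') \<le> n j)" by (rule for_all_large_ge)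
  then show ?thesis
  proof (rule for_all_large_mono)
    fix n assume n: "n \<in> multi_indices d" "\<forall>j\<le>d. Suc (max c c') \<le> n j"
    \<comment> \<open>\<open>m0\<close> is \<open>m\<close> raised in direction \<open>0\<close>; raising both by one in direction \<open>i\<close> gives \<open>n\<close> and its own
        raise in direction \<open>0\<close>, also when \<open>i = 0\<close>.\<close>
    define m where "m = n(i := n i - 1)"
    define m0 where "m0 = m(0 := Suc (m 0))"
    have ni: "n i \<ge> 1" using n(2) i by auto
    have n_eq: "n = m(i := Suc (m i))" using ni by (auto simp: m_def)
    have n0_eq: "n(0 := Suc (n 0)) = m0(i := Suc (m0 i))" using ni by (auto simp: m_def m0_def)
    have m: "m \<in> multi_indices d" "m0 \<in> multi_indices d" using n(1) i by (auto simp: m_def m0_def multi_indices_def)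
    have ge: "c \<le> m j" "c' \<le> m j" "c' \<le> m0 j" if "j \<le> d" for j
      using n(2)[rule_format, OF that] by (auto simp: m_def m0_def)
    have "rel_hilbert_function P n = rel_hilbert_function P m +
        rel_hilbert_function (P \<uplus> mul a (carrier M)) n"
      unfolding rel_hilbert_function_def m0_def[symmetric]
    proof (rule len_quotient_by_mul[OF P aR])
      show "power_submodule (n(0 := Suc (n 0))) \<subseteq> power_submodule n" "power_submodule m0 \<subseteq> power_submodule m"
        unfolding m0_def by (rule power_submodule_Suc_le)+
      show "mul a (power_submodule m) \<subseteq> power_submodule n"
        using mul_power_submodule[OF i a, of m] n_eq by simp
      show "mul a (power_submodule m0) \<subseteq> power_submodule (n(0 := Suc (n 0)))"
        using mul_power_submodule[OF i a, of m0] unfolding n0_eq .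
      show "(P \<uplus> mul a (carrier M)) \<inter> (P \<uplus> power_submodule n) \<subseteq> P \<uplus> mul a (power_submodule m)"
        using c'[OF m(1)] ge n_eq by simp
      show "(P \<uplus> mul a (carrier M)) \<inter> (P \<uplus> power_submodule (n(0 := Suc (n 0))))
          \<subseteq> P \<uplus> mul a (power_submodule m0)"
        using c'[OF m(2)] ge unfolding n0_eq by blast
      show "colon P a \<inter> (P \<uplus> power_submodule m) \<subseteq> P" by (rule K) (use ge in blast)
    qed (rule power_submodule_submodule)+
    with ni show "n i \<ge> 1 \<and> rel_hilbert_function P n = rel_hilbert_function P (n(i := n i - 1)) +
        rel_hilbert_function (P \<uplus> mul a (carrier M)) n" unfolding m_def by blast
  qed
qed

definition has_hilbert_coeffs :: "'c set \<Rightarrow> ((nat \<Rightarrow> nat) \<Rightarrow> int) \<Rightarrow> bool" where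
  "has_hilbert_coeffs P e \<longleftrightarrow> coeff_family d e \<and>
    for_all_large d (\<lambda>n. \<exists>l. rel_hilbert_function P n = enat l \<and> int l = binomial_sum d e n)"

lemma has_hilbert_coeffs_step:
  assumes "noetherian_ring R" and noetherian and P: "submodule P R M"
    and FC: "weak_FC_element R d I (quot_module M P) i a" and e: "has_hilbert_coeffs P e"
  shows "has_hilbert_coeffs (P \<uplus> mul a (carrier M)) (shift_coeffs i e)"
proof -
  note i = weak_FC_element_quotD(1)[OF P FC]
  have ce: "coeff_family d e"
    and he: "for_all_large d (\<lambda>n. \<exists>l. rel_hilbert_function P n = enat l \<and> int l = binomial_sum d e n)"
    using e unfolding has_hilbert_coeffs_def by auto
  note large = for_all_large_conj[OF rel_hilbert_function_step[OF assms(1-4)]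
      for_all_large_conj[OF he for_all_large_decr[OF he i]]]
  show ?thesis unfolding has_hilbert_coeffs_def
  proof (intro conjI coeff_family_shift ce, rule for_all_large_mono[OF large], elim conjE exE)
    fix n l l'
    assume n: "1 \<le> n i"
      and sum: "rel_hilbert_function P n = rel_hilbert_function P (n(i := n i - 1)) +
        rel_hilbert_function (P \<uplus> mul a (carrier M)) n"
      and l: "rel_hilbert_function P n = enat l" "int l = binomial_sum d e n"
      and l': "rel_hilbert_function P (n(i := n i - 1)) = enat l'" "int l' = binomial_sum d e (n(i := n i - 1))"
    obtain q where q: "rel_hilbert_function (P \<uplus> mul a (carrier M)) n = enat q"
      using sum l(1) l'(1) by (cases "rel_hilbert_function (P \<uplus> mul a (carrier M)) n") auto
    then have "l = l' + q" using sum l(1) l'(1) by simp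
    then have "int q = binomial_sum d (shift_coeffs i e) n"
      using l(2) l'(2) binomial_sum_shift[OF ce i, of n] n by simp
    with q show "\<exists>l. rel_hilbert_function (P \<uplus> mul a (carrier M)) n = enat l \<and>
        int l = binomial_sum d (shift_coeffs i e) n" by blast
  qed
qed

section \<open>Weak-(FC)-sequences\<close>

lemma ideal_smult_genideal_insert:
  assumes S: "S \<subseteq> carrier R" and a: "a \<in> carrier R"
  shows "ideal_smult R (Idl (insert a S)) M = ideal_smult R (Idl S) M \<uplus> mul a (carrier M)"
proof
  have aS: "insert a S \<subseteq> carrier R" using S a by blast
  have carr: "b \<in> carrier R" if "b \<in> Idl T" "T \<subseteq> carrier R" for b T
    using ideal.Icarr[OF R.genideal_ideal] that by blast
  have sub: "submodule (ideal_smult R (Idl T) M) R M" if "T \<subseteq> carrier R" for T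
    unfolding ideal_smult_def by (rule mod_span_submodule) (use carr that in auto)
  have gen: "b \<bullet> m \<in> ideal_smult R (Idl T) M" if "b \<in> Idl T" "m \<in> carrier M" for b m T
    unfolding ideal_smult_def by (rule subsetD[OF mod_span_superset]) (use that in blast)
  note s = sub[OF S] mul_submodule[OF carrier_is_submodule a]
  show "ideal_smult R (Idl (insert a S)) M \<subseteq> ideal_smult R (Idl S) M \<uplus> mul a (carrier M)"
    unfolding ideal_smult_def[of R "Idl (insert a S)"]
  proof (rule mod_span_least[OF submodule_sum[OF s]], clarify)
    fix b m assume b: "b \<in> Idl (insert a S)" and m: "m \<in> carrier M"
    show "b \<bullet> m \<in> ideal_smult R (Idl S) M \<uplus> mul a (carrier M)"
    proof (rule genideal_smult_mem[OF submodule_sum[OF s] m aS _ b])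
      fix t assume "t \<in> insert a S"
      then have "t \<bullet> m \<in> mul a (carrier M) \<or> t \<bullet> m \<in> ideal_smult R (Idl S) M"
        using gen[OF _ m, of t S] R.genideal_self[OF S] m by (auto simp: mul_def)
      then show "t \<bullet> m \<in> ideal_smult R (Idl S) M \<uplus> mul a (carrier M)"
        using sum_upper1[OF s] sum_upper2[OF s] by blast
    qed
  qed
  show "ideal_smult R (Idl S) M \<uplus> mul a (carrier M) \<subseteq> ideal_smult R (Idl (insert a S)) M"
  proof (rule sum_least[OF sub[OF aS]])
    have "Idl S \<subseteq> Idl (insert a S)" by (rule R.subset_Idl_subset[OF aS]) blast
    then show "ideal_smult R (Idl S) M \<subseteq> ideal_smult R (Idl (insert a S)) M"
      unfolding ideal_smult_def[of R "Idl S"] using gen by (intro mod_span_least sub aS) blast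
    have "a \<in> Idl (insert a S)" using R.genideal_self[OF aS] by blast
    then show "mul a (carrier M) \<subseteq> ideal_smult R (Idl (insert a S)) M" using gen by (auto simp: mul_def)
  qed
qed

lemma ideal_smult_genideal_empty: "ideal_smult R (Idl {}) M = {\<zero>\<^bsub>M\<^esub>}"
proof
  have "Idl {} \<subseteq> {\<zero>}" by (rule R.genideal_minimal[OF R.zeroideal]) simp
  then show "ideal_smult R (Idl {}) M \<subseteq> {\<zero>\<^bsub>M\<^esub>}"
    unfolding ideal_smult_def by (intro mod_span_least[OF zero_submodule]) auto
  have "{b \<bullet> m |b m. b \<in> Idl {} \<and> m \<in> carrier M} \<subseteq> carrier M"
    using \<open>Idl {} \<subseteq> {\<zero>}\<close> by auto
  from submodule_zero[OF mod_span_submodule[OF this]]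
  show "{\<zero>\<^bsub>M\<^esub>} \<subseteq> ideal_smult R (Idl {}) M" unfolding ideal_smult_def by simp
qed

text \<open>
  Each element counted in \<open>I\<^sub>i\<close> shifts the coefficients by \<open>\<epsilon>\<^sub>i\<close>, so after \<open>j\<close> elements the total shift
  is the type of the initial segment of length \<open>j\<close>.
\<close>
lemma has_hilbert_coeffs_sequence:
  assumes R: "noetherian_ring R" and N: noetherian and len: "length is = length xs"
    and FC: "\<And>j. j < length xs \<Longrightarrow> weak_FC_element R d I (quot_by_elements R M (take j xs)) (is ! j) (xs ! j)"
    and e: "has_hilbert_coeffs {\<zero>\<^bsub>M\<^esub>} e" and "j \<le> length xs"
  shows "set (take j xs) \<subseteq> carrier R \<and> submodule (ideal_smult R (Idl (set (take j xs))) M) R M \<and>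
    has_hilbert_coeffs (ideal_smult R (Idl (set (take j xs))) M)
      (\<lambda>k. e (\<lambda>i. k i + count_list (take j is) i))"
  using \<open>j \<le> length xs\<close>
proof (induction j)
  case 0
  then show ?case using e by (simp add: ideal_smult_genideal_empty zero_submodule)
next
  case (Suc j)
  let ?P = "ideal_smult R (Idl (set (take j xs))) M"
  have j: "j < length xs" using Suc.prems by simp
  have IH: "set (take j xs) \<subseteq> carrier R" "submodule ?P R M"
    "has_hilbert_coeffs ?P (\<lambda>k. e (\<lambda>i. k i + count_list (take j is) i))" using Suc by auto
  have FCj: "weak_FC_element R d I (quot_module M ?P) (is ! j) (xs ! j)"
    using FC[OF j] unfolding quot_by_elements_def .
  have a: "xs ! j \<in> carrier R"
    using weak_FC_element_quotD(1,2)[OF IH(2) FCj] ideal.Icarr[OF ideals] by blast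
  have set_Suc: "set (take (Suc j) xs) = insert (xs ! j) (set (take j xs))"
    using j by (simp add: take_Suc_conv_app_nth)
  have P': "ideal_smult R (Idl (set (take (Suc j) xs))) M = ?P \<uplus> mul (xs ! j) (carrier M)"
    unfolding set_Suc by (rule ideal_smult_genideal_insert[OF IH(1) a])
  have "shift_coeffs (is ! j) (\<lambda>k. e (\<lambda>i. k i + count_list (take j is) i)) =
      (\<lambda>k. e (\<lambda>i. k i + count_list (take (Suc j) is) i))"
  proof
    fix k
    have "(\<lambda>i. (k(is ! j := Suc (k (is ! j)))) i + count_list (take j is) i) =
        (\<lambda>i. k i + count_list (take (Suc j) is) i)"
      using j len by (auto simp: take_Suc_conv_app_nth)
    then show "shift_coeffs (is ! j) (\<lambda>k. e (\<lambda>i. k i + count_list (take j is) i)) k =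
        e (\<lambda>i. k i + count_list (take (Suc j) is) i)" unfolding shift_coeffs_def by simp
  qed
  then have "has_hilbert_coeffs (?P \<uplus> mul (xs ! j) (carrier M))
      (\<lambda>k. e (\<lambda>i. k i + count_list (take (Suc j) is) i))"
    using has_hilbert_coeffs_step[OF R N IH(2) FCj IH(3)] by simp
  then show ?case unfolding P' using set_Suc IH(1) a
      submodule_sum[OF IH(2) mul_submodule[OF carrier_is_submodule a]] by simp
qed

end

lemma hilbert_coeff_eqI:
  assumes "is_hilbert_coeffs R d F e"
  shows "hilbert_coeff R d F = e"
  unfolding hilbert_coeff_def
proof (rule the_equality)
  show "is_hilbert_coeffs R d F e" by (rule assms)
next
  fix e' assume e': "is_hilbert_coeffs R d F e'"
  have c: "coeff_family d e" "coeff_family d e'"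
    using assms e' unfolding is_hilbert_coeffs_def coeff_family_def by auto
  have "for_all_large d (\<lambda>n. \<exists>l. module_length R (F n) = enat l \<and> int l = binomial_sum d e n)"
    "for_all_large d (\<lambda>n. \<exists>l. module_length R (F n) = enat l \<and> int l = binomial_sum d e' n)"
    using assms e' unfolding is_hilbert_coeffs_def binomial_sum_def by auto
  from for_all_large_conj[OF this]
  have "for_all_large d (\<lambda>n. binomial_sum d (\<lambda>k. 1 * e k + (-1) * e' k) n = 0)"
    by (rule for_all_large_mono) (auto simp: binomial_sum_lin[OF c, of 1 "-1", simplified])
  from binomial_sum_zero_imp[OF coeff_family_lin[OF c] this]
  show "e' = e" by (auto simp: fun_eq_iff)
qed

theorem corollary3p9:
  fixes R :: "('a, 'r) ring_scheme" and N :: "('a, 'b, 'm) module_scheme"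
    and \<nn> J :: "'a set" and I :: "nat \<Rightarrow> 'a set"
    and d :: nat and k h :: "nat \<Rightarrow> nat" and xs :: "'a list"
  assumes "local_ring R \<nn>" and "noetherian_ring R"
    and "infinite (carrier (R Quot \<nn>))"
    and "fin_gen_module R N"
    and "d \<ge> 1"
    and "primary_to R \<nn> J"
    and "\<And>i. i \<in> {1..d} \<Longrightarrow> ideal (I i) R"
    and "I 0 = J"
    and "k \<in> multi_indices d" and "h \<in> multi_indices d" and "h \<le> k"
    and "mixed_mult_defined R d I N k"
    and "weak_FC_sequence_of_type R d I N xs h"
  shows "mixed_mult_defined R d I (quot_by_elements R N xs) (\<lambda>i. k i - h i) \<and>
    mixed_mult R d I N k = mixed_mult R d I (quot_by_elements R N xs) (\<lambda>i. k i - h i)"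
proof -
  have J: "ideal J R" "ideal_radical R J = \<nn>"
    using assms(6) unfolding primary_to_def primary_ideal_def by auto
  have mx: "maximalideal \<nn> R" using assms(1) unfolding local_ring_def by blast
  interpret module R N using assms(4) unfolding fin_gen_module_def by blast
  have ideals: "ideal (I i) R" if "i \<le> d" for i
    using assms(7)[of i] assms(8) J(1) that by (cases "i = 0") auto
  interpret module_with_ideals R N d I
    by (rule module_with_ideals.intro[OF module_axioms module_with_ideals_axioms.intro[OF ideals]])
  have N: noetherian by (rule noetherian_if_fin_gen[OF assms(2,4)])
  have JN: "submodule (ideal_smult R (I 0) N) R N"
    unfolding ideal_smult_def by (rule mod_span_submodule) (use ideal.Icarr[OF ideals] in auto)
  have "len (ideal_smult R (I 0) N) (carrier N) \<noteq> \<infinity>"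
  proof (rule finite_len_above_primary[OF N assms(2) mx JN])
    fix b m assume "b \<in> \<nn>" and m: "m \<in> carrier N"
    then obtain u :: nat where "b [^]\<^bsub>R\<^esub> u \<in> I 0"
      using J(2) assms(8) unfolding ideal_radical_def by blast
    then have "(b [^]\<^bsub>R\<^esub> u) \<odot>\<^bsub>N\<^esub> m \<in> ideal_smult R (I 0) N"
      unfolding ideal_smult_def by (intro subsetD[OF mod_span_superset]) (use m in blast)
    then show "\<exists>u::nat. (b [^]\<^bsub>R\<^esub> u) \<odot>\<^bsub>N\<^esub> m \<in> ideal_smult R (I 0) N" ..
  qed
  from hilbert_polynomial_exists[OF assms(2) N this] obtain e where e: "coeff_family d e"
    "for_all_large d (\<lambda>n. \<exists>l. len (power_submodule (n(0 := Suc (n 0)))) (power_submodule n) = enat l \<and>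
      int l = binomial_sum d e n)" by blast
  have eN: "hilbert_coeff R d (mixed_component R d I N) = e"
    by (rule hilbert_coeff_eqI)
      (use e in \<open>simp add: is_hilbert_coeffs_def module_length_mixed_component coeff_family_def binomial_sum_def\<close>)
  obtain "is" where FC: "length is = length xs"
    "\<And>j. j < length xs \<Longrightarrow> weak_FC_element R d I (quot_by_elements R N (take j xs)) (is ! j) (xs ! j)"
    "\<And>i. h i = count_list is i"
    using assms(13) unfolding weak_FC_sequence_of_type_def by blast
  have e0: "has_hilbert_coeffs {\<zero>\<^bsub>N\<^esub>} e"
    unfolding has_hilbert_coeffs_def rel_hilbert_function_zero using e by blast
  let ?P = "ideal_smult R (Idl\<^bsub>R\<^esub> (set xs)) N"
  have P: "submodule ?P R N" "has_hilbert_coeffs ?P (\<lambda>l. e (\<lambda>i. l i + h i))"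
    using has_hilbert_coeffs_sequence[OF assms(2) N FC(1,2) e0, of "length xs"] FC(1)
    by (simp_all add: FC(3))
  have eP: "hilbert_coeff R d (mixed_component R d I (quot_by_elements R N xs)) = (\<lambda>l. e (\<lambda>i. l i + h i))"
    by (rule hilbert_coeff_eqI)
      (use P(2) in \<open>simp add: is_hilbert_coeffs_def quot_by_elements_def module_length_mixed_component_quot[OF P(1)]
        has_hilbert_coeffs_def coeff_family_def binomial_sum_def\<close>)
  have kh: "k i - h i + h i = k i" for i using assms(11) by (simp add: le_fun_def)
  show ?thesis
  proof
    show "mixed_mult R d I N k = mixed_mult R d I (quot_by_elements R N xs) (\<lambda>i. k i - h i)"
      unfolding mixed_mult_def eN eP by (simp add: kh)
    show "mixed_mult_defined R d I (quot_by_elements R N xs) (\<lambda>i. k i - h i)"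
      unfolding mixed_mult_defined_def eP
    proof (intro ballI impI)
      fix l assume l: "l \<in> multi_indices d" "l \<noteq> (\<lambda>i. k i - h i) \<and> (\<lambda>i. k i - h i) \<le> l"
      have "(\<lambda>i. l i + h i) \<in> multi_indices d" using l(1) assms(10) by (simp add: multi_indices_def)
      moreover have "(\<lambda>i. l i + h i) \<noteq> k" using l(2) by auto
      moreover have "k \<le> (\<lambda>i. l i + h i)"
        using l(2) by (auto simp: le_fun_def le_diff_conv)
      ultimately show "e (\<lambda>i. l i + h i) = 0"
        using assms(12) unfolding mixed_mult_defined_def eN by blast
    qed
  qed
qed

end
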